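(* Let $G$ be a non-discrete locally compact group and let $X$ and $Y$ be subalgebras of $L^\infty(G)^*$ (with the first Arens product) with $L_0^\infty(G)^*\subset Y\subset X$. Then there are no trivolutions of $X$ onto $Y$. In particular, $L^\infty(G)^*$ has no trivolutions with range $L_0^\infty(G)^*$.
   Context: $L^\infty(G)^*=L^1(G)^{**}$ carries the first Arens product: for $\lambda\in L^\infty(G)=L^1(G)^*$, $a,b\in L^1(G)$, $\Phi,\Psi\in L^\infty(G)^*$, $\langle\lambda\cdot a,b\rangle=\langle\lambda,a*b\rangle$, $\langle\Psi\cdot\lambda,a\rangle=\langle\Psi,\lambda\cdot a\rangle$, $\langle\Phi\Box\Psi,\lambda\rangle=\langle\Phi,\Psi\cdot\lambda\rangle$. $L_0^\infty(G)$ is the closed ideal of $L^\infty(G)$ of all $f$ such that for every $\epsilon>0$ there is a compact $K\subset G$ with $\operatorname{ess\,sup}\{|f(x)|\colon x\in G\setminus K\}<\epsilon$. One has the Banach space direct sum $L^\infty(G)^*=L_0^\infty(G)^\circ\oplus L_0^\infty(G)^*$ (with $L_0^\infty(G)^\circ$ the annihilator of $L_0^\infty(G)$), in which $L_0^\infty(G)^*$ is identified with the closed subalgebra of $L^\infty(G)^*$ that is the norm closure of the elements with compact carrier, $F\in L^\infty(G)^*$ having compact carrier if for some compact $K\subset G$, $F(f)=F(\chi_Kf)$ for every $f\in L^\infty(G)$. A trivolution on a complex algebra $X$ is a non-zero conjugate-linear anti-homomorphism $\tau\colon X\to X$ (so $\tau(xy)=\tau(y)\tau(x)$) with $\tau^3=\tau\circ\tau\circ\tau=\tau$;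 on a normed algebra it is additionally assumed that $\|\tau\|=1$. A trivolution of $X$ onto $Y$ is a trivolution $\tau$ on $X$ with $\tau(X)=Y$. *)

theory Defs
  imports "HOL-Analysis.Analysis"
begin

text \<open>
  Groups are written additively, following the (non-commutative) class \<open>group_add\<close>:
  \<open>y + x\<close> stands for the product \<open>yx\<close> and \<open>- y + x\<close> for \<open>y\<inverse>x\<close>.
\<close>

definition left_haar_measure :: "'g::{topological_group_add, t2_space} measure \<Rightarrow> bool" where
  "left_haar_measure M \<longleftrightarrow>
     sets M = sets borel \<and>
     (\<forall>K. compact K \<longrightarrow> emeasure M K < \<infinity>) \<and>
     (\<forall>A\<in>sets borel. emeasure M A = (INF U\<in>{U. open U \<and> A \<subseteq> U}. emeasure M U)) \<and>
     (\<forall>U. open U \<longrightarrow> emeasure M U = (SUP K\<in>{K. compact K \<and> K \<subseteq> U}. emeasure M K)) \<and>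
     (\<forall>g. \<forall>A\<in>sets borel. emeasure M ((+) g ` A) = emeasure M A) \<and>
     emeasure M UNIV \<noteq> 0"

text \<open>
  \<open>L\<^sup>1\<close> and \<open>L\<^sup>\<infinity>\<close> are handled through representatives, without forming quotients: \<open>L\<^sup>1\<close> consists
  of the functions with \<open>integrable M\<close>, and functionals on \<open>L\<^sup>\<infinity>\<close> are bounded for the essential
  supremum seminorm, hence do not see locally null sets.

  As the group need not be \<open>\<sigma>\<close>-compact, measurability and null sets in \<open>L\<^sup>\<infinity>\<close> are taken locally,
  i.e. on sets of finite measure. With this convention \<open>L\<^sup>\<infinity>\<close> is the dual of \<open>L\<^sup>1\<close> for the
  Haar measure of every locally compact group.
\<close>

definition loc_AE :: "'g measure \<Rightarrow> ('g \<Rightarrow> bool) \<Rightarrow> bool" where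
  "loc_AE M P \<longleftrightarrow>
     (\<forall>A\<in>sets M. emeasure M A < \<infinity> \<longrightarrow> (AE x in M. x \<in> A \<longrightarrow> P x))"

definition Linf :: "'g measure \<Rightarrow> ('g \<Rightarrow> complex) set" where
  "Linf M = {f.
     (\<forall>A\<in>sets M. emeasure M A < \<infinity> \<longrightarrow> (\<lambda>x. indicator A x * f x) \<in> borel_measurable M) \<and>
     (\<exists>C. loc_AE M (\<lambda>x. norm (f x) \<le> C))}"

definition Linf_norm :: "'g measure \<Rightarrow> ('g \<Rightarrow> complex) \<Rightarrow> real" where
  "Linf_norm M f = Inf {C. 0 \<le> C \<and> loc_AE M (\<lambda>x. norm (f x) \<le> C)}"

text \<open>The value 0 outside \<open>Linf M\<close> makes a functional determined by its values on \<open>Linf M\<close>.\<close>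

definition Linf_dual :: "'g measure \<Rightarrow> (('g \<Rightarrow> complex) \<Rightarrow> complex) set" where
  "Linf_dual M = {F.
     (\<forall>f. f \<notin> Linf M \<longrightarrow> F f = 0) \<and>
     (\<forall>f\<in>Linf M. \<forall>g\<in>Linf M. F (\<lambda>x. f x + g x) = F f + F g) \<and>
     (\<forall>c. \<forall>f\<in>Linf M. F (\<lambda>x. c * f x) = c * F f) \<and>
     (\<exists>B. \<forall>f\<in>Linf M. norm (F f) \<le> B * Linf_norm M f)}"

definition Linf_dual_norm :: "'g measure \<Rightarrow> (('g \<Rightarrow> complex) \<Rightarrow> complex) \<Rightarrow> real" where
  "Linf_dual_norm M F = (SUP f\<in>{f \<in> Linf M. Linf_norm M f \<le> 1}. norm (F f))"

definition L1_conv ::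
    "'g::{topological_group_add, t2_space} measure \<Rightarrow> ('g \<Rightarrow> complex) \<Rightarrow> ('g \<Rightarrow> complex) \<Rightarrow> 'g \<Rightarrow> complex" where
  "L1_conv M a b = (\<lambda>x. \<integral>y. a y * b (- y + x) \<partial>M)"

text \<open>
  The identification of \<open>L\<^sup>1(G)\<^sup>*\<close> with \<open>L\<^sup>\<infinity>(G)\<close>: a function representing the functional \<open>\<phi>\<close> on \<open>L\<^sup>1(G)\<close>
  under \<open>\<langle>h, a\<rangle> = \<integral> h a\<close>. It is determined up to locally null sets, so the Arens product below
  does not depend on the choice.
\<close>

definition L1_dual_rep :: "'g measure \<Rightarrow> (('g \<Rightarrow> complex) \<Rightarrow> complex) \<Rightarrow> 'g \<Rightarrow> complex" where
  "L1_dual_rep M \<phi> =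
     (SOME h. h \<in> Linf M \<and> (\<forall>a. integrable M a \<longrightarrow> (\<integral>x. h x * a x \<partial>M) = \<phi> a))"

text \<open>\<open>\<langle>l \<cdot> a, b\<rangle> = \<langle>l, a * b\<rangle>\<close>\<close>

definition Linf_act_L1 ::
    "'g::{topological_group_add, t2_space} measure \<Rightarrow> ('g \<Rightarrow> complex) \<Rightarrow> ('g \<Rightarrow> complex) \<Rightarrow> 'g \<Rightarrow> complex" where
  "Linf_act_L1 M l a = L1_dual_rep M (\<lambda>b. \<integral>x. l x * L1_conv M a b x \<partial>M)"

text \<open>\<open>\<langle>\<Psi> \<cdot> l, a\<rangle> = \<langle>\<Psi>, l \<cdot> a\<rangle>\<close>\<close>

definition dual_act_Linf ::
    "'g::{topological_group_add, t2_space} measure \<Rightarrow> (('g \<Rightarrow> complex) \<Rightarrow> complex) \<Rightarrow> ('g \<Rightarrow> complex) \<Rightarrow> 'g \<Rightarrow> complex" where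
  "dual_act_Linf M \<Psi> l = L1_dual_rep M (\<lambda>a. \<Psi> (Linf_act_L1 M l a))"

definition arens ::
    "'g::{topological_group_add, t2_space} measure \<Rightarrow> (('g \<Rightarrow> complex) \<Rightarrow> complex) \<Rightarrow>
     (('g \<Rightarrow> complex) \<Rightarrow> complex) \<Rightarrow> ('g \<Rightarrow> complex) \<Rightarrow> complex" where
  "arens M \<Phi> \<Psi> = (\<lambda>l. if l \<in> Linf M then \<Phi> (dual_act_Linf M \<Psi> l) else 0)"

definition compact_carrier ::
    "'g::{topological_group_add, t2_space} measure \<Rightarrow> (('g \<Rightarrow> complex) \<Rightarrow> complex) \<Rightarrow> bool" where
  "compact_carrier M F \<longleftrightarrow>
     (\<exists>K. compact K \<and> (\<forall>f\<in>Linf M. F f = F (\<lambda>x. indicator K x * f x)))"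

text \<open>
  \<open>L\<^sub>0\<^sup>\<infinity>(G)\<^sup>*\<close> in its identification with a subalgebra of \<open>L\<^sup>\<infinity>(G)\<^sup>*\<close>: the norm closure of
  the functionals with compact carrier.
\<close>

definition Linf0_dual ::
    "'g::{topological_group_add, t2_space} measure \<Rightarrow> (('g \<Rightarrow> complex) \<Rightarrow> complex) set" where
  "Linf0_dual M = {F \<in> Linf_dual M.
     \<forall>\<epsilon>>0. \<exists>F'\<in>Linf_dual M. compact_carrier M F' \<and> Linf_dual_norm M (\<lambda>f. F f - F' f) < \<epsilon>}"

definition arens_subalgebra ::
    "'g::{topological_group_add, t2_space} measure \<Rightarrow> (('g \<Rightarrow> complex) \<Rightarrow> complex) set \<Rightarrow> bool" where
  "arens_subalgebra M X \<longleftrightarrow>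
     X \<subseteq> Linf_dual M \<and>
     (\<lambda>f. 0) \<in> X \<and>
     (\<forall>F\<in>X. \<forall>G\<in>X. (\<lambda>f. F f + G f) \<in> X) \<and>
     (\<forall>c. \<forall>F\<in>X. (\<lambda>f. c * F f) \<in> X) \<and>
     (\<forall>F\<in>X. \<forall>G\<in>X. arens M F G \<in> X)"

text \<open>
  A trivolution on the normed algebra \<open>X\<close>; only the values of \<open>\<tau>\<close> on \<open>X\<close> matter. The last condition
  says that the operator norm of \<open>\<tau>\<close> on \<open>X\<close> is 1; the supremum is taken in \<open>ennreal\<close>, so that
  boundedness is part of it.
\<close>

definition trivolution ::
    "'g::{topological_group_add, t2_space} measure \<Rightarrow> (('g \<Rightarrow> complex) \<Rightarrow> complex) set \<Rightarrow>
     ((('g \<Rightarrow> complex) \<Rightarrow> complex) \<Rightarrow> (('g \<Rightarrow> complex) \<Rightarrow> complex)) \<Rightarrow> bool" where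
  "trivolution M X \<tau> \<longleftrightarrow>
     (\<forall>F\<in>X. \<tau> F \<in> X) \<and>
     (\<exists>F\<in>X. \<tau> F \<noteq> (\<lambda>f. 0)) \<and>
     (\<forall>F\<in>X. \<forall>G\<in>X. \<tau> (\<lambda>f. F f + G f) = (\<lambda>f. \<tau> F f + \<tau> G f)) \<and>
     (\<forall>c. \<forall>F\<in>X. \<tau> (\<lambda>f. c * F f) = (\<lambda>f. cnj c * \<tau> F f)) \<and>
     (\<forall>F\<in>X. \<forall>G\<in>X. \<tau> (arens M F G) = arens M (\<tau> G) (\<tau> F)) \<and>
     (\<forall>F\<in>X. \<tau> (\<tau> (\<tau> F)) = \<tau> F) \<and>
     (SUP F\<in>{F \<in> X. Linf_dual_norm M F \<le> 1}. ennreal (Linf_dual_norm M (\<tau> F))) = 1"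

definition trivolution_onto ::
    "'g::{topological_group_add, t2_space} measure \<Rightarrow> (('g \<Rightarrow> complex) \<Rightarrow> complex) set \<Rightarrow>
     (('g \<Rightarrow> complex) \<Rightarrow> complex) set \<Rightarrow>
     ((('g \<Rightarrow> complex) \<Rightarrow> complex) \<Rightarrow> (('g \<Rightarrow> complex) \<Rightarrow> complex)) \<Rightarrow> bool" where
  "trivolution_onto M X Y \<tau> \<longleftrightarrow> trivolution M X \<tau> \<and> \<tau> ` X = Y"

end

theory Submission
  imports Defs
begin

text \<open>
A trivolution \<open>\<tau>\<close> of \<open>X\<close> onto \<open>Y\<close> restricts to an anti-automorphism of period two of \<open>Y = \<tau>(X)\<close>, because
  \<open>\<tau>\<^sup>3 = \<tau>\<close>. It therefore turns one-sided phenomena in \<open>Y\<close> into the opposite ones. The algebra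
  \<open>L\<^sub>0\<^sup>\<infinity>(G)\<^sup>*\<close> is too lopsided for that when \<open>G\<close> is not discrete: it contains a right identity \<open>E\<close> of
  \<open>L\<^sup>\<infinity>(G)\<^sup>*\<close>, and also an element \<open>N \<noteq> 0\<close> with \<open>F \<box> N = 0\<close> for all \<open>F\<close>
  (\<open>right_identity_and_annihilator\<close>). Choose \<open>F\<close> with \<open>\<tau>(F) = E\<close>. Then
  \<open>\<tau>(N) = \<tau>(N) \<box> \<tau>(F) = \<tau>(F \<box> N) = 0\<close>, and \<open>N = \<tau>(\<tau>(N)) = 0\<close>, a contradiction
  (\<open>no_trivolution_onto\<close>).

  A functional \<open>E\<close> is a right identity as soon as \<open>\<langle>E, l \<cdot> a\<rangle> = \<integral> l a\<close> for all \<open>l\<close> and \<open>a\<close>. Such \<open>E\<close>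
  are obtained as weak-star cluster points of the averages \<open>f \<mapsto> (\<integral>\<^sub>A f) / |A|\<close> for Borel sets \<open>A\<close>
  shrinking to the neutral element (\<open>cluster_point_of_averages\<close>), since the normalised indicators
  of these sets form a right approximate identity of \<open>L\<^sup>1(G)\<close> (\<open>L1_right_approximate_identity\<close>). In a
  non-discrete group there is a Borel set \<open>W\<close> such that \<open>W\<close> and its complement both meet every
  neighbourhood of the neutral element in positive measure (\<open>oscillating_set\<close>). Averaging inside \<open>W\<close> and inside
  its complement gives two right identities, which the indicator of \<open>W\<close> tells apart; \<open>N\<close> is their
  difference.

  The analytic work lies in the module action \<open>l \<cdot> a\<close>, that is, in the identity
  \<open>\<integral> l (a * b) = \<integral> (\<integral> a(y) l(yz) dy) b(z) dz\<close> (\<open>L1_conv_pairing\<close>). The functions involved are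
  Borel functions on \<open>G \<times> G\<close>, and for a group without a countable base the Borel sets of \<open>G \<times> G\<close>
  may form a larger \<open>\<sigma>\<close>-algebra than the product of the Borel \<open>\<sigma>\<close>-algebras. Tonelli's theorem is
  thus proved for Radon measures and the Borel \<open>\<sigma>\<close>-algebra of the product, where inner
  regularity reduces open sets to sets of the product \<open>\<sigma>\<close>-algebra. The lack of \<open>\<sigma>\<close>-finiteness is
  harmless because every set of finite measure lies in a \<open>\<sigma>\<close>-compact set.
\<close>

section \<open>Tonelli for Radon measures on the Borel sets of a product\<close>

text \<open>Inner regularity is required on all Borel sets and not only on open ones: the comparison of
  iterated measures below exhausts a Borel set of base points by compact sets.\<close>

definition finite_radon :: "'a::t2_space measure \<Rightarrow> bool" where
  "finite_radon \<nu> \<longleftrightarrow> finite_measure \<nu> \<and> sets \<nu> = sets borel \<and>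
     (\<forall>B\<in>sets borel. \<forall>c<emeasure \<nu> B. \<exists>C. compact C \<and> C \<subseteq> B \<and> c < emeasure \<nu> C)"

lemma finite_radon_inner:
  assumes "finite_radon \<nu>" "B \<in> sets borel" "c < emeasure \<nu> B"
  shows "\<exists>C. compact C \<and> C \<subseteq> B \<and> c < emeasure \<nu> C"
  using assms unfolding finite_radon_def by blast

lemma borel_vimage_Pair:
  fixes B :: "('a::topological_space \<times> 'b::topological_space) set"
  assumes "B \<in> sets borel"
  shows "Pair x -` B \<in> sets borel" "(\<lambda>x. (x, y)) -` B \<in> sets borel"
proof -
  have "Pair x \<in> borel_measurable borel"
    by (intro borel_measurable_continuous_onI continuous_intros)
  from measurable_sets[OF this assms] show "Pair x -` B \<in> sets borel" by simp
  have "(\<lambda>x. (x, y)) \<in> borel_measurable borel"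
    by (intro borel_measurable_continuous_onI continuous_intros)
  from measurable_sets[OF this assms] show "(\<lambda>x. (x, y)) -` B \<in> sets borel" by simp
qed

text \<open>Lower semicontinuity of section measures. A compact part of the section at \<open>x\<close> stays inside the
  sections at all nearby points by the tube lemma.\<close>

lemma open_section_measure_gt:
  fixes W :: "('a::t2_space \<times> 'b::t2_space) set"
  assumes "finite_radon \<nu>" "open W"
  shows "open {x. c < emeasure \<nu> (Pair x -` W)}"
proof (rule topological_space_class.openI)
  fix x assume "x \<in> {x. c < emeasure \<nu> (Pair x -` W)}"
  then have "c < emeasure \<nu> (Pair x -` W)" by simp
  moreover have "Pair x -` W \<in> sets borel"
    by (rule borel_vimage_Pair(1)[OF borel_open[OF assms(2)]])
  ultimately obtain C where C: "compact C" "C \<subseteq> Pair x -` W" "c < emeasure \<nu> C"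
    using finite_radon_inner[OF assms(1)] by metis
  have "{x} \<times> C \<subseteq> W" using C(2) by blast
  then obtain U where U: "x \<in> U" "open U" "U \<times> C \<subseteq> W"
    using Elementary_Topology.tube_lemma[OF C(1) assms(2)] by metis
  have "c < emeasure \<nu> (Pair x' -` W)" if "x' \<in> U" for x'
  proof -
    have "emeasure \<nu> C \<le> emeasure \<nu> (Pair x' -` W)"
    proof (rule emeasure_mono)
      show "C \<subseteq> Pair x' -` W" using that U(3) by blast
      show "Pair x' -` W \<in> sets \<nu>"
        using assms borel_vimage_Pair(1)[of W x'] by (simp add: finite_radon_def)
    qed
    with C(3) show ?thesis by simp
  qed
  with U show "\<exists>T. open T \<and> x \<in> T \<and> T \<subseteq> {x. c < emeasure \<nu> (Pair x -` W)}" by blast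
qed

lemma open_section_measure_measurable:
  fixes W :: "('a::t2_space \<times> 'b::t2_space) set"
  assumes "finite_radon \<nu>" "open W"
  shows "(\<lambda>x. emeasure \<nu> (Pair x -` W)) \<in> borel_measurable borel"
  by (rule borel_measurableI_greater) (use open_section_measure_gt[OF assms] in simp)

lemma open_swap:
  fixes W :: "('a::topological_space \<times> 'b::topological_space) set"
  assumes "open W"
  shows "open (prod.swap -` W)"
  by (rule open_vimage[OF assms]) (simp add: prod.swap_def[abs_def] continuous_on_Pair continuous_on_snd continuous_on_fst)

text \<open>An open set \<open>W\<close> need not belong to the product \<open>\<sigma>\<close>-algebra, but it contains a largest measurable
  set \<open>Q\<close> up to null sets, and \<open>Q\<close> already fills almost every section of \<open>W\<close>. Otherwise, for some
  rational \<open>t\<close>, there is a non-null compact set of base points where the section of \<open>Q\<close> has measure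
  at most \<open>t\<close> and that of \<open>W\<close> more than \<open>t\<close>. Finitely many boxes with compact fibres inside \<open>W\<close> have
  sections of measure above \<open>t\<close> over that compact set, and adding them to \<open>Q\<close> contradicts maximality.
  The ordinary Tonelli theorem for \<open>Q\<close> gives the inequality.\<close>

lemma iterated_measure_open_le:
  fixes W :: "('a::t2_space \<times> 'b::t2_space) set"
  assumes r1: "finite_radon \<nu>1" and r2: "finite_radon \<nu>2" and W: "open W"
  shows "(\<integral>\<^sup>+x. emeasure \<nu>2 (Pair x -` W) \<partial>\<nu>1) \<le> (\<integral>\<^sup>+y. emeasure \<nu>1 ((\<lambda>x. (x, y)) -` W) \<partial>\<nu>2)"
proof -
  interpret f1: finite_measure \<nu>1 using r1 by (simp add: finite_radon_def)
  interpret f2: finite_measure \<nu>2 using r2 by (simp add: finite_radon_def)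
  interpret pair_sigma_finite \<nu>1 \<nu>2 ..
  interpret P: finite_measure "\<nu>1 \<Otimes>\<^sub>M \<nu>2" by (rule finite_measure_pair_measure) unfold_locales
  have s1[simp]: "sets \<nu>1 = sets borel" and s2[simp]: "sets \<nu>2 = sets borel"
    using r1 r2 by (auto simp: finite_radon_def)
  have sp1[simp]: "space \<nu>1 = UNIV" and sp2[simp]: "space \<nu>2 = UNIV"
    using sets_eq_imp_space_eq[OF s1] sets_eq_imp_space_eq[OF s2] by auto
  let ?P = "\<nu>1 \<Otimes>\<^sub>M \<nu>2"
  let ?Q = "{Q \<in> sets ?P. Q \<subseteq> W}"
  have "emeasure ?P ` ?Q \<noteq> {}" by auto
  from ennreal_Sup_countable_SUP[OF this] obtain e :: "nat \<Rightarrow> ennreal" where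
    e: "range e \<subseteq> emeasure ?P ` ?Q" "(SUP Q\<in>?Q. emeasure ?P Q) = (SUP i. e i)" by blast
  have "\<forall>i. \<exists>Q\<in>?Q. e i = emeasure ?P Q" using e(1) by blast
  then obtain q where q: "\<And>i. q i \<in> ?Q" "\<And>i. e i = emeasure ?P (q i)" by metis
  define Q where "Q = (\<Union>i. q i)"
  have Q: "Q \<in> sets ?P" "Q \<subseteq> W" using q(1) unfolding Q_def by auto
  have sup: "emeasure ?P R \<le> emeasure ?P Q" if "R \<in> ?Q" for R
  proof -
    have "emeasure ?P R \<le> (SUP i. e i)" unfolding e(2)[symmetric] using that by (rule SUP_upper)
    also have "\<dots> \<le> emeasure ?P Q"
      unfolding q(2) by (rule SUP_least, rule emeasure_mono) (use Q q in \<open>auto simp: Q_def\<close>)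
    finally show ?thesis .
  qed
  let ?f = "\<lambda>x. emeasure \<nu>2 (Pair x -` W)" and ?q = "\<lambda>x. emeasure \<nu>2 (Pair x -` Q)"
  have mf: "?f \<in> borel_measurable \<nu>1"
    using open_section_measure_measurable[OF r2 W] by (simp cong: measurable_cong_sets)
  have mq: "?q \<in> borel_measurable \<nu>1" by (rule measurable_emeasure_Pair1[OF Q(1)])
  have "AE x in \<nu>1. ?f x \<le> ?q x"
  proof -
    have "AE x in \<nu>1. \<not> (?q x \<le> ennreal (real_of_rat t) \<and> ennreal (real_of_rat t) < ?f x)" for t :: rat
    proof -
      let ?t = "ennreal (real_of_rat t)"
      let ?B = "{x. ?q x \<le> ?t \<and> ?t < ?f x}"
      have B: "?B \<in> sets \<nu>1"
      proof -
        have "?B = (?q -` {..?t} \<inter> space \<nu>1) \<inter> (?f -` {?t<..} \<inter> space \<nu>1)" by auto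
        then show ?thesis
          using measurable_sets[OF mq, of "{..?t}"] measurable_sets[OF mf, of "{?t<..}"] by simp
      qed
      have "emeasure \<nu>1 ?B = 0"
      proof (rule ccontr)
        assume "emeasure \<nu>1 ?B \<noteq> 0"
        then have "0 < emeasure \<nu>1 ?B" by (simp add: zero_less_iff_neq_zero)
        then obtain K where K: "compact K" "K \<subseteq> ?B" "0 < emeasure \<nu>1 K"
          using r1 B unfolding finite_radon_def s1 by blast
        have "\<exists>C U. compact C \<and> ?t < emeasure \<nu>2 C \<and> x \<in> U \<and> open U \<and> U \<times> C \<subseteq> W"
          if x: "x \<in> K" for x
        proof -
          have "?t < ?f x" using x K(2) by auto
          then obtain C where C: "compact C" "C \<subseteq> Pair x -` W" "?t < emeasure \<nu>2 C"
            using finite_radon_inner[OF r2 borel_vimage_Pair(1)[OF borel_open[OF W]]] by metis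
          have "{x} \<times> C \<subseteq> W" using C(2) by blast
          then show ?thesis using Elementary_Topology.tube_lemma[OF C(1) W] C by metis
        qed
        then obtain C U where CU: "\<And>x. x \<in> K \<Longrightarrow> compact (C x) \<and> ?t < emeasure \<nu>2 (C x) \<and> x \<in> U x \<and> open (U x) \<and> U x \<times> C x \<subseteq> W"
          by metis
        obtain D where D: "D \<subseteq> K" "finite D" "K \<subseteq> (\<Union>x\<in>D. U x)"
        proof (rule compactE_image[OF K(1), of K U])
          show "open (U x)" if "x \<in> K" for x using CU[OF that] by blast
          show "K \<subseteq> (\<Union>x\<in>K. U x)" using CU by blast
        qed
        define R where "R = (\<Union>x\<in>D. U x \<times> C x)"
        have R: "R \<in> sets ?P"
          unfolding R_def
        proof (rule sets.finite_UN[OF D(2)], rule pair_measureI)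
          fix d assume "d \<in> D"
          with D(1) CU have "open (U d)" "compact (C d)" by auto
          then show "U d \<in> sets \<nu>1" "C d \<in> sets \<nu>2" by (simp_all add: borel_compact)
        qed
        have RW: "R \<subseteq> W" unfolding R_def using D(1) CU by blast
        have gt: "?t < emeasure \<nu>2 (Pair x -` (Q \<union> R))" if x: "x \<in> K" for x
        proof -
          obtain d where d: "d \<in> D" "x \<in> U d" using D(3) x by blast
          then have "?t < emeasure \<nu>2 (C d)" using CU D(1) by blast
          also have "\<dots> \<le> emeasure \<nu>2 (Pair x -` (Q \<union> R))"
            using d sets_Pair1[OF sets.Un[OF Q(1) R], of x] by (intro emeasure_mono) (auto simp: R_def)
          finally show ?thesis .
        qed
        have "emeasure ?P Q < emeasure ?P (Q \<union> R)"
          unfolding f2.emeasure_pair_measure_alt[OF Q(1)] f2.emeasure_pair_measure_alt[OF sets.Un[OF Q(1) R]]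
        proof (rule nn_integral_less)
          show "(\<integral>\<^sup>+ x. emeasure \<nu>2 (Pair x -` Q) \<partial>\<nu>1) \<noteq> \<infinity>"
            using P.emeasure_finite[of Q] unfolding f2.emeasure_pair_measure_alt[OF Q(1)] by simp
          show "(\<lambda>x. emeasure \<nu>2 (Pair x -` Q)) \<in> borel_measurable \<nu>1" by (rule mq)
          show "(\<lambda>x. emeasure \<nu>2 (Pair x -` (Q \<union> R))) \<in> borel_measurable \<nu>1"
            by (rule measurable_emeasure_Pair1) (use Q R in auto)
          show "AE x in \<nu>1. emeasure \<nu>2 (Pair x -` Q) \<le> emeasure \<nu>2 (Pair x -` (Q \<union> R))"
            using sets_Pair1[OF sets.Un[OF Q(1) R]] by (intro AE_I2 emeasure_mono) auto
          show "\<not> (AE x in \<nu>1. emeasure \<nu>2 (Pair x -` (Q \<union> R)) \<le> emeasure \<nu>2 (Pair x -` Q))"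
          proof
            assume "AE x in \<nu>1. emeasure \<nu>2 (Pair x -` (Q \<union> R)) \<le> emeasure \<nu>2 (Pair x -` Q)"
            then have "AE x in \<nu>1. x \<notin> K"
            proof (rule AE_mp, intro AE_I2 impI notI)
              fix x assume "emeasure \<nu>2 (Pair x -` (Q \<union> R)) \<le> ?q x" "x \<in> K"
              moreover have "?q x \<le> ?t" using \<open>x \<in> K\<close> K(2) by auto
              ultimately show False using gt[of x] by auto
            qed
            then have "emeasure \<nu>1 K = 0"
              using K(1) AE_iff_null_sets[of K \<nu>1] borel_compact[OF K(1)] by (simp add: null_setsD1)
            with K(3) show False by simp
          qed
        qed
        moreover have "emeasure ?P (Q \<union> R) \<le> emeasure ?P Q" by (rule sup) (use Q R RW in auto)
        ultimately show False by simp
      qed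
      then show ?thesis using AE_iff_null_sets[of ?B \<nu>1] B by auto
    qed
    then have "AE x in \<nu>1. \<forall>t::rat. \<not> (?q x \<le> ennreal (real_of_rat t) \<and> ennreal (real_of_rat t) < ?f x)"
      by (subst AE_all_countable) auto
    then show ?thesis
    proof (rule AE_mp, intro AE_I2 impI)
      fix x assume *: "\<forall>t::rat. \<not> (?q x \<le> ennreal (real_of_rat t) \<and> ennreal (real_of_rat t) < ?f x)"
      show "?f x \<le> ?q x"
      proof (rule ccontr)
        assume "\<not> ?f x \<le> ?q x"
        then have "?q x < ?f x" by simp
        from ennreal_rat_dense[OF this] * show False using order.strict_implies_order by blast
      qed
    qed
  qed
  then have "(\<integral>\<^sup>+x. ?f x \<partial>\<nu>1) \<le> (\<integral>\<^sup>+x. ?q x \<partial>\<nu>1)" by (rule nn_integral_mono_AE)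
  also have "\<dots> = (\<integral>\<^sup>+y. emeasure \<nu>1 ((\<lambda>x. (x, y)) -` Q) \<partial>\<nu>2)"
    unfolding emeasure_pair_measure_alt2[OF Q(1), symmetric] f2.emeasure_pair_measure_alt[OF Q(1)] ..
  also have "\<dots> \<le> (\<integral>\<^sup>+y. emeasure \<nu>1 ((\<lambda>x. (x, y)) -` W) \<partial>\<nu>2)"
    using Q borel_vimage_Pair(2)[OF borel_open[OF W]] by (intro nn_integral_mono emeasure_mono) auto
  finally show ?thesis .
qed

lemma iterated_measure_open:
  fixes W :: "('a::t2_space \<times> 'b::t2_space) set"
  assumes r1: "finite_radon \<nu>1" and r2: "finite_radon \<nu>2" and W: "open W"
  shows "(\<integral>\<^sup>+x. emeasure \<nu>2 (Pair x -` W) \<partial>\<nu>1) = (\<integral>\<^sup>+y. emeasure \<nu>1 ((\<lambda>x. (x, y)) -` W) \<partial>\<nu>2)"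
proof (rule antisym[OF iterated_measure_open_le[OF assms]])
  have "Pair y -` prod.swap -` W = (\<lambda>x. (x, y)) -` W" "(\<lambda>y. (y, x)) -` prod.swap -` W = Pair x -` W" for x y
    by auto
  then show "(\<integral>\<^sup>+y. emeasure \<nu>1 ((\<lambda>x. (x, y)) -` W) \<partial>\<nu>2) \<le> (\<integral>\<^sup>+x. emeasure \<nu>2 (Pair x -` W) \<partial>\<nu>1)"
    using iterated_measure_open_le[OF r2 r1 open_swap[OF W]] by simp
qed

text \<open>Open sets form a generator closed under intersections, so both the measurability of the sections
  and the equality pass to all Borel sets by Dynkin's argument.\<close>

lemma iterated_measure_borel:
  fixes B :: "('a::t2_space \<times> 'b::t2_space) set"
  assumes r1: "finite_radon \<nu>1" and r2: "finite_radon \<nu>2" and B: "B \<in> sets borel"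
  shows "(\<lambda>x. emeasure \<nu>2 (Pair x -` B)) \<in> borel_measurable borel \<and>
    (\<lambda>y. emeasure \<nu>1 ((\<lambda>x. (x, y)) -` B)) \<in> borel_measurable borel \<and>
    (\<integral>\<^sup>+x. emeasure \<nu>2 (Pair x -` B) \<partial>\<nu>1) = (\<integral>\<^sup>+y. emeasure \<nu>1 ((\<lambda>x. (x, y)) -` B) \<partial>\<nu>2)"
    (is "?P B")
proof -
  interpret f1: finite_measure \<nu>1 using r1 by (simp add: finite_radon_def)
  interpret f2: finite_measure \<nu>2 using r2 by (simp add: finite_radon_def)
  have s1[simp]: "sets \<nu>1 = sets borel" and s2[simp]: "sets \<nu>2 = sets borel"
    using r1 r2 by (auto simp: finite_radon_def)
  have sp1[simp]: "space \<nu>1 = UNIV" and sp2[simp]: "space \<nu>2 = UNIV"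
    using sets_eq_imp_space_eq[OF s1] sets_eq_imp_space_eq[OF s2] by auto
  have ss: "sigma_sets UNIV {W::('a \<times> 'b) set. open W} = sets borel" by (simp add: borel_def)
  have mc1: "borel_measurable \<nu>1 = borel_measurable borel" and mc2: "borel_measurable \<nu>2 = borel_measurable borel"
    by (auto cong: measurable_cong_sets)
  have ops: "?P W" if "open W" for W
  proof -
    have "Pair y -` prod.swap -` W = (\<lambda>x. (x, y)) -` W" for y by auto
    then show ?thesis
      using open_section_measure_measurable[OF r2 that] open_section_measure_measurable[OF r1 open_swap[OF that]]
        iterated_measure_open[OF r1 r2 that] by simp
  qed
  from B have "B \<in> sigma_sets UNIV {W. open W}" by (simp add: ss)
  then show ?thesis
  proof (rule sigma_sets_induct_disjoint[rotated 2])
    show "Int_stable {W::('a \<times> 'b) set. open W}" by (auto simp: Int_stable_def)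
  next
    fix A assume "A \<in> sigma_sets UNIV {W::('a \<times> 'b) set. open W}" and P: "?P A"
    then have A: "A \<in> sets borel" by (simp add: ss)
    have 1: "emeasure \<nu>2 (Pair x -` (UNIV - A)) = emeasure \<nu>2 UNIV - emeasure \<nu>2 (Pair x -` A)" for x
      using f2.emeasure_finite borel_vimage_Pair(1)[OF A, of x] emeasure_compl[of "Pair x -` A" \<nu>2]
      by (simp add: vimage_Diff)
    have 2: "emeasure \<nu>1 ((\<lambda>x. (x, y)) -` (UNIV - A)) = emeasure \<nu>1 UNIV - emeasure \<nu>1 ((\<lambda>x. (x, y)) -` A)" for y
      using f1.emeasure_finite borel_vimage_Pair(2)[OF A, of y] emeasure_compl[of "(\<lambda>x. (x, y)) -` A" \<nu>1]
      by (simp add: vimage_Diff)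
    have fin: "(\<integral>\<^sup>+x. emeasure \<nu>2 (Pair x -` A) \<partial>\<nu>1) \<noteq> \<infinity>"
    proof -
      have "(\<integral>\<^sup>+x. emeasure \<nu>2 (Pair x -` A) \<partial>\<nu>1) \<le> (\<integral>\<^sup>+x. emeasure \<nu>2 (space \<nu>2) \<partial>\<nu>1)"
        by (intro nn_integral_mono emeasure_space)
      also have "\<dots> < \<infinity>" using f1.emeasure_finite f2.emeasure_finite
        by (simp add: ennreal_mult_eq_top_iff less_top[symmetric])
      finally show ?thesis by simp
    qed
    have "(\<integral>\<^sup>+x. emeasure \<nu>2 UNIV - emeasure \<nu>2 (Pair x -` A) \<partial>\<nu>1)
        = (\<integral>\<^sup>+x. emeasure \<nu>2 UNIV \<partial>\<nu>1) - (\<integral>\<^sup>+x. emeasure \<nu>2 (Pair x -` A) \<partial>\<nu>1)"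
      using P fin emeasure_space[of \<nu>2] by (intro nn_integral_diff) (auto simp: mc1 mc2)
    moreover have "(\<integral>\<^sup>+y. emeasure \<nu>1 UNIV - emeasure \<nu>1 ((\<lambda>x. (x, y)) -` A) \<partial>\<nu>2)
        = (\<integral>\<^sup>+y. emeasure \<nu>1 UNIV \<partial>\<nu>2) - (\<integral>\<^sup>+y. emeasure \<nu>1 ((\<lambda>x. (x, y)) -` A) \<partial>\<nu>2)"
      using P fin emeasure_space[of \<nu>1] by (intro nn_integral_diff) (auto simp: mc1 mc2)
    ultimately show "?P (UNIV - A)"
      unfolding 1 2 using P by (auto simp: mult.commute intro!: borel_measurable_minus_ennreal)
  next
    fix A :: "nat \<Rightarrow> ('a \<times> 'b) set"
    assume dis: "disjoint_family A" and A: "range A \<subseteq> sigma_sets UNIV {W. open W}" and P: "\<And>i. ?P (A i)"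
    then have A: "A i \<in> sets borel" for i by (auto simp: ss)
    have 1: "emeasure \<nu>2 (Pair x -` (\<Union>i. A i)) = (\<Sum>i. emeasure \<nu>2 (Pair x -` A i))" for x
      unfolding vimage_Union image_image vimage_UN
      by (rule suminf_emeasure[symmetric]) (use dis borel_vimage_Pair[OF A] in \<open>auto simp: disjoint_family_on_def\<close>)
    have 2: "emeasure \<nu>1 ((\<lambda>x. (x, y)) -` (\<Union>i. A i)) = (\<Sum>i. emeasure \<nu>1 ((\<lambda>x. (x, y)) -` A i))" for y
      unfolding vimage_Union image_image vimage_UN
      by (rule suminf_emeasure[symmetric]) (use dis borel_vimage_Pair[OF A] in \<open>auto simp: disjoint_family_on_def\<close>)
    show "?P (\<Union>i. A i)"
      unfolding 1 2 using P by (auto simp: nn_integral_suminf mc1 mc2 intro!: borel_measurable_suminf_order)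
  qed (use ops in \<open>auto simp: ss\<close>)
qed

lemma nn_integral_swap_finite_radon:
  fixes F :: "('a::t2_space \<times> 'b::t2_space) \<Rightarrow> ennreal"
  assumes r1: "finite_radon \<nu>1" and r2: "finite_radon \<nu>2" and F: "F \<in> borel_measurable borel"
  shows "(\<lambda>x. \<integral>\<^sup>+y. F (x, y) \<partial>\<nu>2) \<in> borel_measurable borel \<and>
    (\<lambda>y. \<integral>\<^sup>+x. F (x, y) \<partial>\<nu>1) \<in> borel_measurable borel \<and>
    (\<integral>\<^sup>+x. \<integral>\<^sup>+y. F (x, y) \<partial>\<nu>2 \<partial>\<nu>1) = (\<integral>\<^sup>+y. \<integral>\<^sup>+x. F (x, y) \<partial>\<nu>1 \<partial>\<nu>2)"
    (is "?P F")
proof -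
  have s1[simp]: "sets \<nu>1 = sets borel" and s2[simp]: "sets \<nu>2 = sets borel"
    using r1 r2 by (auto simp: finite_radon_def)
  have mc1: "borel_measurable \<nu>1 = borel_measurable borel" and mc2: "borel_measurable \<nu>2 = borel_measurable borel"
    by (auto cong: measurable_cong_sets)
  have P1: "Pair x \<in> borel_measurable borel" for x :: 'a
    by (intro borel_measurable_continuous_onI continuous_intros)
  have P2: "(\<lambda>x. (x, y)) \<in> borel_measurable borel" for y :: 'b
    by (intro borel_measurable_continuous_onI continuous_intros)
  have sec1: "(\<lambda>y. u (x, y)) \<in> borel_measurable borel" if "u \<in> borel_measurable borel" for u :: "'a \<times> 'b \<Rightarrow> ennreal" and x
    using measurable_compose[OF P1 that] .
  have sec2: "(\<lambda>x. u (x, y)) \<in> borel_measurable borel" if "u \<in> borel_measurable borel" for u :: "'a \<times> 'b \<Rightarrow> ennreal" and y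
    using measurable_compose[OF P2 that] .
  show ?thesis using F
  proof (induct rule: borel_measurable_induct)
    case (cong f g)
    then have "f = g" by auto
    with cong show ?case by simp
  next
    case (set A)
    have "(\<lambda>y. indicator A (x, y)) = (indicator (Pair x -` A) :: 'b \<Rightarrow> ennreal)" for x
      by (auto simp: indicator_def)
    moreover have "(\<lambda>x. indicator A (x, y)) = (indicator ((\<lambda>x. (x, y)) -` A) :: 'a \<Rightarrow> ennreal)" for y
      by (auto simp: indicator_def)
    ultimately show ?case
      using iterated_measure_borel[OF r1 r2 set] borel_vimage_Pair[OF set] by simp
  next
    case (mult u c)
    then show ?case
      by (auto simp: nn_integral_cmult mc1 mc2 sec1 sec2)
  next
    case (add u v)
    then show ?case
      by (auto simp: nn_integral_add mc1 mc2 sec1 sec2)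
  next
    case (seq U)
    have 1: "(\<integral>\<^sup>+y. (SUP i. U i) (x, y) \<partial>\<nu>2) = (SUP i. \<integral>\<^sup>+y. U i (x, y) \<partial>\<nu>2)" for x
      unfolding SUP_apply
      by (rule nn_integral_monotone_convergence_SUP) (use seq in \<open>auto simp: mc2 sec1 incseq_def le_fun_def\<close>)
    have 2: "(\<integral>\<^sup>+x. (SUP i. U i) (x, y) \<partial>\<nu>1) = (SUP i. \<integral>\<^sup>+x. U i (x, y) \<partial>\<nu>1)" for y
      unfolding SUP_apply
      by (rule nn_integral_monotone_convergence_SUP) (use seq in \<open>auto simp: mc1 sec2 incseq_def le_fun_def\<close>)
    have 3: "(\<integral>\<^sup>+x. (SUP i. \<integral>\<^sup>+y. U i (x, y) \<partial>\<nu>2) \<partial>\<nu>1) = (SUP i. \<integral>\<^sup>+x. \<integral>\<^sup>+y. U i (x, y) \<partial>\<nu>2 \<partial>\<nu>1)"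
      by (rule nn_integral_monotone_convergence_SUP)
        (use seq in \<open>auto simp: mc1 incseq_def le_fun_def intro!: nn_integral_mono\<close>)
    have 4: "(\<integral>\<^sup>+y. (SUP i. \<integral>\<^sup>+x. U i (x, y) \<partial>\<nu>1) \<partial>\<nu>2) = (SUP i. \<integral>\<^sup>+y. \<integral>\<^sup>+x. U i (x, y) \<partial>\<nu>1 \<partial>\<nu>2)"
      by (rule nn_integral_monotone_convergence_SUP)
        (use seq in \<open>auto simp: mc2 incseq_def le_fun_def intro!: nn_integral_mono\<close>)
    show ?case unfolding 1 2 3 4 using seq by (auto intro!: borel_measurable_SUP)
  qed
qed

section \<open>Sigma-compact sets\<close>

definition sigma_compact :: "'a::topological_space set \<Rightarrow> bool" where
  "sigma_compact S \<longleftrightarrow> (\<exists>\<K>. countable \<K> \<and> (\<forall>K\<in>\<K>. compact K) \<and> S = \<Union>\<K>)"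

lemma compact_imp_sigma_compact: "compact K \<Longrightarrow> sigma_compact K"
  unfolding sigma_compact_def by (intro exI[of _ "{K}"]) auto

lemma sigma_compact_UN:
  assumes "\<And>n::nat. sigma_compact (S n)"
  shows "sigma_compact (\<Union>n. S n)"
proof -
  have "\<forall>n. \<exists>\<K>. countable \<K> \<and> (\<forall>K\<in>\<K>. compact K) \<and> S n = \<Union>\<K>"
    using assms unfolding sigma_compact_def by blast
  then obtain \<K> where *: "\<And>n. countable (\<K> n) \<and> (\<forall>K\<in>\<K> n. compact K) \<and> S n = \<Union>(\<K> n)" by metis
  show ?thesis unfolding sigma_compact_def
    by (rule exI[of _ "\<Union>n. \<K> n"]) (use * in auto)
qed

text \<open>The form in which \<open>\<sigma>\<close>-compactness is used with monotone convergence.\<close>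

lemma sigma_compact_exhaustion:
  assumes "sigma_compact S"
  obtains K :: "nat \<Rightarrow> 'a::topological_space set" where "\<And>n. compact (K n)" "incseq K" "S = (\<Union>n. K n)"
proof -
  obtain \<K> where *: "countable \<K>" "\<And>K. K \<in> \<K> \<Longrightarrow> compact K" "S = \<Union>\<K>"
    using assms unfolding sigma_compact_def by blast
  define L where "L = from_nat_into (insert {} \<K>)"
  have range: "range L = insert {} \<K>" unfolding L_def
    by (rule range_from_nat_into) (use *(1) in auto)
  then have L: "compact (L n)" for n using *(2) by (metis compact_empty insertE rangeI)
  define K where "K n = (\<Union>i\<le>n. L i)" for n
  have "compact (K n)" for n unfolding K_def by (intro compact_UN) (use L in auto)
  moreover have "incseq K" unfolding K_def incseq_def by (auto intro: order_trans)
  moreover have "S = (\<Union>n. K n)"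
  proof -
    have "S = \<Union>(range L)" unfolding range *(3) by simp
    also have "\<dots> = (\<Union>n. K n)" unfolding K_def by auto
    finally show ?thesis .
  qed
  ultimately show ?thesis using that by blast
qed

lemma sigma_compact_borel: "sigma_compact (S::'a::t2_space set) \<Longrightarrow> S \<in> sets borel"
  by (metis borel_compact sets.countable_UN sigma_compact_exhaustion image_subsetI)

lemma compact_sum:
  fixes S T :: "'g::topological_monoid_add set"
  assumes "compact S" "compact T"
  shows "compact ((\<lambda>(x, y). x + y) ` (S \<times> T))"
proof (rule compact_continuous_image)
  show "continuous_on (S \<times> T) (\<lambda>(x, y). x + y :: 'g)"
    unfolding case_prod_unfold by (intro continuous_intros)
  show "compact (S \<times> T)" using assms by (rule compact_Times)
qed

lemma sigma_compact_sum:
  fixes S T :: "'g::topological_monoid_add set"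
  assumes "sigma_compact S" "sigma_compact T"
  shows "sigma_compact ((\<lambda>(x, y). x + y) ` (S \<times> T))"
proof -
  obtain K where K: "\<And>n. compact (K n)" "S = (\<Union>n::nat. K n)"
    using sigma_compact_exhaustion[OF assms(1)] by blast
  obtain L where L: "\<And>n. compact (L n)" "T = (\<Union>n::nat. L n)"
    using sigma_compact_exhaustion[OF assms(2)] by blast
  have "(\<lambda>(x, y). x + y) ` (S \<times> T) = (\<Union>m. \<Union>n. (\<lambda>(x, y). x + y) ` (K m \<times> L n))"
    unfolding K(2) L(2) by fast
  moreover have "sigma_compact (\<Union>m. \<Union>n. (\<lambda>(x, y). x + y) ` (K m \<times> L n))"
    by (intro sigma_compact_UN compact_imp_sigma_compact compact_sum K L)
  ultimately show ?thesis by simp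
qed

section \<open>Haar measure\<close>

locale haar_group =
  fixes M :: "'g::{topological_group_add, t2_space} measure"
  assumes locally_compact: "locally_compact_space (euclidean :: 'g topology)"
    and haar: "left_haar_measure M"
begin

lemma sets_M [simp, measurable_cong]: "sets M = sets borel"
  using haar by (simp add: left_haar_measure_def)

lemma space_M [simp]: "space M = UNIV"
  using sets_eq_imp_space_eq[OF sets_M] by simp

lemma measurable_M [simp]: "borel_measurable M = borel_measurable borel"
  by (auto cong: measurable_cong_sets)

lemma emeasure_compact_finite: "compact K \<Longrightarrow> emeasure M K < \<infinity>"
  using haar by (simp add: left_haar_measure_def)

lemma outer_regular:
  assumes "A \<in> sets borel" "emeasure M A < c"
  obtains U where "open U" "A \<subseteq> U" "emeasure M U < c"
proof -
  have "emeasure M A = (INF U\<in>{U. open U \<and> A \<subseteq> U}. emeasure M U)"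
    by (rule haar[unfolded left_haar_measure_def, THEN conjunct2, THEN conjunct2, THEN conjunct1, rule_format, OF assms(1)])
  with assms(2) show ?thesis using that by (auto simp: INF_less_iff)
qed

lemma inner_regular_open:
  assumes "open U" "c < emeasure M U"
  obtains K where "compact K" "K \<subseteq> U" "c < emeasure M K"
proof -
  have "emeasure M U = (SUP K\<in>{K. compact K \<and> K \<subseteq> U}. emeasure M K)"
    by (rule haar[unfolded left_haar_measure_def, THEN conjunct2, THEN conjunct2, THEN conjunct2, THEN conjunct1, rule_format, OF assms(1)])
  with assms(2) show ?thesis using that by (auto simp: less_SUP_iff)
qed

lemma emeasure_translate_image: "A \<in> sets borel \<Longrightarrow> emeasure M ((+) g ` A) = emeasure M A"
  by (rule haar[unfolded left_haar_measure_def, THEN conjunct2, THEN conjunct2, THEN conjunct2, THEN conjunct2, THEN conjunct1, rule_format])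

lemma continuous_translate: "continuous_on UNIV ((+) (g::'g))"
  by (intro continuous_intros)

lemma translate_borel: "(+) (g::'g) \<in> borel_measurable borel"
  using continuous_translate by (auto intro: borel_measurable_continuous_onI)

lemma uminus_borel: "uminus \<in> (borel :: 'g measure) \<rightarrow>\<^sub>M borel"
  by (intro borel_measurable_continuous_onI continuous_intros)

lemma translate_image_eq_vimage: "(+) (g::'g) ` A = (+) (- g) -` A"
  by (force simp: image_iff add.assoc[symmetric])

lemma distr_translate: "distr M borel ((+) g) = M"
proof (rule measure_eqI)
  fix A assume "A \<in> sets (distr M borel ((+) g))"
  then have A: "A \<in> sets borel" by simp
  have "emeasure (distr M borel ((+) g)) A = emeasure M ((+) (- g) ` A)"
    using A translate_borel by (simp add: emeasure_distr translate_image_eq_vimage)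
  then show "emeasure (distr M borel ((+) g)) A = emeasure M A"
    by (simp add: emeasure_translate_image[OF A])
qed simp

lemma nn_integral_translate:
  assumes "f \<in> borel_measurable borel"
  shows "(\<integral>\<^sup>+x. f (g + x) \<partial>M) = (\<integral>\<^sup>+x. f x \<partial>M)"
  using nn_integral_distr[of "(+) g" M borel f] assms translate_borel distr_translate[of g] by simp

lemma integral_translate:
  fixes f :: "'g \<Rightarrow> complex"
  assumes "f \<in> borel_measurable borel"
  shows "(\<integral>x. f (g + x) \<partial>M) = (\<integral>x. f x \<partial>M)"
  using integral_distr[of "(+) g" M borel f] assms translate_borel distr_translate[of g] by simp

lemma compact_neighbourhood_zero:
  obtains U K where "open U" "(0::'g) \<in> U" "U \<subseteq> K" "compact K"
proof -
  have "\<exists>U K. open U \<and> compact K \<and> (0::'g) \<in> U \<and> U \<subseteq> K"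
    using locally_compact unfolding locally_compact_space_def by simp
  then show ?thesis using that by blast
qed

text \<open>Outer regularity of the complement \<open>K - B\<close> is inner regularity of \<open>B\<close>: remove from \<open>K\<close> an open
  set that covers \<open>K - B\<close> tightly.\<close>

lemma inner_regular_in_compact:
  assumes K: "compact K" and B: "B \<in> sets borel" "B \<subseteq> K" and c: "c < emeasure M B"
  obtains C where "compact C" "C \<subseteq> B" "c < emeasure M C"
proof -
  have KB[measurable]: "K \<in> sets borel" by (rule borel_compact[OF K])
  have fin: "emeasure M K < \<infinity>" by (rule emeasure_compact_finite[OF K])
  have finB: "emeasure M B \<noteq> \<infinity>" using fin emeasure_mono[OF B(2), of M] by auto
  have finKB: "emeasure M (K - B) \<noteq> \<infinity>" using fin emeasure_mono[of "K - B" K M] by auto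
  define d where "d = emeasure M B - c"
  have d: "0 < d" unfolding d_def using c by (simp add: diff_gr0_ennreal)
  have "emeasure M (K - B) < emeasure M (K - B) + d"
    using d finKB by (simp add: ennreal_add_left_cancel_less less_top)
  from outer_regular[OF _ this] B obtain U where U: "open U" "K - B \<subseteq> U" "emeasure M U < emeasure M (K - B) + d"
    by auto
  define C where "C = K - U"
  have C: "compact C" unfolding C_def using K U(1) by (rule compact_diff)
  have CB: "C \<subseteq> B" unfolding C_def using U by blast
  have UB[measurable]: "U \<in> sets borel" using U by simp
  have "emeasure M (K - B) + emeasure M (B - C) \<le> emeasure M U"
    using B U CB by (subst plus_emeasure) (auto simp: C_def borel_compact C intro!: emeasure_mono)
  then have "emeasure M (K - B) + emeasure M (B - C) < emeasure M (K - B) + d" using U(3) by (rule le_less_trans)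
  then have lt: "emeasure M (B - C) < d" using finKB by (simp add: ennreal_add_left_cancel_less)
  have "emeasure M B = emeasure M C + emeasure M (B - C)"
    using B CB borel_compact[OF C] by (subst plus_emeasure) (auto intro!: arg_cong[where f="emeasure M"])
  moreover have "c + d = emeasure M B" unfolding d_def using c by (simp add: add_diff_eq_iff_ennreal)
  ultimately have eq: "emeasure M C + emeasure M (B - C) = c + d" by simp
  have "c < emeasure M C"
  proof (rule ccontr)
    assume "\<not> c < emeasure M C"
    then have le: "emeasure M C \<le> c" by simp
    have "c \<noteq> top" using c by auto
    have "emeasure M C + emeasure M (B - C) \<le> c + emeasure M (B - C)" using le by (rule add_right_mono)
    also have "\<dots> < c + d" using lt \<open>c \<noteq> top\<close> by (simp add: ennreal_add_left_cancel_less)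
    finally show False using eq by simp
  qed
  with C CB that show ?thesis by blast
qed

section \<open>Fubini for Haar measure\<close>

lemma finite_radon_restrict:
  assumes K: "compact K"
  shows "finite_radon (density M (indicator K))"
proof -
  have KB[measurable]: "K \<in> sets borel" by (rule borel_compact[OF K])
  have e: "emeasure (density M (indicator K)) B = emeasure M (K \<inter> B)" if "B \<in> sets borel" for B
    using that by (subst emeasure_density) (auto simp: indicator_inter_arith[symmetric])
  show ?thesis
    unfolding finite_radon_def
  proof (intro conjI ballI allI impI)
    show "finite_measure (density M (indicator K))"
      using e[of UNIV] emeasure_compact_finite[OF K] by (intro finite_measureI) auto
    show "sets (density M (indicator K)) = sets borel" by simp
    fix B c assume B: "B \<in> sets borel" and "c < emeasure (density M (indicator K)) B"
    then have "c < emeasure M (K \<inter> B)" by (simp add: e)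
    then obtain C where C: "compact C" "C \<subseteq> K \<inter> B" "c < emeasure M C"
      using inner_regular_in_compact[OF K, of "K \<inter> B"] B by auto
    have "K \<inter> C = C" using C by blast
    then have "c < emeasure (density M (indicator K)) C" using e[OF borel_compact[OF C(1)]] C by simp
    with C show "\<exists>C. compact C \<and> C \<subseteq> B \<and> c < emeasure (density M (indicator K)) C" by blast
  qed
qed

text \<open>Haar measure need not be \<open>\<sigma>\<close>-finite. On a \<open>\<sigma>\<close>-compact support Tonelli's theorem follows by exhaustion from the case of finite measures.\<close>

lemma nn_integral_swap:
  fixes F :: "'g \<times> 'g \<Rightarrow> ennreal"
  assumes F: "F \<in> borel_measurable borel" and S: "sigma_compact S" and T: "sigma_compact T"
    and supp: "\<And>x y. F (x, y) \<noteq> 0 \<Longrightarrow> x \<in> S \<and> y \<in> T"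
  shows "(\<lambda>x. \<integral>\<^sup>+y. F (x, y) \<partial>M) \<in> borel_measurable borel \<and>
    (\<lambda>y. \<integral>\<^sup>+x. F (x, y) \<partial>M) \<in> borel_measurable borel \<and>
    (\<integral>\<^sup>+x. \<integral>\<^sup>+y. F (x, y) \<partial>M \<partial>M) = (\<integral>\<^sup>+y. \<integral>\<^sup>+x. F (x, y) \<partial>M \<partial>M)"
proof -
  obtain K where K: "\<And>n. compact (K n)" "incseq K" "S = (\<Union>n::nat. K n)"
    using sigma_compact_exhaustion[OF S] by blast
  obtain L where L: "\<And>n. compact (L n)" "incseq L" "T = (\<Union>n::nat. L n)"
    using sigma_compact_exhaustion[OF T] by blast
  have P1: "Pair x \<in> borel_measurable borel" for x :: 'g
    by (intro borel_measurable_continuous_onI continuous_intros)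
  have P2: "(\<lambda>x. (x, y)) \<in> borel_measurable borel" for y :: 'g
    by (intro borel_measurable_continuous_onI continuous_intros)
  define U where "U n z = F z * indicator (K n \<times> L n) z" for n z
  have Um: "U n \<in> borel_measurable borel" for n
    unfolding U_def using F borel_compact[OF compact_Times[OF K(1) L(1)]]
    by (intro borel_measurable_times_ennreal borel_measurable_indicator) auto
  have sec1: "(\<lambda>y. U n (x, y)) \<in> borel_measurable borel" for n x
    using measurable_compose[OF P1 Um] .
  have sec2: "(\<lambda>x. U n (x, y)) \<in> borel_measurable borel" for n y
    using measurable_compose[OF P2 Um] .
  have mono: "m \<le> n \<Longrightarrow> U m z \<le> U n z" for m n z
    using incseqD[OF K(2), of m n] incseqD[OF L(2), of m n] unfolding U_def
    by (auto simp: indicator_def subset_iff)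
  have FU: "F z = (SUP n. U n z)" for z
  proof (rule antisym)
    show "(SUP n. U n z) \<le> F z"
      by (rule SUP_least) (auto simp: U_def indicator_def)
    show "F z \<le> (SUP n. U n z)"
    proof (cases "F z = 0")
      case False
      obtain x y where z: "z = (x, y)" by (cases z)
      with False supp have "x \<in> S" "y \<in> T" by auto
      then obtain i j where "x \<in> K i" "y \<in> L j" using K(3) L(3) by blast
      then have "z \<in> K (max i j) \<times> L (max i j)"
        using incseqD[OF K(2), of i "max i j"] incseqD[OF L(2), of j "max i j"] z by auto
      then have "F z = U (max i j) z" by (simp add: U_def)
      also have "\<dots> \<le> (SUP n. U n z)" by (rule SUP_upper) simp
      finally show ?thesis .
    qed simp
  qed
  have d2: "(\<integral>\<^sup>+y. U n (x, y) \<partial>density M (indicator (L n))) = (\<integral>\<^sup>+y. U n (x, y) \<partial>M)" for n x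
    using sec1 borel_compact[OF L(1)[of n]]
    by (subst nn_integral_density) (auto simp: U_def indicator_def intro!: nn_integral_cong)
  have d1: "(\<integral>\<^sup>+x. U n (x, y) \<partial>density M (indicator (K n))) = (\<integral>\<^sup>+x. U n (x, y) \<partial>M)" for n y
    using sec2 borel_compact[OF K(1)[of n]]
    by (subst nn_integral_density) (auto simp: U_def indicator_def intro!: nn_integral_cong)
  have sw: "(\<lambda>x. \<integral>\<^sup>+y. U n (x, y) \<partial>M) \<in> borel_measurable borel"
    "(\<lambda>y. \<integral>\<^sup>+x. U n (x, y) \<partial>M) \<in> borel_measurable borel"
    "(\<integral>\<^sup>+x. \<integral>\<^sup>+y. U n (x, y) \<partial>M \<partial>density M (indicator (K n))) = (\<integral>\<^sup>+y. \<integral>\<^sup>+x. U n (x, y) \<partial>M \<partial>density M (indicator (L n)))" for n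
    using nn_integral_swap_finite_radon[OF finite_radon_restrict[OF K(1)[of n]] finite_radon_restrict[OF L(1)[of n]] Um[of n]]
    unfolding d1 d2 by auto
  have e1: "(\<integral>\<^sup>+x. \<integral>\<^sup>+y. U n (x, y) \<partial>M \<partial>density M (indicator (K n))) = (\<integral>\<^sup>+x. \<integral>\<^sup>+y. U n (x, y) \<partial>M \<partial>M)" for n
    using sw(1) borel_compact[OF K(1)[of n]]
    by (subst nn_integral_density) (auto simp: U_def indicator_def intro!: nn_integral_cong)
  have e2: "(\<integral>\<^sup>+y. \<integral>\<^sup>+x. U n (x, y) \<partial>M \<partial>density M (indicator (L n))) = (\<integral>\<^sup>+y. \<integral>\<^sup>+x. U n (x, y) \<partial>M \<partial>M)" for n
    using sw(2) borel_compact[OF L(1)[of n]]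
    by (subst nn_integral_density) (auto simp: U_def indicator_def intro!: nn_integral_cong)
  have 1: "(\<integral>\<^sup>+y. F (x, y) \<partial>M) = (SUP i. \<integral>\<^sup>+y. U i (x, y) \<partial>M)" for x
    unfolding FU by (rule nn_integral_monotone_convergence_SUP) (auto simp: sec1 incseq_def le_fun_def mono)
  have 2: "(\<integral>\<^sup>+x. F (x, y) \<partial>M) = (SUP i. \<integral>\<^sup>+x. U i (x, y) \<partial>M)" for y
    unfolding FU by (rule nn_integral_monotone_convergence_SUP) (auto simp: sec2 incseq_def le_fun_def mono)
  have 3: "(\<integral>\<^sup>+x. (SUP i. \<integral>\<^sup>+y. U i (x, y) \<partial>M) \<partial>M) = (SUP i. \<integral>\<^sup>+x. \<integral>\<^sup>+y. U i (x, y) \<partial>M \<partial>M)"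
    by (rule nn_integral_monotone_convergence_SUP)
      (auto simp: sw incseq_def le_fun_def intro!: nn_integral_mono mono)
  have 4: "(\<integral>\<^sup>+y. (SUP i. \<integral>\<^sup>+x. U i (x, y) \<partial>M) \<partial>M) = (SUP i. \<integral>\<^sup>+y. \<integral>\<^sup>+x. U i (x, y) \<partial>M \<partial>M)"
    by (rule nn_integral_monotone_convergence_SUP)
      (auto simp: sw incseq_def le_fun_def intro!: nn_integral_mono mono)
  show ?thesis unfolding 1 2 3 4 using sw e1 e2 by (auto intro!: borel_measurable_SUP)
qed


text \<open>Measurability holds also across the points where the section fails to be integrable: the integral
  is the constant 0 there, and the set of these points is Borel.\<close>

lemma complex_integral_section_measurable:
  fixes F :: "'g \<times> 'g \<Rightarrow> complex"
  assumes F: "F \<in> borel_measurable borel" and S: "sigma_compact S" and T: "sigma_compact T"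
    and supp: "\<And>x y. F (x, y) \<noteq> 0 \<Longrightarrow> x \<in> S \<and> y \<in> T"
  shows "(\<lambda>x. \<integral>y. F (x, y) \<partial>M) \<in> borel_measurable borel"
    and "(\<lambda>y. \<integral>x. F (x, y) \<partial>M) \<in> borel_measurable borel"
proof -
  have P1: "Pair x \<in> borel_measurable borel" for x :: 'g
    by (intro borel_measurable_continuous_onI continuous_intros)
  have P2: "(\<lambda>x. (x, y)) \<in> borel_measurable borel" for y :: 'g
    by (intro borel_measurable_continuous_onI continuous_intros)
  have nn: "(\<lambda>x. \<integral>\<^sup>+y. ennreal (p (F (x, y))) \<partial>M) \<in> borel_measurable borel \<and>
      (\<lambda>y. \<integral>\<^sup>+x. ennreal (p (F (x, y))) \<partial>M) \<in> borel_measurable borel"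
    if "p \<in> borel_measurable borel" "p 0 = 0" for p :: "complex \<Rightarrow> real"
  proof -
    have "x \<in> S \<and> y \<in> T" if "ennreal (p (F (x, y))) \<noteq> 0" for x y
      using that \<open>p 0 = 0\<close> supp by (metis ennreal_0)
    then show ?thesis
      using nn_integral_swap[of "\<lambda>z. ennreal (p (F z))", OF _ S T] measurable_compose[OF F that(1)]
      by simp
  qed
  have int_eq: "(\<integral>y. f y \<partial>M) = (if (\<integral>\<^sup>+y. ennreal (norm (f y)) \<partial>M) < \<infinity>
      then Complex (enn2real (\<integral>\<^sup>+y. ennreal (Re (f y)) \<partial>M) - enn2real (\<integral>\<^sup>+y. ennreal (- Re (f y)) \<partial>M))
                   (enn2real (\<integral>\<^sup>+y. ennreal (Im (f y)) \<partial>M) - enn2real (\<integral>\<^sup>+y. ennreal (- Im (f y)) \<partial>M))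
      else 0)" if "f \<in> borel_measurable borel" for f :: "'g \<Rightarrow> complex"
  proof (cases "integrable M f")
    case True
    then have "(\<integral>\<^sup>+y. ennreal (norm (f y)) \<partial>M) < \<infinity>" by (simp add: integrable_iff_bounded)
    moreover have "(\<integral>y. f y \<partial>M) = Complex (\<integral>y. Re (f y) \<partial>M) (\<integral>y. Im (f y) \<partial>M)"
      using True by (intro complex_eqI) auto
    moreover have "(\<integral>y. Re (f y) \<partial>M) = enn2real (\<integral>\<^sup>+y. ennreal (Re (f y)) \<partial>M) - enn2real (\<integral>\<^sup>+y. ennreal (- Re (f y)) \<partial>M)"
      "(\<integral>y. Im (f y) \<partial>M) = enn2real (\<integral>\<^sup>+y. ennreal (Im (f y)) \<partial>M) - enn2real (\<integral>\<^sup>+y. ennreal (- Im (f y)) \<partial>M)"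
      using integrable_Re[OF True] integrable_Im[OF True] by (auto intro: real_lebesgue_integral_def)
    ultimately show ?thesis by simp
  next
    case False
    then have "\<not> (\<integral>\<^sup>+y. ennreal (norm (f y)) \<partial>M) < \<infinity>" using that by (simp add: integrable_iff_bounded)
    with False show ?thesis by (simp add: not_integrable_integral_eq)
  qed
  have meas: "(\<lambda>x. if a x < \<infinity> then Complex (enn2real (p1 x) - enn2real (p2 x)) (enn2real (p3 x) - enn2real (p4 x)) else 0)
      \<in> borel_measurable borel"
    if [measurable]: "a \<in> borel_measurable borel" "p1 \<in> borel_measurable borel" "p2 \<in> borel_measurable borel"
      "p3 \<in> borel_measurable borel" "p4 \<in> borel_measurable borel" for a p1 p2 p3 p4 :: "'g \<Rightarrow> ennreal"
    unfolding Complex_eq by measurable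
  have n: "(norm :: complex \<Rightarrow> real) \<in> borel_measurable borel" "Re \<in> borel_measurable borel" "Im \<in> borel_measurable borel"
     "(\<lambda>z. - Re z) \<in> borel_measurable borel" "(\<lambda>z. - Im z) \<in> borel_measurable borel"
    by measurable
  have "(\<lambda>y. F (x, y)) \<in> borel_measurable borel" for x using measurable_compose[OF P1 F] .
  note e1 = int_eq[OF this]
  have "(\<lambda>x. F (x, y)) \<in> borel_measurable borel" for y using measurable_compose[OF P2 F] .
  note e2 = int_eq[OF this]
  show "(\<lambda>x. \<integral>y. F (x, y) \<partial>M) \<in> borel_measurable borel"
    unfolding e1 by (rule meas) (use nn[of norm] nn[of Re] nn[of Im] nn[of "\<lambda>z. - Re z"] nn[of "\<lambda>z. - Im z"] n in auto)
  show "(\<lambda>y. \<integral>x. F (x, y) \<partial>M) \<in> borel_measurable borel"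
    unfolding e2 by (rule meas) (use nn[of norm] nn[of Re] nn[of Im] nn[of "\<lambda>z. - Re z"] nn[of "\<lambda>z. - Im z"] n in auto)
qed

lemma nonneg_integral_swap:
  fixes p :: "'g \<times> 'g \<Rightarrow> real"
  assumes p: "p \<in> borel_measurable borel" and S: "sigma_compact S" and T: "sigma_compact T"
    and supp: "\<And>x y. p (x, y) \<noteq> 0 \<Longrightarrow> x \<in> S \<and> y \<in> T"
    and nonneg: "\<And>z. 0 \<le> p z" and fin: "(\<integral>\<^sup>+x. \<integral>\<^sup>+y. ennreal (p (x, y)) \<partial>M \<partial>M) < \<infinity>"
  shows "AE x in M. integrable M (\<lambda>y. p (x, y))"
    and "integrable M (\<lambda>x. \<integral>y. p (x, y) \<partial>M)"
    and "AE y in M. integrable M (\<lambda>x. p (x, y))"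
    and "integrable M (\<lambda>y. \<integral>x. p (x, y) \<partial>M)"
    and "(\<integral>x. \<integral>y. p (x, y) \<partial>M \<partial>M) = (\<integral>y. \<integral>x. p (x, y) \<partial>M \<partial>M)"
proof -
  have P1: "Pair x \<in> borel_measurable borel" for x :: 'g
    by (intro borel_measurable_continuous_onI continuous_intros)
  have P2: "(\<lambda>x. (x, y)) \<in> borel_measurable borel" for y :: 'g
    by (intro borel_measurable_continuous_onI continuous_intros)
  have m1: "(\<lambda>y. p (x, y)) \<in> borel_measurable borel" for x using measurable_compose[OF P1 p] .
  have m2: "(\<lambda>x. p (x, y)) \<in> borel_measurable borel" for y using measurable_compose[OF P2 p] .
  have "x \<in> S \<and> y \<in> T" if "ennreal (p (x, y)) \<noteq> 0" for x y
    using that supp by (metis ennreal_0)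
  then have sw: "(\<lambda>x. \<integral>\<^sup>+y. ennreal (p (x, y)) \<partial>M) \<in> borel_measurable borel"
    "(\<lambda>y. \<integral>\<^sup>+x. ennreal (p (x, y)) \<partial>M) \<in> borel_measurable borel"
    "(\<integral>\<^sup>+x. \<integral>\<^sup>+y. ennreal (p (x, y)) \<partial>M \<partial>M) = (\<integral>\<^sup>+y. \<integral>\<^sup>+x. ennreal (p (x, y)) \<partial>M \<partial>M)"
    using nn_integral_swap[of "\<lambda>z. ennreal (p z)", OF _ S T] p by auto
  have i1: "(\<integral>y. p (x, y) \<partial>M) = enn2real (\<integral>\<^sup>+y. ennreal (p (x, y)) \<partial>M)" for x
    by (rule integral_eq_nn_integral) (use m1 nonneg in auto)
  have i2: "(\<integral>x. p (x, y) \<partial>M) = enn2real (\<integral>\<^sup>+x. ennreal (p (x, y)) \<partial>M)" for y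
    by (rule integral_eq_nn_integral) (use m2 nonneg in auto)
  have f1: "AE x in M. (\<integral>\<^sup>+y. ennreal (p (x, y)) \<partial>M) < \<infinity>"
    using nn_integral_PInf_AE[of "\<lambda>x. \<integral>\<^sup>+y. ennreal (p (x, y)) \<partial>M" M] sw fin by (auto simp: less_top)
  have f2: "AE y in M. (\<integral>\<^sup>+x. ennreal (p (x, y)) \<partial>M) < \<infinity>"
    using nn_integral_PInf_AE[of "\<lambda>y. \<integral>\<^sup>+x. ennreal (p (x, y)) \<partial>M" M] sw fin by (auto simp: less_top)
  show "AE x in M. integrable M (\<lambda>y. p (x, y))"
    using f1 by eventually_elim (use m1 nonneg in \<open>auto simp: integrable_iff_bounded\<close>)
  show "AE y in M. integrable M (\<lambda>x. p (x, y))"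
    using f2 by eventually_elim (use m2 nonneg in \<open>auto simp: integrable_iff_bounded\<close>)
  have e1: "(\<integral>\<^sup>+x. ennreal (enn2real (\<integral>\<^sup>+y. ennreal (p (x, y)) \<partial>M)) \<partial>M) = (\<integral>\<^sup>+x. \<integral>\<^sup>+y. ennreal (p (x, y)) \<partial>M \<partial>M)"
    by (rule nn_integral_cong_AE) (use f1 in \<open>eventually_elim, simp\<close>)
  have e2: "(\<integral>\<^sup>+y. ennreal (enn2real (\<integral>\<^sup>+x. ennreal (p (x, y)) \<partial>M)) \<partial>M) = (\<integral>\<^sup>+y. \<integral>\<^sup>+x. ennreal (p (x, y)) \<partial>M \<partial>M)"
    by (rule nn_integral_cong_AE) (use f2 in \<open>eventually_elim, simp\<close>)
  show "integrable M (\<lambda>x. \<integral>y. p (x, y) \<partial>M)"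
    unfolding i1 using sw fin e1 by (auto simp: integrable_iff_bounded)
  show "integrable M (\<lambda>y. \<integral>x. p (x, y) \<partial>M)"
    unfolding i2 using sw fin e2 by (auto simp: integrable_iff_bounded)
  show "(\<integral>x. \<integral>y. p (x, y) \<partial>M \<partial>M) = (\<integral>y. \<integral>x. p (x, y) \<partial>M \<partial>M)"
    unfolding i1 i2 using sw by (subst (1 2) integral_eq_nn_integral) (auto simp: e1 e2)
qed

text \<open>The class of functions for which the conclusion holds is closed under linear combinations and
  contains the positive and negative parts of the real and imaginary parts.\<close>

lemma complex_integral_swap:
  fixes F :: "'g \<times> 'g \<Rightarrow> complex"
  assumes F: "F \<in> borel_measurable borel" and S: "sigma_compact S" and T: "sigma_compact T"
    and supp: "\<And>x y. F (x, y) \<noteq> 0 \<Longrightarrow> x \<in> S \<and> y \<in> T"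
    and fin: "(\<integral>\<^sup>+x. \<integral>\<^sup>+y. ennreal (norm (F (x, y))) \<partial>M \<partial>M) < \<infinity>"
  shows "integrable M (\<lambda>x. \<integral>y. F (x, y) \<partial>M)"
    and "integrable M (\<lambda>y. \<integral>x. F (x, y) \<partial>M)"
    and "(\<integral>x. \<integral>y. F (x, y) \<partial>M \<partial>M) = (\<integral>y. \<integral>x. F (x, y) \<partial>M \<partial>M)"
proof -
  define Fub :: "('g \<times> 'g \<Rightarrow> complex) \<Rightarrow> bool" where "Fub G \<longleftrightarrow>
     (AE x in M. integrable M (\<lambda>y. G (x, y))) \<and> integrable M (\<lambda>x. \<integral>y. G (x, y) \<partial>M) \<and>
     (AE y in M. integrable M (\<lambda>x. G (x, y))) \<and> integrable M (\<lambda>y. \<integral>x. G (x, y) \<partial>M) \<and>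
     G \<in> borel_measurable borel \<and> (\<forall>x y. G (x, y) \<noteq> 0 \<longrightarrow> x \<in> S \<and> y \<in> T) \<and>
     (\<integral>x. \<integral>y. G (x, y) \<partial>M \<partial>M) = (\<integral>y. \<integral>x. G (x, y) \<partial>M \<partial>M)" for G
  have part: "Fub (\<lambda>z. complex_of_real (max 0 (q (F z))))"
    if q: "q \<in> borel_measurable borel" "\<And>z. q z \<le> norm z" for q :: "complex \<Rightarrow> real"
  proof -
    let ?p = "\<lambda>z. max 0 (q (F z))"
    have p: "?p \<in> borel_measurable borel"
      using measurable_compose[OF F q(1)] by simp
    have ple: "?p z \<le> norm (F z)" for z using q(2)[of "F z"] by simp
    have psupp: "x \<in> S \<and> y \<in> T" if "?p (x, y) \<noteq> 0" for x y
      using that q(2)[of 0] supp[of x y] by (cases "F (x, y) = 0") auto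
    have "(\<integral>\<^sup>+x. \<integral>\<^sup>+y. ennreal (?p (x, y)) \<partial>M \<partial>M) \<le> (\<integral>\<^sup>+x. \<integral>\<^sup>+y. ennreal (norm (F (x, y))) \<partial>M \<partial>M)"
      by (intro nn_integral_mono ennreal_leI ple)
    then have pfin: "(\<integral>\<^sup>+x. \<integral>\<^sup>+y. ennreal (?p (x, y)) \<partial>M \<partial>M) < \<infinity>" using fin by (rule le_less_trans)
    have "0 \<le> ?p z" for z by simp
    note * = nonneg_integral_swap[of ?p, OF p S T psupp this pfin]
    have i: "(\<integral>y. complex_of_real (f y) \<partial>M) = complex_of_real (\<integral>y. f y \<partial>M)" for f :: "'g \<Rightarrow> real"
      by (rule integral_complex_of_real)
    show ?thesis unfolding Fub_def i
      using * p psupp by (simp add: i complex_of_real_integrable_eq)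
  qed
  have add: "Fub (\<lambda>z. G z + c * H z)" if G: "Fub G" and H: "Fub H" for G H c
  proof -
    have 1: "AE x in M. integrable M (\<lambda>y. G (x, y)) \<and> integrable M (\<lambda>y. H (x, y))"
      using G H by (auto simp: Fub_def)
    have 2: "AE y in M. integrable M (\<lambda>x. G (x, y)) \<and> integrable M (\<lambda>x. H (x, y))"
      using G H by (auto simp: Fub_def)
    have e1: "AE x in M. (\<integral>y. G (x, y) \<partial>M) + c * (\<integral>y. H (x, y) \<partial>M) = (\<integral>y. G (x, y) + c * H (x, y) \<partial>M)"
      using 1 by eventually_elim simp
    have e2: "AE y in M. (\<integral>x. G (x, y) \<partial>M) + c * (\<integral>x. H (x, y) \<partial>M) = (\<integral>x. G (x, y) + c * H (x, y) \<partial>M)"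
      using 2 by eventually_elim simp
    have m: "(\<lambda>z. G z + c * H z) \<in> borel_measurable borel" using G H by (auto simp: Fub_def)
    have sp: "x \<in> S \<and> y \<in> T" if "G (x, y) + c * H (x, y) \<noteq> 0" for x y
      using that G H unfolding Fub_def by (cases "G (x, y) = 0") auto
    note meas = complex_integral_section_measurable[OF m S T sp]
    have i1: "integrable M (\<lambda>x. (\<integral>y. G (x, y) \<partial>M) + c * (\<integral>y. H (x, y) \<partial>M))"
      and i2: "integrable M (\<lambda>y. (\<integral>x. G (x, y) \<partial>M) + c * (\<integral>x. H (x, y) \<partial>M))"
      using G H by (auto simp: Fub_def)
    have j1: "integrable M (\<lambda>x. \<integral>y. G (x, y) + c * H (x, y) \<partial>M)"
      using integrable_cong_AE_imp[OF i1 _ e1] meas by simp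
    have j2: "integrable M (\<lambda>y. \<integral>x. G (x, y) + c * H (x, y) \<partial>M)"
      using integrable_cong_AE_imp[OF i2 _ e2] meas by simp
    have k1: "(\<integral>x. \<integral>y. G (x, y) + c * H (x, y) \<partial>M \<partial>M) = (\<integral>x. \<integral>y. G (x, y) \<partial>M \<partial>M) + c * (\<integral>x. \<integral>y. H (x, y) \<partial>M \<partial>M)"
      using integral_cong_AE[OF borel_measurable_integrable[OF i1] borel_measurable_integrable[OF j1] e1] G H
      by (simp add: Fub_def)
    have k2: "(\<integral>y. \<integral>x. G (x, y) + c * H (x, y) \<partial>M \<partial>M) = (\<integral>y. \<integral>x. G (x, y) \<partial>M \<partial>M) + c * (\<integral>y. \<integral>x. H (x, y) \<partial>M \<partial>M)"
      using integral_cong_AE[OF borel_measurable_integrable[OF i2] borel_measurable_integrable[OF j2] e2] G H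
      by (simp add: Fub_def)
    have a1: "AE x in M. integrable M (\<lambda>y. G (x, y) + c * H (x, y))"
      using 1 by eventually_elim auto
    have a2: "AE y in M. integrable M (\<lambda>x. G (x, y) + c * H (x, y))"
      using 2 by eventually_elim auto
    have "(\<integral>x. \<integral>y. G (x, y) \<partial>M \<partial>M) = (\<integral>y. \<integral>x. G (x, y) \<partial>M \<partial>M)" "(\<integral>x. \<integral>y. H (x, y) \<partial>M \<partial>M) = (\<integral>y. \<integral>x. H (x, y) \<partial>M \<partial>M)"
      using G H by (auto simp: Fub_def)
    then have eq: "(\<integral>x. \<integral>y. G (x, y) + c * H (x, y) \<partial>M \<partial>M) = (\<integral>y. \<integral>x. G (x, y) + c * H (x, y) \<partial>M \<partial>M)"
      unfolding k1 k2 by simp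
    show ?thesis unfolding Fub_def using m sp j1 j2 a1 a2 eq by blast
  qed
  have q: "Re \<in> borel_measurable borel" "Im \<in> borel_measurable borel"
     "(\<lambda>z. - Re z) \<in> borel_measurable borel" "(\<lambda>z. - Im z) \<in> borel_measurable borel"
    by measurable
  have le: "Re z \<le> norm z" "Im z \<le> norm z" "- Re z \<le> norm z" "- Im z \<le> norm z" for z :: complex
    using abs_Re_le_cmod[of z] abs_Im_le_cmod[of z] by linarith+
  have "Fub (\<lambda>z. ((complex_of_real (max 0 (Re (F z))) + (- 1) * complex_of_real (max 0 (- Re (F z))))
      + \<i> * complex_of_real (max 0 (Im (F z)))) + (- \<i>) * complex_of_real (max 0 (- Im (F z))))"
    by (intro add part q le)
  also have "(\<lambda>z. ((complex_of_real (max 0 (Re (F z))) + (- 1) * complex_of_real (max 0 (- Re (F z))))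
      + \<i> * complex_of_real (max 0 (Im (F z)))) + (- \<i>) * complex_of_real (max 0 (- Im (F z)))) = F"
    by (rule ext, rule complex_eqI) auto
  finally have "Fub F" .
  then show "integrable M (\<lambda>x. \<integral>y. F (x, y) \<partial>M)"
    and "integrable M (\<lambda>y. \<integral>x. F (x, y) \<partial>M)"
    and "(\<integral>x. \<integral>y. F (x, y) \<partial>M \<partial>M) = (\<integral>y. \<integral>x. F (x, y) \<partial>M \<partial>M)"
    by (auto simp: Fub_def)
qed

section \<open>Sigma-compact supports\<close>

text \<open>Otherwise every compact set, being covered by finitely many translates of the open set, would be
  null.\<close>

lemma open_measure_pos:
  assumes "open U" "u \<in> U"
  shows "0 < emeasure M U"
proof (rule ccontr)
  assume "\<not> 0 < emeasure M U"
  then have 0: "emeasure M U = 0" by simp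
  have "emeasure M UNIV \<noteq> 0"
    by (rule haar[unfolded left_haar_measure_def, THEN conjunct2, THEN conjunct2, THEN conjunct2, THEN conjunct2, THEN conjunct2])
  then obtain K where K: "compact K" "0 < emeasure M K"
    using inner_regular_open[of UNIV 0] by (auto simp: zero_less_iff_neq_zero)
  let ?V = "\<lambda>k. (+) (k - u) ` U"
  have op: "open (?V k)" for k
    unfolding translate_image_eq_vimage by (rule open_vimage[OF assms(1) continuous_translate])
  have mem: "k \<in> ?V k" for k
    using assms(2) by (intro image_eqI[of _ _ u]) auto
  obtain D where D: "D \<subseteq> K" "finite D" "K \<subseteq> (\<Union>k\<in>D. ?V k)"
  proof (rule compactE_image[OF K(1), of K ?V])
    show "open (?V k)" for k by (rule op)
    show "K \<subseteq> (\<Union>k\<in>K. ?V k)" using mem by blast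
  qed
  have "emeasure M K \<le> emeasure M (\<Union>k\<in>D. ?V k)"
    using D(3) by (rule emeasure_mono) (use op in \<open>auto intro!: borel_open\<close>)
  also have "\<dots> \<le> (\<Sum>k\<in>D. emeasure M (?V k))"
    by (rule emeasure_subadditive_finite) (use D op in \<open>auto intro!: borel_open\<close>)
  also have "\<dots> = 0" using emeasure_translate_image[of U] assms(1) 0 by simp
  finally show False using K(2) by simp
qed

text \<open>Enclose \<open>A\<close> in an open set \<open>W\<close> of finite measure and exhaust \<open>W\<close>, up to a null set, by a
  \<open>\<sigma>\<close>-compact \<open>L\<close>. Adding a compact neighbourhood of 0 to \<open>L\<close> again and again produces a \<open>\<sigma>\<close>-compact
  set \<open>Q\<close> whose complement is open. The open set \<open>W - Q\<close> is null, hence empty. This removes the null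
  set, as exact containment is what makes products with locally measurable functions Borel.\<close>

lemma finite_measure_subset_sigma_compact:
  assumes A: "A \<in> sets borel" "emeasure M A < \<infinity>"
  obtains P where "sigma_compact P" "A \<subseteq> P"
proof -
  obtain W where W: "open W" "A \<subseteq> W" "emeasure M W < \<infinity>"
    using outer_regular[OF A] by blast
  let ?K = "{K. compact K \<and> K \<subseteq> W}"
  have "emeasure M ` ?K \<noteq> {}" by (auto intro: exI[of _ "{}"])
  from ennreal_Sup_countable_SUP[OF this] obtain e :: "nat \<Rightarrow> ennreal" where
    e: "range e \<subseteq> emeasure M ` ?K" "(SUP K\<in>?K. emeasure M K) = (SUP i. e i)" by blast
  have "\<forall>i. \<exists>K\<in>?K. e i = emeasure M K" using e(1) by blast
  then obtain K where K: "\<And>i. K i \<in> ?K" "\<And>i. e i = emeasure M (K i)" by metis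
  define L where "L = (\<Union>i. K i)"
  have L: "sigma_compact L" unfolding L_def by (intro sigma_compact_UN compact_imp_sigma_compact) (use K in auto)
  have LW: "L \<subseteq> W" using K unfolding L_def by auto
  have LB: "L \<in> sets borel" by (rule sigma_compact_borel[OF L])
  have "emeasure M W = (SUP K\<in>?K. emeasure M K)"
    by (rule haar[unfolded left_haar_measure_def, THEN conjunct2, THEN conjunct2, THEN conjunct2, THEN conjunct1, rule_format, OF W(1)])
  also have "\<dots> \<le> emeasure M L" unfolding e(2) K(2) using LB
    by (intro SUP_least emeasure_mono) (auto simp: L_def)
  finally have le: "emeasure M W \<le> emeasure M L" .
  have "emeasure M L \<le> emeasure M W" by (rule emeasure_mono[OF LW]) (use W in simp)
  then have "emeasure M L \<noteq> \<infinity>" using W(3) by auto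
  then have "emeasure M (W - L) = emeasure M W - emeasure M L"
    by (intro emeasure_Diff) (use W LB LW in auto)
  then have null: "emeasure M (W - L) = 0"
    using le W(3) by (simp add: diff_eq_0_ennreal)
  obtain U0 K0 where U0: "open U0" "(0::'g) \<in> U0" "U0 \<subseteq> K0" "compact K0"
    by (rule compact_neighbourhood_zero)
  define P where "P = rec_nat L (\<lambda>_ Q. (\<lambda>(x, y). x + y) ` (Q \<times> K0))"
  have P0: "P 0 = L" and PS: "P (Suc n) = (\<lambda>(x, y). x + y) ` (P n \<times> K0)" for n
    unfolding P_def by auto
  have scP: "sigma_compact (P n)" for n
    by (induct n) (simp_all only: P0 PS L sigma_compact_sum compact_imp_sigma_compact[OF U0(4)])
  \<comment> \<open>\<open>Q + K0 \<subseteq> Q\<close>, so the complement of \<open>Q\<close> contains a neighbourhood of each of its points.\<close>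
  define Q where "Q = (\<Union>n. P n)"
  have Q: "sigma_compact Q" unfolding Q_def by (intro sigma_compact_UN scP)
  have "open (- Q)"
  proof (rule topological_space_class.openI)
    fix x assume x: "x \<in> - Q"
    let ?N = "(\<lambda>y. - y + x) -` U0"
    have "open ?N" by (rule open_vimage[OF U0(1)]) (intro continuous_intros)
    moreover have "x \<in> ?N" using U0 by simp
    moreover have "?N \<subseteq> - Q"
    proof (rule subsetI, rule ComplI)
      fix y assume y: "y \<in> ?N" "y \<in> Q"
      then obtain n where "y \<in> P n" unfolding Q_def by blast
      moreover have "- y + x \<in> K0" using y U0 by auto
      ultimately have "y + (- y + x) \<in> P (Suc n)" unfolding PS by (intro image_eqI[of _ _ "(y, - y + x)"]) auto
      then have "x \<in> P (Suc n)" by (simp add: add.assoc[symmetric])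
      then show False using x unfolding Q_def by blast
    qed
    ultimately show "\<exists>T. open T \<and> x \<in> T \<and> T \<subseteq> - Q" by blast
  qed
  then have op: "open (W \<inter> - Q)" using W by auto
  have "emeasure M (W \<inter> - Q) \<le> emeasure M (W - L)"
    by (rule emeasure_mono) (use W LB P0 in \<open>auto simp: Q_def\<close>)
  then have "emeasure M (W \<inter> - Q) = 0" using null by simp
  then have "W \<inter> - Q = {}" using open_measure_pos[OF op] by fastforce
  then have "A \<subseteq> Q" using W by blast
  with Q that show ?thesis by blast
qed

lemma integrable_support_sigma_compact:
  fixes a :: "'g \<Rightarrow> complex"
  assumes a: "integrable M a"
  obtains S where "sigma_compact S" "\<And>x. a x \<noteq> 0 \<Longrightarrow> x \<in> S"
proof -
  have m: "a \<in> borel_measurable borel" using borel_measurable_integrable[OF a] by simp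
  let ?A = "\<lambda>n::nat. {x \<in> UNIV. 1 \<le> ennreal (real n) * ennreal (norm (a x))}"
  have "\<exists>P. sigma_compact P \<and> ?A n \<subseteq> P" for n
  proof -
    have A: "?A n \<in> sets borel" using m by measurable
    have "emeasure M (?A n) \<le> ennreal (real n) * (\<integral>\<^sup>+x. ennreal (norm (a x)) * indicator UNIV x \<partial>M)"
      using m by (intro nn_integral_Markov_inequality) auto
    also have "\<dots> < \<infinity>" using a by (auto simp: integrable_iff_bounded ennreal_mult_less_top)
    finally have "emeasure M (?A n) < \<infinity>" .
    from finite_measure_subset_sigma_compact[OF A this] show ?thesis by blast
  qed
  then obtain P where P: "\<And>n. sigma_compact (P n)" "\<And>n. ?A n \<subseteq> P n" by metis
  have supp: "x \<in> (\<Union>n. P n)" if "a x \<noteq> 0" for x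
  proof -
    obtain n where "1 < real n * norm (a x)" using reals_Archimedean3[of "norm (a x)"] \<open>a x \<noteq> 0\<close> by auto
    then have "x \<in> ?A n" by (simp add: ennreal_mult[symmetric])
    then have "x \<in> P n" using P(2)[of n] by (rule rev_subsetD)
    then show ?thesis by (rule UN_I[OF UNIV_I])
  qed
  show ?thesis by (rule that[OF sigma_compact_UN[OF P(1)] supp])
qed


section \<open>Pairing convolutions with bounded functions\<close>

text \<open>A locally measurable function becomes Borel when it is cut off to a \<open>\<sigma>\<close>-compact set.\<close>

lemma Linf_sigma_compact_measurable:
  assumes l: "l \<in> Linf M" and P: "sigma_compact P"
  shows "(\<lambda>x. indicator P x * l x) \<in> borel_measurable borel"
proof -
  obtain K where K: "\<And>n. compact (K n)" "incseq K" "P = (\<Union>n::nat. K n)"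
    using sigma_compact_exhaustion[OF P] by blast
  have "(\<lambda>x. indicator (K n) x * l x) \<in> borel_measurable borel" for n
    using l borel_compact[OF K(1)] emeasure_compact_finite[OF K(1)] by (auto simp: Linf_def)
  then show ?thesis
  proof (rule borel_measurable_LIMSEQ_metric)
    fix x
    have "(\<lambda>n. indicator (K n) x :: complex) \<longlonglongrightarrow> indicator P x"
      unfolding K(3) by (rule LIMSEQ_indicator_incseq[OF K(2)])
    then show "(\<lambda>n. indicator (K n) x * l x) \<longlonglongrightarrow> indicator P x * l x"
      by (intro tendsto_intros)
  qed
qed

lemma L1_conv_support:
  assumes "\<And>x. a x \<noteq> 0 \<Longrightarrow> x \<in> S" "\<And>x. b x \<noteq> 0 \<Longrightarrow> x \<in> T" "L1_conv M a b x \<noteq> 0"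
  shows "x \<in> (\<lambda>(x, y). x + y) ` (S \<times> T)"
proof (rule ccontr)
  assume x: "x \<notin> (\<lambda>(x, y). x + y) ` (S \<times> T)"
  have "a y * b (- y + x) = 0" for y
  proof (rule ccontr)
    assume "a y * b (- y + x) \<noteq> 0"
    then have "y \<in> S" "- y + x \<in> T" using assms(1,2) by auto
    then have "y + (- y + x) \<in> (\<lambda>(x, y). x + y) ` (S \<times> T)" by force
    then show False using x by (simp add: add.assoc[symmetric])
  qed
  then have "(\<lambda>y. a y * b (- y + x)) = (\<lambda>y. 0)" by (rule ext)
  then have "L1_conv M a b x = 0" unfolding L1_conv_def by simp
  with assms(3) show False by simp
qed

lemma borel_pair_maps:
  "(fst :: 'g \<times> 'g \<Rightarrow> 'g) \<in> borel_measurable borel" "(snd :: 'g \<times> 'g \<Rightarrow> 'g) \<in> borel_measurable borel"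
  "(\<lambda>p :: 'g \<times> 'g. - fst p + snd p) \<in> borel_measurable borel"
  "(\<lambda>p :: 'g \<times> 'g. fst p + snd p) \<in> borel_measurable borel"
  by (intro borel_measurable_continuous_onI continuous_intros)+

text \<open>Both sides are the integral of \<open>a(y) l(y + z) b(z)\<close>. With \<open>x = y + z\<close> this takes Fubini's theorem
  twice, once in the variables \<open>(y, x)\<close> and once in \<open>(y, z)\<close>, with left invariance in between. All
  functions live on the supports \<open>S\<close> and \<open>T\<close> of \<open>a\<close> and \<open>b\<close> and on \<open>S + T\<close>, so \<open>l\<close> may be cut off to
  \<open>S + T\<close>.\<close>

lemma L1_conv_pairing:
  assumes l: "l \<in> Linf M" "\<And>x. norm (l x) \<le> C" and a: "integrable M a" and b: "integrable M b"
  shows "integrable M (\<lambda>x. l x * L1_conv M a b x)"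
    and "(\<integral>x. l x * L1_conv M a b x \<partial>M) = (\<integral>z. (\<integral>y. a y * l (y + z) \<partial>M) * b z \<partial>M)"
proof -
  obtain S where S: "sigma_compact S" "\<And>x. a x \<noteq> 0 \<Longrightarrow> x \<in> S"
    using integrable_support_sigma_compact[OF a] by blast
  obtain T where T: "sigma_compact T" "\<And>x. b x \<noteq> 0 \<Longrightarrow> x \<in> T"
    using integrable_support_sigma_compact[OF b] by blast
  define P where "P = (\<lambda>(x, y). x + y) ` (S \<times> T)"
  have P: "sigma_compact P" unfolding P_def by (rule sigma_compact_sum[OF S(1) T(1)])
  define k where "k x = indicator P x * l x" for x
  have km: "k \<in> borel_measurable borel"
    unfolding k_def by (rule Linf_sigma_compact_measurable[OF l(1) P])
  have C: "0 \<le> C" using l(2)[of 0] norm_ge_zero order_trans by blast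
  have kC: "norm (k x) \<le> C" for x unfolding k_def using l(2)[of x] C by (auto simp: indicator_def)
  have am: "a \<in> borel_measurable borel" and bm: "b \<in> borel_measurable borel"
    using borel_measurable_integrable[OF a] borel_measurable_integrable[OF b] by auto
  have an: "(\<integral>\<^sup>+y. ennreal (norm (a y)) \<partial>M) < \<infinity>" and bn: "(\<integral>\<^sup>+y. ennreal (norm (b y)) \<partial>M) < \<infinity>"
    using a b by (auto simp: integrable_iff_bounded)
  have bound: "(\<integral>\<^sup>+y. \<integral>\<^sup>+x. ennreal (norm (a y)) * (ennreal C * ennreal (norm (b x))) \<partial>M \<partial>M) < \<infinity>"
    using am bm an bn by (simp add: nn_integral_cmult nn_integral_multc ennreal_mult_less_top)

  define F1 where "F1 p = a (fst p) * (k (snd p) * b (- fst p + snd p))" for p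
  have F1m: "F1 \<in> borel_measurable borel"
    unfolding F1_def
    by (intro borel_measurable_times measurable_compose[OF borel_pair_maps(1) am]
        measurable_compose[OF borel_pair_maps(2) km] measurable_compose[OF borel_pair_maps(3) bm])
  have F1s: "y \<in> S \<and> x \<in> P" if "F1 (y, x) \<noteq> 0" for y x
    using that S(2) by (auto simp: F1_def k_def indicator_def split: if_splits)
  have "(\<integral>\<^sup>+y. \<integral>\<^sup>+x. ennreal (norm (F1 (y, x))) \<partial>M \<partial>M)
      \<le> (\<integral>\<^sup>+y. \<integral>\<^sup>+x. ennreal (norm (a y)) * (ennreal C * ennreal (norm (b (- y + x)))) \<partial>M \<partial>M)"
    using kC C by (intro nn_integral_mono) (auto simp: F1_def norm_mult ennreal_mult[symmetric] intro!: mult_left_mono mult_right_mono)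
  also have "\<dots> = (\<integral>\<^sup>+y. \<integral>\<^sup>+x. ennreal (norm (a y)) * (ennreal C * ennreal (norm (b x))) \<partial>M \<partial>M)"
    by (intro nn_integral_cong nn_integral_translate) (use bm in measurable)
  also note bound
  finally have F1f: "(\<integral>\<^sup>+y. \<integral>\<^sup>+x. ennreal (norm (F1 (y, x))) \<partial>M \<partial>M) < \<infinity>" .
  note sw1 = complex_integral_swap[OF F1m S(1) P F1s F1f]
  have i1: "(\<integral>y. F1 (y, x) \<partial>M) = l x * L1_conv M a b x" for x
  proof -
    have "(\<integral>y. F1 (y, x) \<partial>M) = (\<integral>y. k x * (a y * b (- y + x)) \<partial>M)"
      by (rule Bochner_Integration.integral_cong) (auto simp: F1_def)
    also have "\<dots> = k x * L1_conv M a b x" unfolding L1_conv_def by simp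
    also have "\<dots> = l x * L1_conv M a b x"
      using L1_conv_support[of a S b T x] S(2) T(2) unfolding k_def P_def[symmetric]
      by (cases "L1_conv M a b x = 0") auto
    finally show ?thesis .
  qed

  define F2 where "F2 p = a (fst p) * (k (fst p + snd p) * b (snd p))" for p
  have F2m: "F2 \<in> borel_measurable borel"
    unfolding F2_def
    by (intro borel_measurable_times measurable_compose[OF borel_pair_maps(1) am]
        measurable_compose[OF borel_pair_maps(4) km] measurable_compose[OF borel_pair_maps(2) bm])
  have F2s: "y \<in> S \<and> z \<in> T" if "F2 (y, z) \<noteq> 0" for y z
    using that S(2) T(2) by (auto simp: F2_def)
  have "(\<integral>\<^sup>+y. \<integral>\<^sup>+z. ennreal (norm (F2 (y, z))) \<partial>M \<partial>M)
      \<le> (\<integral>\<^sup>+y. \<integral>\<^sup>+x. ennreal (norm (a y)) * (ennreal C * ennreal (norm (b x))) \<partial>M \<partial>M)"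
    using kC C by (intro nn_integral_mono) (auto simp: F2_def norm_mult ennreal_mult[symmetric] intro!: mult_left_mono mult_right_mono)
  also note bound
  finally have F2f: "(\<integral>\<^sup>+y. \<integral>\<^sup>+z. ennreal (norm (F2 (y, z))) \<partial>M \<partial>M) < \<infinity>" .
  note sw2 = complex_integral_swap[OF F2m S(1) T(1) F2s F2f]
  have i2: "(\<integral>y. F2 (y, z) \<partial>M) = (\<integral>y. a y * l (y + z) \<partial>M) * b z" for z
  proof -
    have "F2 (y, z) = (a y * l (y + z)) * b z" for y
    proof (cases "a y = 0 \<or> b z = 0")
      case False
      then have "(y, z) \<in> S \<times> T" using S(2) T(2) by auto
      then have "y + z \<in> P" unfolding P_def by force
      then show ?thesis by (simp add: F2_def k_def)
    qed (auto simp: F2_def)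
    then show ?thesis by simp
  qed
  have F12: "(\<integral>x. F1 (y, x) \<partial>M) = (\<integral>z. F2 (y, z) \<partial>M)" for y
  proof -
    have "(\<lambda>x. F1 (y, x)) \<in> borel_measurable borel"
      by (rule measurable_compose[OF _ F1m]) (intro borel_measurable_continuous_onI continuous_intros)
    from integral_translate[OF this, of y] have "(\<integral>x. F1 (y, x) \<partial>M) = (\<integral>z. F1 (y, y + z) \<partial>M)" ..
    also have "\<dots> = (\<integral>z. F2 (y, z) \<partial>M)" by (simp add: F1_def F2_def add.assoc[symmetric])
    finally show ?thesis .
  qed
  show "integrable M (\<lambda>x. l x * L1_conv M a b x)" using sw1(2) unfolding i1 .
  show "(\<integral>x. l x * L1_conv M a b x \<partial>M) = (\<integral>z. (\<integral>y. a y * l (y + z) \<partial>M) * b z \<partial>M)"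
    using sw1(3) sw2(3) unfolding i1 i2 F12 by simp
qed

lemma Linf_act_formula_bounded:
  fixes l :: "'g \<Rightarrow> complex"
  assumes l: "\<And>x. norm (l x) \<le> C" and a: "integrable M a"
  shows "norm (\<integral>y. a y * l (y + z) \<partial>M) \<le> C * (\<integral>y. norm (a y) \<partial>M)"
proof -
  have C: "0 \<le> C" using l[of 0] norm_ge_zero order_trans by blast
  have "norm (\<integral>y. a y * l (y + z) \<partial>M) \<le> (\<integral>y. norm (a y) * C \<partial>M)"
  proof (cases "integrable M (\<lambda>y. a y * l (y + z))")
    case True
    have "norm (\<integral>y. a y * l (y + z) \<partial>M) \<le> (\<integral>y. norm (a y * l (y + z)) \<partial>M)"
      by (rule Bochner_Integration.integral_norm_bound)
    also have "\<dots> \<le> (\<integral>y. norm (a y) * C \<partial>M)"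
      by (rule Bochner_Integration.integral_mono) (use integrable_norm[OF True] a l in \<open>auto simp: norm_mult intro!: mult_left_mono\<close>)
    finally show ?thesis .
  qed (use C in \<open>simp add: not_integrable_integral_eq\<close>)
  then show ?thesis by (simp add: mult.commute)
qed

text \<open>The function on the right of \<open>L1_conv_pairing\<close>, which thus represents \<open>l \<cdot> a\<close> for bounded \<open>l\<close>.\<close>

lemma Linf_act_formula_in_Linf:
  assumes l: "l \<in> Linf M" "\<And>x. norm (l x) \<le> C" and a: "integrable M a"
  shows "(\<lambda>z. \<integral>y. a y * l (y + z) \<partial>M) \<in> Linf M"
proof -
  obtain S where S: "sigma_compact S" "\<And>x. a x \<noteq> 0 \<Longrightarrow> x \<in> S"
    using integrable_support_sigma_compact[OF a] by blast
  have am: "a \<in> borel_measurable borel" using borel_measurable_integrable[OF a] by simp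
  have "(\<lambda>z. indicator A z * (\<integral>y. a y * l (y + z) \<partial>M)) \<in> borel_measurable M"
    if A: "A \<in> sets M" "emeasure M A < \<infinity>" for A
  proof -
    obtain T where T: "sigma_compact T" "A \<subseteq> T"
      using finite_measure_subset_sigma_compact[of A] A by auto
    define P where "P = (\<lambda>(x, y). x + y) ` (S \<times> T)"
    have P: "sigma_compact P" unfolding P_def by (rule sigma_compact_sum[OF S(1) T(1)])
    define k where "k x = indicator P x * l x" for x
    have km: "k \<in> borel_measurable borel"
      unfolding k_def by (rule Linf_sigma_compact_measurable[OF l(1) P])
    define F where "F p = indicator A (snd p) * (a (fst p) * k (fst p + snd p))" for p
    have im: "(indicator A :: 'g \<Rightarrow> complex) \<in> borel_measurable borel" using A by simp
    have Fm: "F \<in> borel_measurable borel"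
      unfolding F_def
      by (intro borel_measurable_times measurable_compose[OF borel_pair_maps(1) am]
          measurable_compose[OF borel_pair_maps(4) km] measurable_compose[OF borel_pair_maps(2) im])
    have Fs: "y \<in> S \<and> z \<in> T" if "F (y, z) \<noteq> 0" for y z
      using that S(2) T(2) by (auto simp: F_def indicator_def split: if_splits)
    have "indicator A z * (\<integral>y. a y * l (y + z) \<partial>M) = (\<integral>y. F (y, z) \<partial>M)" for z
    proof -
      have "F (y, z) = indicator A z * (a y * l (y + z))" for y
      proof (cases "a y = 0 \<or> z \<notin> A")
        case False
        then have "(y, z) \<in> S \<times> T" using S(2) T(2) by auto
        then have "y + z \<in> P" unfolding P_def by force
        then show ?thesis by (simp add: F_def k_def)
      qed (auto simp: F_def)
      then show ?thesis by simp
    qed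
    then show ?thesis using complex_integral_section_measurable(2)[OF Fm S(1) T(1) Fs] by simp
  qed
  moreover have "loc_AE M (\<lambda>z. norm (\<integral>y. a y * l (y + z) \<partial>M) \<le> C * (\<integral>y. norm (a y) \<partial>M))"
    using Linf_act_formula_bounded[of l C a, OF l(2) a] by (simp add: loc_AE_def)
  ultimately show ?thesis unfolding Linf_def by blast
qed

text \<open>Replacing \<open>l\<close> by a function bounded everywhere avoids tracking exceptional null sets under
  translation.\<close>

lemma Linf_truncate:
  assumes l: "l \<in> Linf M"
  obtains k C where "k \<in> Linf M" "\<And>x. norm (k x) \<le> C" "loc_AE M (\<lambda>x. l x = k x)"
proof -
  obtain C where C: "loc_AE M (\<lambda>x. norm (l x) \<le> C)" using l unfolding Linf_def by blast
  define D where "D = max 0 C"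
  \<comment> \<open>The bound \<open>D\<close> is nonnegative so that the value 0 respects it.\<close>
  define k where "k x = (if norm (l x) \<le> D then l x else 0)" for x
  have "(\<lambda>x. indicator A x * k x) \<in> borel_measurable M" if A: "A \<in> sets M" "emeasure M A < \<infinity>" for A
  proof -
    have [measurable]: "(\<lambda>x. indicator A x * l x) \<in> borel_measurable M" using l A by (auto simp: Linf_def)
    have "(\<lambda>x. indicator A x * k x) = (\<lambda>x. if norm (indicator A x * l x) \<le> D then indicator A x * l x else 0)"
      by (auto simp: k_def indicator_def D_def)
    then show ?thesis by simp
  qed
  moreover have b: "norm (k x) \<le> D" for x by (auto simp: k_def D_def)
  ultimately have "k \<in> Linf M" unfolding Linf_def loc_AE_def by auto
  moreover have "loc_AE M (\<lambda>x. l x = k x)"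
    unfolding loc_AE_def
  proof (intro ballI impI)
    fix A assume "A \<in> sets M" "emeasure M A < \<infinity>"
    then have "AE x in M. x \<in> A \<longrightarrow> norm (l x) \<le> C" using C unfolding loc_AE_def by blast
    then show "AE x in M. x \<in> A \<longrightarrow> l x = k x" by eventually_elim (auto simp: k_def D_def)
  qed
  ultimately show ?thesis using that b by blast
qed

lemma one_in_Linf: "(\<lambda>x. 1) \<in> Linf M"
  by (auto simp: Linf_def loc_AE_def intro!: exI[of _ 1])

lemma integrable_L1_conv:
  assumes "integrable M a" "integrable M b"
  shows "integrable M (L1_conv M a b)"
  using L1_conv_pairing(1)[OF one_in_Linf, of 1] assms by simp

lemma loc_AE_sigma_compact:
  assumes "loc_AE M Q" "sigma_compact P"
  shows "AE x in M. x \<in> P \<longrightarrow> Q x"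
proof -
  obtain K where K: "\<And>n. compact (K n)" "P = (\<Union>n::nat. K n)"
    using sigma_compact_exhaustion[OF assms(2)] by blast
  have "AE x in M. x \<in> K n \<longrightarrow> Q x" for n
    using assms(1) borel_compact[OF K(1)] emeasure_compact_finite[OF K(1)] by (auto simp: loc_AE_def)
  then have "AE x in M. \<forall>n. x \<in> K n \<longrightarrow> Q x" by (subst AE_all_countable) auto
  then show ?thesis by eventually_elim (auto simp: K)
qed

lemma integral_mult_Linf_cong:
  assumes l: "l \<in> Linf M" and k: "k \<in> Linf M" and lk: "loc_AE M (\<lambda>x. l x = k x)" and a: "integrable M a"
  shows "(\<integral>x. l x * a x \<partial>M) = (\<integral>x. k x * a x \<partial>M)"
proof -
  obtain S where S: "sigma_compact S" "\<And>x. a x \<noteq> 0 \<Longrightarrow> x \<in> S"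
    using integrable_support_sigma_compact[OF a] by blast
  have am: "a \<in> borel_measurable borel" using borel_measurable_integrable[OF a] by simp
  have m: "(\<lambda>x. h x * a x) \<in> borel_measurable M" if "h \<in> Linf M" for h
  proof -
    have "(\<lambda>x. h x * a x) = (\<lambda>x. (indicator S x * h x) * a x)"
      using S(2) by (auto simp: indicator_def fun_eq_iff)
    then show ?thesis using Linf_sigma_compact_measurable[OF that S(1)] am by simp
  qed
  have "AE x in M. l x * a x = k x * a x"
    using loc_AE_sigma_compact[OF lk S(1)] by eventually_elim (use S(2) in force)
  then show ?thesis by (rule integral_cong_AE[OF m[OF l] m[OF k]])
qed


section \<open>The dual of the bounded functions and the Arens product\<close>

lemma Linf_measurable_on:
  "f \<in> Linf M \<Longrightarrow> A \<in> sets M \<Longrightarrow> emeasure M A < \<infinity> \<Longrightarrow> (\<lambda>x. indicator A x * f x) \<in> borel_measurable M"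
  by (simp add: Linf_def)

lemma loc_AE_conj: "loc_AE M P \<Longrightarrow> loc_AE M Q \<Longrightarrow> loc_AE M (\<lambda>x. P x \<and> Q x)"
  unfolding loc_AE_def by (intro ballI impI) (drule bspec, assumption, drule bspec, assumption, auto)

lemma loc_AE_mono: "loc_AE M P \<Longrightarrow> (\<And>x. P x \<Longrightarrow> Q x) \<Longrightarrow> loc_AE M Q"
  unfolding loc_AE_def by (intro ballI impI) (drule bspec, assumption, auto elim!: eventually_mono)

lemma Linf_norm_set_nonempty:
  assumes "l \<in> Linf M"
  shows "{C. 0 \<le> C \<and> loc_AE M (\<lambda>x. norm (l x) \<le> C)} \<noteq> {}"
proof -
  obtain C where "loc_AE M (\<lambda>x. norm (l x) \<le> C)" using assms unfolding Linf_def by blast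
  then have "loc_AE M (\<lambda>x. norm (l x) \<le> max 0 C)" by (rule loc_AE_mono) simp
  then have "max 0 C \<in> {C. 0 \<le> C \<and> loc_AE M (\<lambda>x. norm (l x) \<le> C)}" by simp
  then show ?thesis by blast
qed

lemma Linf_norm_le: "0 \<le> C \<Longrightarrow> loc_AE M (\<lambda>x. norm (l x) \<le> C) \<Longrightarrow> Linf_norm M l \<le> C"
  unfolding Linf_norm_def by (rule cInf_lower) (auto intro!: bdd_belowI[of _ 0])

lemma Linf_norm_nonneg: "l \<in> Linf M \<Longrightarrow> 0 \<le> Linf_norm M l"
  unfolding Linf_norm_def by (rule cInf_greatest[OF Linf_norm_set_nonempty]) auto

text \<open>The essential supremum is attained, since countably many exceptional null sets can be united.\<close>

lemma Linf_norm_bound: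
  assumes l: "l \<in> Linf M"
  shows "loc_AE M (\<lambda>x. norm (l x) \<le> Linf_norm M l)"
  unfolding loc_AE_def
proof (intro ballI impI)
  fix A assume A: "A \<in> sets M" "emeasure M A < \<infinity>"
  have "AE x in M. x \<in> A \<longrightarrow> norm (l x) \<le> Linf_norm M l + 1 / real (Suc n)" for n
  proof -
    have "Linf_norm M l < Linf_norm M l + 1 / real (Suc n)" by simp
    then obtain C where C: "loc_AE M (\<lambda>x. norm (l x) \<le> C)" "C < Linf_norm M l + 1 / real (Suc n)"
      using cInf_lessD[OF Linf_norm_set_nonempty[OF l]] unfolding Linf_norm_def by blast
    have "AE x in M. x \<in> A \<longrightarrow> norm (l x) \<le> C" using C(1) A unfolding loc_AE_def by blast
    then show ?thesis by eventually_elim (use C(2) in auto)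
  qed
  then have "AE x in M. \<forall>n. x \<in> A \<longrightarrow> norm (l x) \<le> Linf_norm M l + 1 / real (Suc n)"
    by (subst AE_all_countable) auto
  then show "AE x in M. x \<in> A \<longrightarrow> norm (l x) \<le> Linf_norm M l"
  proof eventually_elim
    case (elim x)
    show ?case
    proof (rule impI, rule field_le_epsilon)
      fix e :: real assume "x \<in> A" "0 < e"
      obtain n where "1 / real (Suc n) < e" using nat_approx_posE[OF \<open>0 < e\<close>] by blast
      then show "norm (l x) \<le> Linf_norm M l + e" using elim[rule_format, OF \<open>x \<in> A\<close>, of n] by linarith
    qed
  qed
qed

lemma Linf_lincomb:
  assumes f: "f \<in> Linf M" and g: "g \<in> Linf M"
  shows "(\<lambda>x. f x + c * g x) \<in> Linf M"
proof -
  have "(\<lambda>x. indicator A x * (f x + c * g x)) \<in> borel_measurable M" if "A \<in> sets M" "emeasure M A < \<infinity>" for A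
  proof -
    have "(\<lambda>x. indicator A x * f x + c * (indicator A x * g x)) \<in> borel_measurable M"
      by (intro borel_measurable_add borel_measurable_times borel_measurable_const Linf_measurable_on f g that)
    then show ?thesis by (simp add: algebra_simps)
  qed
  moreover have "loc_AE M (\<lambda>x. norm (f x + c * g x) \<le> Linf_norm M f + norm c * Linf_norm M g)"
  proof (rule loc_AE_mono[OF loc_AE_conj[OF Linf_norm_bound[OF f] Linf_norm_bound[OF g]]])
    fix x assume *: "norm (f x) \<le> Linf_norm M f \<and> norm (g x) \<le> Linf_norm M g"
    have "norm (f x + c * g x) \<le> norm (f x) + norm c * norm (g x)"
      by (metis norm_mult norm_triangle_ineq)
    also have "\<dots> \<le> Linf_norm M f + norm c * Linf_norm M g"
      using * by (intro add_mono mult_left_mono) auto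
    finally show "norm (f x + c * g x) \<le> Linf_norm M f + norm c * Linf_norm M g" .
  qed
  ultimately show ?thesis unfolding Linf_def by blast
qed

lemma zero_in_Linf: "(\<lambda>x. 0) \<in> Linf M"
  by (auto simp: Linf_def loc_AE_def intro!: exI[of _ 0])

lemma Linf_scale: "g \<in> Linf M \<Longrightarrow> (\<lambda>x. c * g x) \<in> Linf M"
  using Linf_lincomb[OF zero_in_Linf, of g c] by simp

lemma Linf_add: "f \<in> Linf M \<Longrightarrow> g \<in> Linf M \<Longrightarrow> (\<lambda>x. f x + g x) \<in> Linf M"
  using Linf_lincomb[of f g 1] by simp

lemma indicator_in_Linf: "A \<in> sets borel \<Longrightarrow> indicator A \<in> Linf M"
  by (auto simp: Linf_def loc_AE_def indicator_def intro!: exI[of _ 1])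

lemma Linf_indicator_mult:
  assumes f: "f \<in> Linf M" and B: "B \<in> sets borel"
  shows "(\<lambda>x. indicator B x * f x) \<in> Linf M"
proof -
  have "(\<lambda>x. indicator A x * (indicator B x * f x)) \<in> borel_measurable M" if "A \<in> sets M" "emeasure M A < \<infinity>" for A
  proof -
    have "(\<lambda>x. indicator A x * f x) \<in> borel_measurable M" by (rule Linf_measurable_on[OF f that])
    then have "(\<lambda>x. indicator B x * (indicator A x * f x)) \<in> borel_measurable M"
      by (rule borel_measurable_times[OF borel_measurable_indicator, rotated]) (use B in simp)
    then show ?thesis by (simp add: mult.left_commute)
  qed
  moreover have "loc_AE M (\<lambda>x. norm (indicator B x * f x) \<le> Linf_norm M f)"
    by (rule loc_AE_mono[OF Linf_norm_bound[OF f]]) (use Linf_norm_nonneg[OF f] in \<open>auto simp: indicator_def\<close>)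
  ultimately show ?thesis unfolding Linf_def by blast
qed

lemma Linf_dual_add:
  "F \<in> Linf_dual M \<Longrightarrow> f \<in> Linf M \<Longrightarrow> g \<in> Linf M \<Longrightarrow> F (\<lambda>x. f x + g x) = F f + F g"
  by (simp add: Linf_dual_def)

lemma Linf_dual_scale: "F \<in> Linf_dual M \<Longrightarrow> f \<in> Linf M \<Longrightarrow> F (\<lambda>x. c * f x) = c * F f"
  by (simp add: Linf_dual_def)

lemma Linf_dual_cong:
  assumes F: "F \<in> Linf_dual M" and l: "l \<in> Linf M" and k: "k \<in> Linf M" and lk: "loc_AE M (\<lambda>x. l x = k x)"
  shows "F l = F k"
proof -
  let ?d = "\<lambda>x. l x + (- 1) * k x"
  have d: "?d \<in> Linf M" by (rule Linf_lincomb[OF l k])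
  have "Linf_norm M ?d \<le> 0"
    by (rule Linf_norm_le) (auto intro: loc_AE_mono[OF lk])
  then have n0: "Linf_norm M ?d = 0" using Linf_norm_nonneg[OF d] by simp
  obtain B where "\<forall>f\<in>Linf M. norm (F f) \<le> B * Linf_norm M f" using F unfolding Linf_dual_def by blast
  then have "F ?d = 0" using d n0 by (metis mult_zero_right norm_le_zero_iff)
  moreover have "F ?d = F l + F (\<lambda>x. (- 1) * k x)" "F (\<lambda>x. (- 1) * k x) = (- 1) * F k"
    by (rule Linf_dual_add[OF F l Linf_scale[OF k]], rule Linf_dual_scale[OF F k])
  ultimately show ?thesis by simp
qed

lemma integrable_Linf_mult:
  assumes l: "l \<in> Linf M" and a: "integrable M a"
  shows "integrable M (\<lambda>x. l x * a x)"
proof -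
  obtain S where S: "sigma_compact S" "\<And>x. a x \<noteq> 0 \<Longrightarrow> x \<in> S"
    using integrable_support_sigma_compact[OF a] by blast
  have am: "a \<in> borel_measurable borel" using borel_measurable_integrable[OF a] by simp
  have eq: "(\<lambda>x. l x * a x) = (\<lambda>x. (indicator S x * l x) * a x)"
    using S(2) by (auto simp: indicator_def fun_eq_iff)
  have "integrable M (\<lambda>x. of_real (Linf_norm M l) * a x)" using a by simp
  then show ?thesis
  proof (rule Bochner_Integration.integrable_bound)
    show "(\<lambda>x. l x * a x) \<in> borel_measurable M"
      unfolding eq using Linf_sigma_compact_measurable[OF l S(1)] am by simp
    show "AE x in M. norm (l x * a x) \<le> norm (of_real (Linf_norm M l) * a x)"
      using loc_AE_sigma_compact[OF Linf_norm_bound[OF l] S(1)]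
    proof eventually_elim
      case (elim x)
      show ?case
      proof (cases "a x = 0")
        case False
        then have "norm (l x) \<le> Linf_norm M l" using elim S(2) by blast
        then show ?thesis using Linf_norm_nonneg[OF l] by (simp add: norm_mult mult_right_mono)
      qed simp
    qed
  qed
qed

text \<open>On a set \<open>A\<close> of finite measure, test the difference \<open>d\<close> against the integrable function
  \<open>cnj (1\<^sub>A d)\<close>, which yields \<open>\<integral>\<^sub>A |d|\<^sup>2 = 0\<close>.\<close>

lemma Linf_eq_if_same_pairing:
  assumes l: "l \<in> Linf M" and k: "k \<in> Linf M"
    and eq: "\<And>a. integrable M a \<Longrightarrow> (\<integral>x. l x * a x \<partial>M) = (\<integral>x. k x * a x \<partial>M)"
  shows "loc_AE M (\<lambda>x. l x = k x)"
  unfolding loc_AE_def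
proof (intro ballI impI)
  fix A assume A: "A \<in> sets M" "emeasure M A < \<infinity>"
  define d where "d x = l x + (- 1) * k x" for x
  have d: "d \<in> Linf M" unfolding d_def by (rule Linf_lincomb[OF l k])
  have [measurable]: "(\<lambda>x. indicator A x * d x) \<in> borel_measurable M" by (rule Linf_measurable_on[OF d A])
  define a where "a x = cnj (indicator A x * d x)" for x
  have cnjm: "cnj \<in> borel_measurable borel" by (intro borel_measurable_continuous_onI continuous_intros)
  have "AE x in M. x \<in> A \<longrightarrow> norm (d x) \<le> Linf_norm M d" using Linf_norm_bound[OF d] A unfolding loc_AE_def by blast
  then have bnd: "AE x \<in> A in M. norm (a x) \<le> Linf_norm M d"
    by eventually_elim (auto simp: a_def)
  have am: "a \<in> borel_measurable M"
    unfolding a_def by (rule measurable_compose[OF _ cnjm]) measurable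
  have a: "integrable M a"
    by (rule integrableI_bounded_set[OF A(1) am A(2) bnd]) (auto simp: a_def)
  have "(\<integral>x. d x * a x \<partial>M) = 0"
  proof -
    have "(\<integral>x. d x * a x \<partial>M) = (\<integral>x. l x * a x + (- 1) * (k x * a x) \<partial>M)"
      by (simp add: d_def algebra_simps)
    also have "\<dots> = (\<integral>x. l x * a x \<partial>M) + (- 1) * (\<integral>x. k x * a x \<partial>M)"
      using integrable_Linf_mult[OF l a] integrable_Linf_mult[OF k a] by simp
    finally show ?thesis using eq[OF a] by simp
  qed
  moreover have da: "d x * a x = complex_of_real ((norm (indicator A x * d x))\<^sup>2)" for x
    unfolding complex_norm_square a_def by (auto simp: indicator_def)
  ultimately have "complex_of_real (\<integral>x. (norm (indicator A x * d x))\<^sup>2 \<partial>M) = 0" 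
    unfolding da integral_complex_of_real by simp
  then have "(\<integral>x. (norm (indicator A x * d x))\<^sup>2 \<partial>M) = 0" by simp
  moreover have "integrable M (\<lambda>x. (norm (indicator A x * d x))\<^sup>2)"
    using integrable_Linf_mult[OF d a] unfolding da by (simp only: complex_of_real_integrable_eq)
  ultimately have "AE x in M. (norm (indicator A x * d x))\<^sup>2 = 0"
    by (subst integral_nonneg_eq_0_iff_AE[symmetric]) auto
  then show "AE x in M. x \<in> A \<longrightarrow> l x = k x" by eventually_elim (auto simp: d_def)
qed

lemma L1_dual_rep_props:
  assumes "h \<in> Linf M" "\<forall>a. integrable M a \<longrightarrow> (\<integral>x. h x * a x \<partial>M) = \<phi> a"
  shows "L1_dual_rep M \<phi> \<in> Linf M"
    and "integrable M a \<Longrightarrow> (\<integral>x. L1_dual_rep M \<phi> x * a x \<partial>M) = \<phi> a"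
proof -
  have "L1_dual_rep M \<phi> \<in> Linf M \<and> (\<forall>a. integrable M a \<longrightarrow> (\<integral>x. L1_dual_rep M \<phi> x * a x \<partial>M) = \<phi> a)"
    unfolding L1_dual_rep_def by (rule someI[of _ h]) (use assms in blast)
  then show "L1_dual_rep M \<phi> \<in> Linf M"
    and "integrable M a \<Longrightarrow> (\<integral>x. L1_dual_rep M \<phi> x * a x \<partial>M) = \<phi> a" by blast+
qed

text \<open>Functionals on \<open>L\<^sup>\<infinity>\<close> do not see the choice made in \<open>L1_dual_rep\<close>.\<close>

lemma Linf_dual_L1_dual_rep:
  assumes F: "F \<in> Linf_dual M" and h: "h \<in> Linf M" "\<And>a. integrable M a \<Longrightarrow> (\<integral>x. h x * a x \<partial>M) = \<phi> a"
  shows "F (L1_dual_rep M \<phi>) = F h"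
proof (rule Linf_dual_cong[OF F _ h(1)])
  have "\<forall>a. integrable M a \<longrightarrow> (\<integral>x. h x * a x \<partial>M) = \<phi> a" using h(2) by blast
  note r = L1_dual_rep_props[OF h(1) this]
  show "L1_dual_rep M \<phi> \<in> Linf M" by (rule r(1))
  show "loc_AE M (\<lambda>x. L1_dual_rep M \<phi> x = h x)"
  proof (rule Linf_eq_if_same_pairing[OF r(1) h(1)])
    fix a :: "'g \<Rightarrow> complex" assume a: "integrable M a"
    show "(\<integral>x. L1_dual_rep M \<phi> x * a x \<partial>M) = (\<integral>x. h x * a x \<partial>M)"
      by (rule trans[OF r(2)[OF a] h(2)[OF a, symmetric]])
  qed
qed

text \<open>The module action is well defined: a bounded truncation of \<open>l\<close> supplies a representing function.\<close>

lemma Linf_act_L1_props: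
  assumes l: "l \<in> Linf M" and a: "integrable M a"
  shows "Linf_act_L1 M l a \<in> Linf M"
    and "integrable M b \<Longrightarrow> (\<integral>x. Linf_act_L1 M l a x * b x \<partial>M) = (\<integral>x. l x * L1_conv M a b x \<partial>M)"
proof -
  obtain k C where k: "k \<in> Linf M" "\<And>x. norm (k x) \<le> C" "loc_AE M (\<lambda>x. l x = k x)"
    using Linf_truncate[OF l] by blast
  have *: "\<forall>b. integrable M b \<longrightarrow> (\<integral>z. (\<integral>y. a y * k (y + z) \<partial>M) * b z \<partial>M) = (\<integral>x. l x * L1_conv M a b x \<partial>M)"
  proof (intro allI impI)
    fix b :: "'g \<Rightarrow> complex" assume b: "integrable M b"
    show "(\<integral>z. (\<integral>y. a y * k (y + z) \<partial>M) * b z \<partial>M) = (\<integral>x. l x * L1_conv M a b x \<partial>M)"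
    using L1_conv_pairing(2)[OF k(1,2) a b] integral_mult_Linf_cong[OF l k(1,3) integrable_L1_conv[OF a b]] by simp
  qed
  note r = L1_dual_rep_props[OF Linf_act_formula_in_Linf[OF k(1,2) a] *]
  show "Linf_act_L1 M l a \<in> Linf M" unfolding Linf_act_L1_def by (rule r(1))
  show "integrable M b \<Longrightarrow> (\<integral>x. Linf_act_L1 M l a x * b x \<partial>M) = (\<integral>x. l x * L1_conv M a b x \<partial>M)"
    unfolding Linf_act_L1_def by (rule r(2))
qed

text \<open>Under the hypothesis \<open>E \<cdot> l = l\<close>, both being represented by the functional \<open>a \<mapsto> \<integral> l a\<close> on \<open>L\<^sup>1\<close>.\<close>

lemma arens_right_identity:
  assumes E: "\<And>l a. l \<in> Linf M \<Longrightarrow> integrable M a \<Longrightarrow> E (Linf_act_L1 M l a) = (\<integral>x. l x * a x \<partial>M)"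
    and F: "F \<in> Linf_dual M"
  shows "arens M F E = F"
proof
  fix l
  show "arens M F E l = F l"
  proof (cases "l \<in> Linf M")
    case True
    then show ?thesis
      unfolding arens_def dual_act_Linf_def using Linf_dual_L1_dual_rep[OF F True] E[OF True] by simp
  next
    case False
    then show ?thesis using F by (simp add: arens_def Linf_dual_def)
  qed
qed

lemma arens_right_annihilator:
  assumes N: "\<And>l a. l \<in> Linf M \<Longrightarrow> integrable M a \<Longrightarrow> N (Linf_act_L1 M l a) = 0"
    and F: "F \<in> Linf_dual M"
  shows "arens M F N = (\<lambda>l. 0)"
proof
  fix l
  show "arens M F N l = 0"
  proof (cases "l \<in> Linf M")
    case True
    have "F (dual_act_Linf M N l) = F (\<lambda>x. 0)"
      unfolding dual_act_Linf_def by (rule Linf_dual_L1_dual_rep[OF F zero_in_Linf]) (use N[OF True] in simp)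
    also have "F (\<lambda>x. 0) = 0 * F (\<lambda>x. 0)"
    proof -
      show ?thesis using Linf_dual_scale[OF F zero_in_Linf, of 0] by simp
    qed
    finally show ?thesis by (simp add: arens_def)
  qed (simp add: arens_def)
qed


section \<open>Normalised indicators as a right approximate identity\<close>

lemma complex_integral_indicator:
  assumes "A \<in> sets borel" "emeasure M A < \<infinity>"
  shows "integrable M (indicator A :: 'g \<Rightarrow> complex)" "(\<integral>x. indicator A x \<partial>M) = complex_of_real (measure M A)"
proof -
  have eq: "(indicator A :: 'g \<Rightarrow> complex) = (\<lambda>x. complex_of_real (indicator A x))"
    by (auto simp: indicator_def)
  show "integrable M (indicator A :: 'g \<Rightarrow> complex)"
    unfolding eq complex_of_real_integrable_eq using assms by simp
  show "(\<integral>x. indicator A x \<partial>M) = complex_of_real (measure M A)"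
    unfolding eq integral_complex_of_real using assms by simp
qed

text \<open>The set \<open>{y. - y + x \<in> A}\<close> is \<open>x - A\<close>.\<close>

lemma L1_conv_indicator:
  assumes "P \<in> sets borel" "A \<in> sets borel"
  shows "L1_conv M (indicator P) (indicator A) x = complex_of_real (measure M (P \<inter> (\<lambda>y. - y + x) -` A))"
proof -
  have "(\<lambda>y. - y + x) \<in> borel_measurable borel"
    by (intro borel_measurable_continuous_onI continuous_intros)
  then have "(\<lambda>y. - y + x) -` A \<in> sets borel" using measurable_sets[of "\<lambda>y. - y + x" borel borel A] assms by simp
  then have B: "P \<inter> (\<lambda>y. - y + x) -` A \<in> sets borel" using assms by simp
  have "L1_conv M (indicator P) (indicator A) x = (\<integral>y. complex_of_real (indicator (P \<inter> (\<lambda>y. - y + x) -` A) y) \<partial>M)"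
    unfolding L1_conv_def by (rule Bochner_Integration.integral_cong) (auto simp: indicator_def)
  also have "\<dots> = complex_of_real (measure M (P \<inter> (\<lambda>y. - y + x) -` A))"
    unfolding integral_complex_of_real using B by simp
  finally show ?thesis .
qed

lemma integral_indicator_conv:
  assumes P: "P \<in> sets borel" "emeasure M P < \<infinity>" and A: "A \<in> sets borel" "emeasure M A < \<infinity>"
  shows "integrable M (\<lambda>x. measure M (P \<inter> (\<lambda>y. - y + x) -` A))"
    and "(\<integral>x. measure M (P \<inter> (\<lambda>y. - y + x) -` A) \<partial>M) = measure M P * measure M A"
proof -
  note p = complex_integral_indicator[OF P] and a = complex_integral_indicator[OF A]
  note pr = L1_conv_pairing[OF one_in_Linf, of 1, OF _ p(1) a(1)]
  show "integrable M (\<lambda>x. measure M (P \<inter> (\<lambda>y. - y + x) -` A))"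
    using pr(1) by (simp add: L1_conv_indicator P A complex_of_real_integrable_eq)
  have "complex_of_real (\<integral>x. measure M (P \<inter> (\<lambda>y. - y + x) -` A) \<partial>M)
      = (\<integral>x. 1 * L1_conv M (indicator P) (indicator A) x \<partial>M)"
    by (simp add: L1_conv_indicator P A)
  also have "\<dots> = (\<integral>z. (\<integral>y. indicator P y * 1 \<partial>M) * indicator A z \<partial>M)"
    by (rule pr(2)) simp
  also have "\<dots> = complex_of_real (measure M P * measure M A)"
    using p(2) a(2) by simp
  finally show "(\<integral>x. measure M (P \<inter> (\<lambda>y. - y + x) -` A) \<partial>M) = measure M P * measure M A"
    unfolding of_real_eq_iff .
qed

lemma compact_add_neighbourhood:
  assumes "compact K" "open W" "K \<subseteq> (W :: 'g set)"
  obtains U where "open U" "0 \<in> U" "\<And>k u. k \<in> K \<Longrightarrow> u \<in> U \<Longrightarrow> k + u \<in> W"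
proof -
  let ?W = "(\<lambda>p. snd p + fst p) -` W"
  have op: "open ?W" by (rule open_vimage[OF assms(2)]) (intro continuous_intros)
  have sub: "{0} \<times> K \<subseteq> ?W" using assms(3) by auto
  obtain U where U: "0 \<in> U" "open U" "U \<times> K \<subseteq> ?W"
    using Elementary_Topology.tube_lemma[OF assms(1) op sub] by blast
  show ?thesis
  proof (rule that[OF U(2,1)])
    fix k u assume "k \<in> K" "u \<in> U"
    then have "(u, k) \<in> ?W" using U(3) by blast
    then show "k + u \<in> W" by simp
  qed
qed

lemma measure_reflected_translate:
  assumes A: "A \<in> sets borel"
  shows "measure M ((\<lambda>y. - y + x) -` A) = measure M (uminus -` A)"
proof -
  have "uminus -` A \<in> sets borel" using measurable_sets[OF uminus_borel A] by simp
  from emeasure_translate_image[OF this, of x]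
  have "emeasure M ((+) (- x) -` uminus -` A) = emeasure M (uminus -` A)"
    unfolding translate_image_eq_vimage .
  moreover have "(+) (- x) -` uminus -` A = (\<lambda>y. - y + x) -` A"
    by (simp add: vimage_def minus_add)
  ultimately show ?thesis by (simp add: measure_def)
qed

lemma emeasure_subset_compact_finite:
  assumes "compact K" "A \<subseteq> K"
  shows "emeasure M A < \<infinity>"
  using emeasure_mono[OF assms(2), of M] borel_compact[OF assms(1)] emeasure_compact_finite[OF assms(1)] by (simp add: le_less_trans)

text \<open>Continuity of the modular function at 0, in the form of an upper bound and without its
  construction. Take a compact \<open>K\<close> of positive measure and an open \<open>W \<supseteq> K\<close> of nearly the same
  measure. If \<open>A\<close> is so small that \<open>K - A \<subseteq> W\<close>, then \<open>|W \<inter> (x - A)| = |- A|\<close> for \<open>x \<in> K\<close>, so that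
  integrating over \<open>x\<close> gives \<open>|K| |- A| \<le> |W| |A|\<close>.\<close>

lemma measure_reflection_near_zero:
  assumes \<delta>: "0 < \<delta>"
  obtains U where "open U" "0 \<in> U" 
    "\<And>A. A \<in> sets borel \<Longrightarrow> A \<subseteq> U \<Longrightarrow> measure M (uminus -` A) \<le> (1 + \<delta>) * measure M A"
proof -
  obtain U0 K where U0: "open U0" "(0::'g) \<in> U0" "U0 \<subseteq> K" "compact K"
    by (rule compact_neighbourhood_zero)
  have KB: "K \<in> sets borel" by (rule borel_compact[OF U0(4)])
  have Kf: "emeasure M K < \<infinity>" by (rule emeasure_compact_finite[OF U0(4)])
  have "0 < emeasure M U0" by (rule open_measure_pos[OF U0(1,2)])
  also have "\<dots> \<le> emeasure M K" using U0(3) KB by (intro emeasure_mono) auto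
  finally have m0: "0 < measure M K" using Kf by (simp add: measure_def enn2real_positive_iff)
  have "emeasure M K < ennreal ((1 + \<delta>) * measure M K)"
    using Kf m0 \<delta> by (subst emeasure_eq_ennreal_measure) (auto simp: less_top intro!: ennreal_lessI)
  then obtain W where W: "open W" "K \<subseteq> W" "emeasure M W < ennreal ((1 + \<delta>) * measure M K)"
    using outer_regular[OF KB] by blast
  have Wf: "emeasure M W < \<infinity>" using W(3) by (rule order.strict_trans) simp
  have Wm: "measure M W \<le> (1 + \<delta>) * measure M K"
    using W(3) Wf m0 \<delta> by (subst (asm) emeasure_eq_ennreal_measure) (auto simp: less_top ennreal_less_iff)
  obtain U1 where U1: "open U1" "0 \<in> U1" "\<And>k u. k \<in> K \<Longrightarrow> u \<in> U1 \<Longrightarrow> k + u \<in> W"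
    using compact_add_neighbourhood[OF U0(4) W(1,2)] by blast
  \<comment> \<open>The reflected copies keep both \<open>A\<close> and \<open>- A\<close> inside the compact set, hence of finite measure.\<close>
  define U where "U = U0 \<inter> uminus -` U0 \<inter> uminus -` U1"
  have cm: "continuous_on UNIV (uminus :: 'g \<Rightarrow> 'g)" by (intro continuous_intros)
  have "open U" unfolding U_def using U0(1) U1(1) by (intro open_Int open_vimage cm)
  moreover have "0 \<in> U" unfolding U_def using U0(2) U1(2) by simp
  moreover have "measure M (uminus -` A) \<le> (1 + \<delta>) * measure M A" if A: "A \<in> sets borel" "A \<subseteq> U" for A
  proof -
    have Af: "emeasure M A < \<infinity>"
      by (rule emeasure_subset_compact_finite[OF U0(4)]) (use A(2) U0(3) in \<open>auto simp: U_def\<close>)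
    note c = integral_indicator_conv[OF borel_open[OF W(1)] Wf A(1) Af]
    have "measure M K * measure M (uminus -` A) = (\<integral>x. indicator K x * measure M (uminus -` A) \<partial>M)"
      using KB by simp
    also have "\<dots> \<le> (\<integral>x. measure M (W \<inter> (\<lambda>y. - y + x) -` A) \<partial>M)"
    proof (rule Bochner_Integration.integral_mono)
      show "integrable M (\<lambda>x. indicator K x * measure M (uminus -` A))" using KB Kf by simp
      show "integrable M (\<lambda>x. measure M (W \<inter> (\<lambda>y. - y + x) -` A))" by (rule c(1))
      fix x
      show "indicator K x * measure M (uminus -` A) \<le> measure M (W \<inter> (\<lambda>y. - y + x) -` A)"
      proof (cases "x \<in> K")
        case True
        have "(\<lambda>y. - y + x) -` A \<subseteq> W"
        proof
          fix y assume "y \<in> (\<lambda>y. - y + x) -` A"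
          then have "- (- y + x) \<in> U1" using A(2) unfolding U_def by auto
          then have "x + - (- y + x) \<in> W" by (rule U1(3)[OF True])
          then show "y \<in> W" by (simp add: minus_add add.assoc[symmetric])
        qed
        then have "W \<inter> (\<lambda>y. - y + x) -` A = (\<lambda>y. - y + x) -` A" by blast
        then show ?thesis using True measure_reflected_translate[OF A(1)] by simp
      qed simp
    qed
    also have "\<dots> = measure M W * measure M A" by (rule c(2))
    also have "\<dots> \<le> ((1 + \<delta>) * measure M K) * measure M A" by (rule mult_right_mono[OF Wm]) simp
    finally have "measure M K * measure M (uminus -` A) \<le> measure M K * ((1 + \<delta>) * measure M A)"
      by (simp add: mult_ac)
    then show ?thesis using m0 by simp
  qed
  ultimately show ?thesis using that by blast
qed

definition avg :: "'g set \<Rightarrow> 'g \<Rightarrow> complex" where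
  "avg A = (\<lambda>x. indicator A x / complex_of_real (measure M A))"

lemma measure_pos_imp_finite: "0 < measure M A \<Longrightarrow> emeasure M A < \<infinity>"
  by (metis infinity_ennreal_def less_irrefl less_top measure_eq_emeasure_eq_ennreal measure_zero_top)

lemma avg_props:
  assumes A: "A \<in> sets borel" "0 < measure M A"
  shows "integrable M (avg A)" "(\<integral>x. norm (avg A x) \<partial>M) = 1"
proof -
  note f = measure_pos_imp_finite[OF A(2)]
  show "integrable M (avg A)" unfolding avg_def using complex_integral_indicator(1)[OF A(1) f] by simp
  have "(\<integral>x. norm (avg A x) \<partial>M) = (\<integral>x. indicator A x / measure M A \<partial>M)"
    by (rule Bochner_Integration.integral_cong) (auto simp: avg_def indicator_def norm_divide)
  then show "(\<integral>x. norm (avg A x) \<partial>M) = 1" using A by simp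
qed

lemma L1_conv_avg: "L1_conv M a (avg A) x = L1_conv M a (indicator A) x / complex_of_real (measure M A)"
  by (simp add: L1_conv_def avg_def)

text \<open>Let \<open>c\<close> be the convolution of \<open>1\<^sub>K\<close> with the normalised indicator of \<open>A\<close>. For an open \<open>W \<supseteq> K\<close> and
  small \<open>A\<close> one has \<open>0 \<le> c \<le> (1 + \<delta>) 1\<^sub>W\<close>, by the bound on reflections. As \<open>1\<^sub>K\<close> lies below the same
  majorant and both have integral \<open>|K|\<close>, each is close to the majorant in \<open>L\<^sup>1\<close>.\<close>

lemma compact_indicator_approx:
  assumes K: "compact K" and e: "0 < e"
  obtains U where "open U" "0 \<in> U"
    "\<And>A. A \<in> sets borel \<Longrightarrow> A \<subseteq> U \<Longrightarrow> 0 < measure M A \<Longrightarrow>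
       (\<integral>x. norm (L1_conv M (indicator K) (avg A) x - indicator K x) \<partial>M) < e"
proof -
  have KB: "K \<in> sets borel" by (rule borel_compact[OF K])
  have Kf: "emeasure M K < \<infinity>" by (rule emeasure_compact_finite[OF K])
  define m where "m = measure M K"
  have m: "0 \<le> m" by (simp add: m_def)
  \<comment> \<open>Twice the gap between the integrals of \<open>(1 + \<delta>) 1\<^sub>W\<close> and \<open>1\<^sub>K\<close> is at most \<open>2 \<delta> (m + 2)\<close>.\<close>
  define \<delta> where "\<delta> = min 1 (e / (4 * (m + 2)))"
  have \<delta>: "0 < \<delta>" "\<delta> \<le> 1" "2 * ((1 + \<delta>) * (m + \<delta>) - m) < e"
  proof -
    show "0 < \<delta>" "\<delta> \<le> 1" unfolding \<delta>_def using e m by auto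
    have "\<delta> \<le> e / (4 * (m + 2))" unfolding \<delta>_def by simp
    then have "\<delta> * (4 * (m + 2)) \<le> e" using m by (simp add: pos_le_divide_eq)
    moreover have "(1 + \<delta>) * (m + \<delta>) - m = \<delta> * (1 + m + \<delta>)" by (simp add: algebra_simps)
    moreover have "\<delta> * (1 + m + \<delta>) \<le> \<delta> * (m + 2)"
      using \<open>0 < \<delta>\<close> \<open>\<delta> \<le> 1\<close> by (intro mult_left_mono) auto
    ultimately show "2 * ((1 + \<delta>) * (m + \<delta>) - m) < e" using e by (simp add: algebra_simps)
  qed
  have "emeasure M K < ennreal (m + \<delta>)"
    using Kf m \<delta>(1) by (subst emeasure_eq_ennreal_measure) (auto simp: less_top m_def intro!: ennreal_lessI add_nonneg_pos)
  then obtain W where W: "open W" "K \<subseteq> W" "emeasure M W < ennreal (m + \<delta>)"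
    using outer_regular[OF KB] by blast
  have Wf: "emeasure M W < \<infinity>" using W(3) by (rule order.strict_trans) simp
  have Wm: "measure M W \<le> m + \<delta>"
    using W(3) Wf m \<delta>(1) by (subst (asm) emeasure_eq_ennreal_measure) (auto simp: less_top ennreal_less_iff simp del: ennreal_plus)
  have WB: "W \<in> sets borel" using W(1) by simp
  obtain U1 where U1: "open U1" "0 \<in> U1" "\<And>k u. k \<in> K \<Longrightarrow> u \<in> U1 \<Longrightarrow> k + u \<in> W"
    using compact_add_neighbourhood[OF K W(1,2)] by blast
  obtain U2 where U2: "open U2" "0 \<in> U2"
    "\<And>A. A \<in> sets borel \<Longrightarrow> A \<subseteq> U2 \<Longrightarrow> measure M (uminus -` A) \<le> (1 + \<delta>) * measure M A"
    using measure_reflection_near_zero[OF \<delta>(1)] by blast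
  obtain U0 K0 where U0: "open U0" "(0::'g) \<in> U0" "U0 \<subseteq> K0" "compact K0"
    by (rule compact_neighbourhood_zero)
  define U where "U = U1 \<inter> U2 \<inter> uminus -` U0"
  have cm: "continuous_on UNIV (uminus :: 'g \<Rightarrow> 'g)" by (intro continuous_intros)
  have "open U" unfolding U_def using U0(1) U1(1) U2(1) by (intro open_Int open_vimage cm)
  moreover have "0 \<in> U" unfolding U_def using U0(2) U1(2) U2(2) by simp
  moreover have "(\<integral>x. norm (L1_conv M (indicator K) (avg A) x - indicator K x) \<partial>M) < e"
    if A: "A \<in> sets borel" "A \<subseteq> U" and p: "0 < measure M A" for A
  proof -
    note Af = measure_pos_imp_finite[OF p]
    note c = integral_indicator_conv[OF KB Kf A(1) Af]
    let ?c = "\<lambda>x. measure M (K \<inter> (\<lambda>y. - y + x) -` A) / measure M A"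
    have mA: "(\<lambda>y. - y + x) -` A \<in> sets borel" for x
    proof -
      have "(\<lambda>y. - y + x) \<in> borel_measurable borel"
        by (intro borel_measurable_continuous_onI continuous_intros)
      from measurable_sets[OF this A(1)] show ?thesis by simp
    qed
    have upper: "?c x \<le> (1 + \<delta>) * indicator W x" for x
    proof (cases "x \<in> W")
      case True
      have "emeasure M (uminus -` A) < \<infinity>"
        by (rule emeasure_subset_compact_finite[OF U0(4)]) (use A(2) U0(3) in \<open>auto simp: U_def\<close>)
      then have fin: "emeasure M ((\<lambda>y. - y + x) -` A) < \<infinity>"
      proof -
        have "uminus -` A \<in> sets borel" using measurable_sets[OF uminus_borel A(1)] by simp
        from emeasure_translate_image[OF this, of x]
        have "emeasure M ((+) (- x) -` uminus -` A) = emeasure M (uminus -` A)"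
          unfolding translate_image_eq_vimage .
        moreover have "(+) (- x) -` uminus -` A = (\<lambda>y. - y + x) -` A"
          by (simp add: vimage_def minus_add)
        ultimately show ?thesis using \<open>emeasure M (uminus -` A) < \<infinity>\<close> by simp
      qed
      have "measure M (K \<inter> (\<lambda>y. - y + x) -` A) \<le> measure M ((\<lambda>y. - y + x) -` A)"
        using fin mA KB by (intro measure_mono_fmeasurable) (auto simp: fmeasurable_def)
      also have "\<dots> \<le> (1 + \<delta>) * measure M A"
        unfolding measure_reflected_translate[OF A(1)] by (rule U2(3)) (use A in \<open>auto simp: U_def\<close>)
      finally show ?thesis using True p by (simp add: pos_divide_le_eq)
    next
      case False
      have "K \<inter> (\<lambda>y. - y + x) -` A = {}"
      proof (rule ccontr)
        assume "K \<inter> (\<lambda>y. - y + x) -` A \<noteq> {}"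
        then obtain y where y: "y \<in> K" "- y + x \<in> A" by auto
        then have "y + (- y + x) \<in> W" using A(2) by (intro U1(3)) (auto simp: U_def)
        then show False using False by (simp add: add.assoc[symmetric])
      qed
      then show ?thesis using False by simp
    qed
    \<comment> \<open>Both \<open>?c\<close> and the indicator of \<open>K\<close> lie below the majorant and have integral \<open>m\<close>.\<close>
    have KW: "indicator K x \<le> (1 + \<delta>) * (indicator W x :: real)" for x
      using W(2) \<delta>(1) by (auto simp: indicator_def)
    have ci: "integrable M ?c" "(\<integral>x. ?c x \<partial>M) = m" using c p by (auto simp: m_def)
    have wi: "integrable M (\<lambda>x. (1 + \<delta>) * indicator W x :: real)" using WB Wf by simp
    have ki: "integrable M (\<lambda>x. indicator K x :: real)" using KB Kf by simp
    have eq: "norm (L1_conv M (indicator K) (avg A) x - indicator K x) = \<bar>?c x - indicator K x\<bar>" for x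
    proof -
      have "L1_conv M (indicator K) (avg A) x - indicator K x = complex_of_real (?c x - indicator K x)"
        by (simp add: L1_conv_avg L1_conv_indicator KB A(1) indicator_def)
      then show ?thesis by (simp only: norm_of_real)
    qed
    have "(\<integral>x. norm (L1_conv M (indicator K) (avg A) x - indicator K x) \<partial>M) = (\<integral>x. \<bar>?c x - indicator K x\<bar> \<partial>M)"
      unfolding eq ..
    also have "\<dots> \<le> (\<integral>x. ((1 + \<delta>) * indicator W x - ?c x) + ((1 + \<delta>) * indicator W x - indicator K x) \<partial>M)"
    proof (rule Bochner_Integration.integral_mono)
      show "integrable M (\<lambda>x. \<bar>?c x - indicator K x\<bar>)" using ci(1) ki by simp
      show "integrable M (\<lambda>x. ((1 + \<delta>) * indicator W x - ?c x) + ((1 + \<delta>) * indicator W x - indicator K x))"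
        using ci(1) ki wi by simp
      fix x
      show "\<bar>?c x - indicator K x\<bar> \<le> ((1 + \<delta>) * indicator W x - ?c x) + ((1 + \<delta>) * indicator W x - indicator K x)"
        using upper[of x] KW[of x] by linarith
    qed
    also have "\<dots> = ((1 + \<delta>) * measure M W - m) + ((1 + \<delta>) * measure M W - m)"
    proof -
      have "(\<integral>x. (1 + \<delta>) * indicator W x \<partial>M) = (1 + \<delta>) * measure M W" using WB by simp
      moreover have "(\<integral>x. indicator K x \<partial>M) = m" using KB by (simp add: m_def)
      ultimately show ?thesis
        using ci wi ki by (simp only: Bochner_Integration.integral_add Bochner_Integration.integral_diff Bochner_Integration.integrable_diff)
    qed
    also have "\<dots> \<le> 2 * ((1 + \<delta>) * (m + \<delta>) - m)"
    proof -
      have "X - m + (X - m) \<le> 2 * (Y - m)" if "X \<le> Y" for X Y :: real using that by simp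
      then show ?thesis by this (rule mult_left_mono[OF Wm], use \<delta>(1) in simp)
    qed
    also have "\<dots> < e" by (rule \<delta>(3))
    finally show ?thesis .
  qed
  ultimately show ?thesis using that by blast
qed

lemma avg_convolution_bound:
  assumes k: "k \<in> Linf M" "\<And>x. norm (k x) \<le> C" and A: "A \<in> sets borel" "0 < measure M A"
    and a: "integrable M a"
  shows "norm (\<integral>x. k x * L1_conv M a (avg A) x \<partial>M) \<le> C * (\<integral>y. norm (a y) \<partial>M)"
proof -
  note av = avg_props[OF A]
  let ?h = "\<lambda>z. \<integral>y. a y * k (y + z) \<partial>M"
  let ?B = "C * (\<integral>y. norm (a y) \<partial>M)"
  have "(\<integral>x. k x * L1_conv M a (avg A) x \<partial>M) = (\<integral>z. ?h z * avg A z \<partial>M)"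
    by (rule L1_conv_pairing(2)[OF k a av(1)])
  also have "norm \<dots> \<le> (\<integral>z. norm (?h z * avg A z) \<partial>M)"
    by (rule Bochner_Integration.integral_norm_bound)
  also have "\<dots> \<le> (\<integral>z. ?B * norm (avg A z) \<partial>M)"
  proof (rule Bochner_Integration.integral_mono)
    show "integrable M (\<lambda>z. norm (?h z * avg A z))"
      by (rule integrable_norm[OF integrable_Linf_mult[OF Linf_act_formula_in_Linf[OF k a] av(1)]])
    show "integrable M (\<lambda>z. ?B * norm (avg A z))" using av(1) by simp
    show "norm (?h z * avg A z) \<le> ?B * norm (avg A z)" for z
      unfolding norm_mult by (rule mult_right_mono[OF Linf_act_formula_bounded[of k C a, OF k(2) a]]) simp
  qed
  also have "\<dots> = ?B" using av(2) by simp
  finally show ?thesis .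
qed

lemma L1_conv_avg_lincomb:
  assumes A: "A \<in> sets borel" and a: "integrable M a" and b: "integrable M b"
  shows "L1_conv M (\<lambda>y. a y + c * b y) (avg A) x = L1_conv M a (avg A) x + c * L1_conv M b (avg A) x"
proof -
  have i: "integrable M (\<lambda>y. f y * avg A (- y + x))" if f: "integrable M f" for f
  proof -
    have "integrable M (\<lambda>y. f y / complex_of_real (measure M A))" using f by simp
    then show ?thesis
    proof (rule Bochner_Integration.integrable_bound)
      have m: "(\<lambda>y. - y + x) \<in> borel_measurable borel"
        by (intro borel_measurable_continuous_onI continuous_intros)
      have [measurable]: "avg A \<in> borel_measurable borel" unfolding avg_def using A by measurable
      have "(\<lambda>y. avg A (- y + x)) \<in> borel_measurable borel" by (rule measurable_compose[OF m]) measurable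
      then show "(\<lambda>y. f y * avg A (- y + x)) \<in> borel_measurable M"
        using borel_measurable_integrable[OF f] by simp
      show "AE y in M. norm (f y * avg A (- y + x)) \<le> norm (f y / complex_of_real (measure M A))"
        by (auto simp: avg_def indicator_def)
    qed
  qed
  show ?thesis unfolding L1_conv_def using i[OF a] i[OF b]
    by (simp add: distrib_right mult.assoc)
qed

text \<open>The error \<open>D A a\<close> is linear in \<open>a\<close> and bounded by a multiple of the \<open>L\<^sup>1\<close> norm uniformly in \<open>A\<close>, so
  its smallness passes from indicators of compact sets to the closure of their linear span.\<close>

lemma L1_right_approximate_identity:
  assumes k: "k \<in> Linf M" "\<And>x. norm (k x) \<le> C" and a: "integrable M a" and e: "0 < e"
  shows "\<exists>U. open U \<and> 0 \<in> U \<and> (\<forall>A\<in>sets borel. A \<subseteq> U \<and> 0 < measure M A \<longrightarrow>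
    norm ((\<integral>x. k x * L1_conv M a (avg A) x \<partial>M) - (\<integral>x. k x * a x \<partial>M)) < e)"
proof -
  define D where "D A a = (\<integral>x. k x * L1_conv M a (avg A) x \<partial>M) - (\<integral>x. k x * a x \<partial>M)" for A a
  have C: "0 \<le> C" using k(2)[of 0] norm_ge_zero order_trans by blast
  have D_lin: "D A (\<lambda>x. a x + c * b x) = D A a + c * D A b"
    if A: "A \<in> sets borel" "0 < measure M A" and a: "integrable M a" and b: "integrable M b" for A a b c
  proof -
    note ia = L1_conv_pairing(1)[OF k a avg_props(1)[OF A]] and ib = L1_conv_pairing(1)[OF k b avg_props(1)[OF A]]
    note ja = integrable_Linf_mult[OF k(1) a] and jb = integrable_Linf_mult[OF k(1) b]
    have "(\<integral>x. k x * L1_conv M (\<lambda>x. a x + c * b x) (avg A) x \<partial>M)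
        = (\<integral>x. k x * L1_conv M a (avg A) x + c * (k x * L1_conv M b (avg A) x) \<partial>M)"
      unfolding L1_conv_avg_lincomb[OF A(1) a b] by (simp add: algebra_simps)
    also have "\<dots> = (\<integral>x. k x * L1_conv M a (avg A) x \<partial>M) + c * (\<integral>x. k x * L1_conv M b (avg A) x \<partial>M)"
      using ia ib by simp
    finally have 1: "(\<integral>x. k x * L1_conv M (\<lambda>x. a x + c * b x) (avg A) x \<partial>M) = \<dots>" .
    have "(\<integral>x. k x * (a x + c * b x) \<partial>M) = (\<integral>x. k x * a x + c * (k x * b x) \<partial>M)"
      by (simp add: algebra_simps)
    also have "\<dots> = (\<integral>x. k x * a x \<partial>M) + c * (\<integral>x. k x * b x \<partial>M)" using ja jb by simp
    finally show ?thesis unfolding D_def 1 by (simp add: algebra_simps)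
  qed
  have D_bound: "norm (D A a) \<le> 2 * C * (\<integral>y. norm (a y) \<partial>M)"
    if A: "A \<in> sets borel" "0 < measure M A" and a: "integrable M a" for A a
  proof -
    have "norm (\<integral>x. k x * a x \<partial>M) \<le> (\<integral>x. norm (k x * a x) \<partial>M)"
      by (rule Bochner_Integration.integral_norm_bound)
    also have "\<dots> \<le> (\<integral>x. C * norm (a x) \<partial>M)"
      by (rule Bochner_Integration.integral_mono)
        (use integrable_norm[OF integrable_Linf_mult[OF k(1) a]] a k(2) in \<open>auto simp: norm_mult intro!: mult_right_mono\<close>)
    finally have "norm (\<integral>x. k x * a x \<partial>M) \<le> C * (\<integral>x. norm (a x) \<partial>M)" by simp
    moreover have "norm (D A a) \<le> norm (\<integral>x. k x * L1_conv M a (avg A) x \<partial>M) + norm (\<integral>x. k x * a x \<partial>M)"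
      unfolding D_def by (rule norm_triangle_ineq4)
    ultimately show ?thesis using avg_convolution_bound[OF k A a] by simp
  qed
  \<comment> \<open>The functions \<open>a\<close> for which the error tends to 0.\<close>
  define ok where "ok a \<longleftrightarrow> integrable M a \<and> (\<forall>e>0. \<exists>U. open U \<and> 0 \<in> U \<and>
     (\<forall>A\<in>sets borel. A \<subseteq> U \<and> 0 < measure M A \<longrightarrow> norm (D A a) < e))" for a
  have ok_lin: "ok (\<lambda>x. a x + c * b x)" if a: "ok a" and b: "ok b" for a b c
    unfolding ok_def
  proof (intro conjI allI impI)
    show "integrable M (\<lambda>x. a x + c * b x)" using a b by (simp add: ok_def)
    fix e :: real assume e: "0 < e"
    define e' where "e' = e / (2 * (norm c + 1))"
    have e': "0 < e'" using e by (simp add: e'_def add_nonneg_pos)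
    have "0 < e / 2" using e by simp
    then obtain U where U: "open U" "0 \<in> U" "\<And>A. A \<in> sets borel \<Longrightarrow> A \<subseteq> U \<Longrightarrow> 0 < measure M A \<Longrightarrow> norm (D A a) < e / 2"
      using a unfolding ok_def by meson
    obtain V where V: "open V" "0 \<in> V" "\<And>A. A \<in> sets borel \<Longrightarrow> A \<subseteq> V \<Longrightarrow> 0 < measure M A \<Longrightarrow> norm (D A b) < e'"
      using b e' unfolding ok_def by meson
    show "\<exists>U. open U \<and> 0 \<in> U \<and> (\<forall>A\<in>sets borel. A \<subseteq> U \<and> 0 < measure M A \<longrightarrow> norm (D A (\<lambda>x. a x + c * b x)) < e)"
    proof (intro exI[of _ "U \<inter> V"] conjI ballI impI)
      fix A assume A: "A \<in> sets borel" "A \<subseteq> U \<inter> V \<and> 0 < measure M A"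
      have "D A (\<lambda>x. a x + c * b x) = D A a + c * D A b"
        by (rule D_lin) (use A a b in \<open>auto simp: ok_def\<close>)
      then have "norm (D A (\<lambda>x. a x + c * b x)) \<le> norm (D A a) + norm c * norm (D A b)"
        by (metis norm_mult norm_triangle_ineq)
      also have "\<dots> < e / 2 + norm c * e' + e'"
      proof -
        have "norm (D A a) < e / 2" using A by (intro U(3)) auto
        moreover have "norm c * norm (D A b) \<le> norm c * e'"
          using V(3)[of A] A by (intro mult_left_mono) auto
        ultimately show ?thesis using e' by linarith
      qed
      also have "\<dots> = e"
      proof -
        have "(norm c + 1) * e' = e / 2" unfolding e'_def using norm_ge_zero[of c] by (simp add: field_simps add_nonneg_eq_0_iff)
        then show ?thesis by (simp add: algebra_simps)
      qed
      finally show "norm (D A (\<lambda>x. a x + c * b x)) < e" .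
    qed (use U V in auto)
  qed
  have ok_closed: "ok a" if a: "integrable M a"
    and ap: "\<And>\<eta>. 0 < \<eta> \<Longrightarrow> \<exists>b. ok b \<and> (\<integral>x. norm (a x - b x) \<partial>M) < \<eta>" for a
    unfolding ok_def
  proof (intro conjI allI impI a)
    fix e :: real assume e: "0 < e"
    define \<eta> where "\<eta> = e / (2 * (2 * C + 1))"
    have \<eta>: "0 < \<eta>" using e C by (simp add: \<eta>_def)
    from ap[OF this] obtain b where b: "ok b" "(\<integral>x. norm (a x - b x) \<partial>M) < \<eta>" by blast
    have bi: "integrable M b" using b(1) by (simp add: ok_def)
    have "0 < e / 2" using e by simp
    then obtain U where U: "open U" "0 \<in> U" "\<And>A. A \<in> sets borel \<Longrightarrow> A \<subseteq> U \<Longrightarrow> 0 < measure M A \<Longrightarrow> norm (D A b) < e / 2"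
      using b(1) unfolding ok_def by meson
    show "\<exists>U. open U \<and> 0 \<in> U \<and> (\<forall>A\<in>sets borel. A \<subseteq> U \<and> 0 < measure M A \<longrightarrow> norm (D A a) < e)"
    proof (intro exI[of _ U] conjI ballI impI U)
      fix A assume A: "A \<in> sets borel" "A \<subseteq> U \<and> 0 < measure M A"
      have "D A (\<lambda>x. b x + 1 * (a x - b x)) = D A b + 1 * D A (\<lambda>x. a x - b x)"
        by (rule D_lin) (use A a bi in auto)
      then have "norm (D A a) \<le> norm (D A b) + norm (D A (\<lambda>x. a x - b x))"
        using norm_triangle_ineq by simp
      also have "\<dots> < e / 2 + e / 2"
      proof (rule add_less_le_mono)
        show "norm (D A b) < e / 2" using A by (intro U(3)) auto
        have "norm (D A (\<lambda>x. a x - b x)) \<le> 2 * C * (\<integral>x. norm (a x - b x) \<partial>M)"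
          by (rule D_bound) (use A a bi in auto)
        also have "\<dots> \<le> 2 * C * \<eta>" using b(2) C by (intro mult_left_mono) auto
        also have "\<dots> \<le> (2 * C + 1) * \<eta>" using \<eta> by (simp add: algebra_simps)
        also have "\<dots> = e / 2" unfolding \<eta>_def using C by (simp add: field_simps)
        finally show "norm (D A (\<lambda>x. a x - b x)) \<le> e / 2" .
      qed
      finally show "norm (D A a) < e" by simp
    qed
  qed
  have ok_compact: "ok (indicator K)" if K: "compact K" for K
    unfolding ok_def
  proof (intro conjI allI impI)
    note ki = complex_integral_indicator(1)[OF borel_compact[OF K] emeasure_compact_finite[OF K]]
    show "integrable M (indicator K :: 'g \<Rightarrow> complex)" by (rule ki)
    fix e :: real assume e: "0 < e"
    define \<eta> where "\<eta> = e / (C + 1)"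
    have \<eta>: "0 < \<eta>" using e C by (simp add: \<eta>_def)
    obtain U where U: "open U" "0 \<in> U" "\<And>A. A \<in> sets borel \<Longrightarrow> A \<subseteq> U \<Longrightarrow> 0 < measure M A \<Longrightarrow>
       (\<integral>x. norm (L1_conv M (indicator K) (avg A) x - indicator K x) \<partial>M) < \<eta>"
      using compact_indicator_approx[OF K \<eta>] by blast
    show "\<exists>U. open U \<and> 0 \<in> U \<and> (\<forall>A\<in>sets borel. A \<subseteq> U \<and> 0 < measure M A \<longrightarrow> norm (D A (indicator K)) < e)"
    proof (intro exI[of _ U] conjI ballI impI U)
      fix A assume A: "A \<in> sets borel" "A \<subseteq> U \<and> 0 < measure M A"
      let ?d = "\<lambda>x. L1_conv M (indicator K) (avg A) x - indicator K x"
      have ci: "integrable M (L1_conv M (indicator K) (avg A))"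
        by (rule integrable_L1_conv[OF ki avg_props(1)]) (use A in auto)
      have di: "integrable M ?d" using ci ki by simp
      have "D A (indicator K) = (\<integral>x. k x * ?d x \<partial>M)"
        unfolding D_def right_diff_distrib
        by (rule Bochner_Integration.integral_diff[symmetric]) (use integrable_Linf_mult[OF k(1)] ci ki in auto)
      also have "norm \<dots> \<le> (\<integral>x. norm (k x * ?d x) \<partial>M)"
        by (rule Bochner_Integration.integral_norm_bound)
      also have "\<dots> \<le> (\<integral>x. C * norm (?d x) \<partial>M)"
      proof (rule Bochner_Integration.integral_mono)
        show "integrable M (\<lambda>x. norm (k x * ?d x))" by (rule integrable_norm[OF integrable_Linf_mult[OF k(1) di]])
        show "integrable M (\<lambda>x. C * norm (?d x))" using di by simp
        show "norm (k x * ?d x) \<le> C * norm (?d x)" for x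
          unfolding norm_mult by (rule mult_right_mono[OF k(2)]) simp
      qed
      also have "\<dots> = C * (\<integral>x. norm (?d x) \<partial>M)" by simp
      also have "\<dots> \<le> C * \<eta>"
        using U(3)[of A] A C by (intro mult_left_mono) auto
      also have "\<dots> < e" unfolding \<eta>_def using C e by (simp add: field_simps)
      finally show "norm (D A (indicator K)) < e" .
    qed
  qed
  have ok_indicator: "ok (indicator B)" if B: "B \<in> sets borel" "emeasure M B < \<infinity>" for B
  proof (rule ok_closed)
    show "integrable M (indicator B :: 'g \<Rightarrow> complex)" by (rule complex_integral_indicator(1)[OF B])
    fix \<eta> :: real assume \<eta>: "0 < \<eta>"
    have "emeasure M B < emeasure M B + ennreal (\<eta> / 4)"
      using B(2) \<eta> by (simp add: ennreal_add_left_cancel_less less_top)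
    from outer_regular[OF B(1) this] obtain W where W: "open W" "B \<subseteq> W" "emeasure M W < emeasure M B + ennreal (\<eta> / 4)"
      by blast
    have Wf: "emeasure M W < \<infinity>"
      using W(3) B(2) by (metis ennreal_add_eq_top ennreal_neq_top infinity_ennreal_def less_top order.strict_trans top.not_eq_extremum)
    have WB: "W \<in> sets borel" using W by simp
    have mW: "measure M W \<le> measure M B + \<eta> / 4"
    proof -
      have "ennreal (measure M W) < ennreal (measure M B) + ennreal (\<eta> / 4)"
        using W(3) Wf B(2) by (simp add: emeasure_eq_ennreal_measure less_top)
      also have "\<dots> = ennreal (measure M B + \<eta> / 4)" using \<eta> by (subst ennreal_plus) auto
      finally show ?thesis using \<eta> by (simp add: ennreal_less_iff del: ennreal_plus)
    qed
    obtain K where K: "compact K" "K \<subseteq> W" "measure M W - \<eta> / 4 \<le> measure M K"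
    proof (cases "emeasure M W = 0")
      case True
      then show ?thesis using that[of "{}"] \<eta> by (simp add: measure_def)
    next
      case False
      then have mp: "0 < measure M W" using Wf by (simp add: measure_def enn2real_positive_iff zero_less_iff_neq_zero)
      then have "ennreal (measure M W - \<eta> / 4) < emeasure M W"
        using Wf \<eta> by (subst emeasure_eq_ennreal_measure) (auto simp: less_top intro!: ennreal_lessI)
      from inner_regular_open[OF W(1) this] obtain K where K: "compact K" "K \<subseteq> W" "ennreal (measure M W - \<eta> / 4) < emeasure M K"
        by blast
      have "emeasure M K = ennreal (measure M K)"
        using emeasure_compact_finite[OF K(1)] by (intro emeasure_eq_ennreal_measure) (auto simp: less_top)
      then have "measure M W - \<eta> / 4 \<le> measure M K" using K(3) by (metis ennreal_leI ennreal_le_iff2 leD linorder_linear measure_nonneg order_trans)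
      with K(1,2) that show ?thesis by blast
    qed
    have KB: "K \<in> sets borel" and Kf: "emeasure M K < \<infinity>"
      using borel_compact[OF K(1)] emeasure_compact_finite[OF K(1)] by auto
    have "(\<integral>x. norm (indicator B x - indicator K x :: complex) \<partial>M)
        \<le> (\<integral>x. (indicator W x - indicator B x) + (indicator W x - indicator K x) \<partial>M)"
    proof (rule Bochner_Integration.integral_mono)
      show "integrable M (\<lambda>x. norm (indicator B x - indicator K x :: complex))"
        using complex_integral_indicator(1)[OF B] complex_integral_indicator(1)[OF KB Kf] by simp
      show "integrable M (\<lambda>x. (indicator W x - indicator B x) + (indicator W x - indicator K x) :: real)"
        using B KB Kf WB Wf by simp
      show "norm (indicator B x - indicator K x :: complex) \<le> (indicator W x - indicator B x) + (indicator W x - indicator K x)" for x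
        using W(2) K(2) by (auto simp: indicator_def)
    qed
    also have "\<dots> = (measure M W - measure M B) + (measure M W - measure M K)"
    proof -
      have i: "integrable M (indicator P :: 'g \<Rightarrow> real)" "(\<integral>x. indicator P x \<partial>M) = measure M P"
        if "P \<in> sets borel" "emeasure M P < \<infinity>" for P using that by auto
      show ?thesis
        by (simp only: Bochner_Integration.integral_add Bochner_Integration.integral_diff Bochner_Integration.integrable_diff
            i[OF B] i[OF WB Wf] i[OF KB Kf])
    qed
    also have "\<dots> < \<eta>" using mW K(3) \<eta> by linarith
    finally have "(\<integral>x. norm (indicator B x - indicator K x :: complex) \<partial>M) < \<eta>" .
    with ok_compact[OF K(1)] show "\<exists>b. ok b \<and> (\<integral>x. norm (indicator B x - b x) \<partial>M) < \<eta>"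
      by (intro exI[of _ "indicator K"] conjI)
  qed
  have "ok a" using a
  proof (induct rule: integrable_induct)
    case (base A c)
    have "(indicator {} :: 'g \<Rightarrow> complex) = (\<lambda>x. 0)" by auto
    then have "ok (\<lambda>x. 0)" using ok_compact[of "{}"] by simp
    then have "ok (\<lambda>x. 0 + c * indicator A x)"
      by (rule ok_lin) (use base in \<open>auto intro!: ok_indicator\<close>)
    moreover have "(\<lambda>x. 0 + c * indicator A x) = (\<lambda>x. indicator A x *\<^sub>R c)"
      by (auto simp: indicator_def)
    ultimately show ?case by simp
  next
    case (add f g)
    then show ?case using ok_lin[of f g 1] by simp
  next
    case (lim f s)
    show ?case
    proof (rule ok_closed[OF lim(5)])
      fix \<eta> :: real assume \<eta>: "0 < \<eta>"
      have "(\<lambda>i. \<integral>x. norm (f x - s i x) \<partial>M) \<longlonglongrightarrow> (\<integral>x. 0 \<partial>M)"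
      proof (rule integral_dominated_convergence)
        show "integrable M (\<lambda>x. 3 * norm (f x))" using lim(5) by simp
        show "(\<lambda>x. norm (f x - s i x)) \<in> borel_measurable M" for i
          using borel_measurable_integrable[OF lim(5)] borel_measurable_integrable[OF lim(1)[of i]] by simp
        have "(\<lambda>i. norm (f x - s i x)) \<longlonglongrightarrow> 0" for x
          using tendsto_norm[OF tendsto_diff[OF tendsto_const lim(3)[of x]], of "f x"] by simp
        then show "AE x in M. (\<lambda>i. norm (f x - s i x)) \<longlonglongrightarrow> 0" by simp
        show "AE x in M. norm (norm (f x - s i x)) \<le> 3 * norm (f x)" for i
        proof (rule AE_I2)
          fix x assume "x \<in> space M"
          have "norm (f x - s i x) \<le> norm (f x) + norm (s i x)" by (rule norm_triangle_ineq4)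
          with lim(4)[OF \<open>x \<in> space M\<close>, of i] show "norm (norm (f x - s i x)) \<le> 3 * norm (f x)" by simp
        qed
      qed simp
      then have "\<forall>\<^sub>F i in sequentially. (\<integral>x. norm (f x - s i x) \<partial>M) < \<eta>"
        using \<eta> by (intro order_tendstoD) auto
      then obtain i where "(\<integral>x. norm (f x - s i x) \<partial>M) < \<eta>" by (auto simp: eventually_sequentially)
      with lim(2)[of i] show "\<exists>b. ok b \<and> (\<integral>x. norm (f x - b x) \<partial>M) < \<eta>" by blast
    qed
  qed
  then show ?thesis using e unfolding ok_def D_def by blast
qed


section \<open>Right identities as cluster points of averages\<close>

text \<open>The averages are norm-bounded, hence lie in a product of discs indexed by the functions \<open>f\<close>. This
  product is compact by Tychonoff's theorem, and the filter of sets \<open>A \<subseteq> W\<close> shrinking to 0 has a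
  cluster point \<open>E\<close> there. Every closed condition that eventually holds for the averages holds for
  \<open>E\<close>; all the listed properties are obtained in this way.\<close>

lemma cluster_point_of_averages:
  assumes W: "W \<in> sets borel" and W_pos: "\<And>U. open U \<Longrightarrow> 0 \<in> U \<Longrightarrow> 0 < emeasure M (U \<inter> W)"
    and K: "compact K" "open U0" "0 \<in> U0" "U0 \<subseteq> K"
  obtains E where "E \<in> Linf_dual M"
    "\<forall>l\<in>Linf M. \<forall>a. integrable M a \<longrightarrow> E (Linf_act_L1 M l a) = (\<integral>x. l x * a x \<partial>M)"
    "\<forall>f\<in>Linf M. E f = E (\<lambda>x. indicator K x * f x)"
    "\<forall>f\<in>Linf M. E f = E (\<lambda>x. indicator W x * f x)"
    "E (\<lambda>x. 1) = 1"
proof -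
  define \<A> where "\<A> U = {A \<in> sets borel. A \<subseteq> U \<inter> W \<and> 0 < measure M A}" for U
  define \<U> where "\<U> = {U :: 'g set. open U \<and> 0 \<in> U}"
  define Fi where "Fi = (INF U\<in>\<U>. principal (\<A> U))"
  define \<phi> where "\<phi> A f = (if f \<in> Linf M then \<integral>x. f x * avg A x \<partial>M else 0)" for A f
  have KB: "K \<in> sets borel" by (rule borel_compact[OF K(1)])
  have \<A>_ne: "\<A> U \<noteq> {}" if "U \<in> \<U>" for U
  proof -
    have op: "open (U \<inter> U0)" "0 \<in> U \<inter> U0" using that K unfolding \<U>_def by auto
    have "emeasure M (U \<inter> U0 \<inter> W) < \<infinity>" by (rule emeasure_subset_compact_finite[OF K(1)]) (use K in auto)
    moreover have "0 < emeasure M (U \<inter> U0 \<inter> W)" by (rule W_pos[OF op])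
    ultimately have "0 < measure M (U \<inter> U0 \<inter> W)" by (simp add: measure_def enn2real_positive_iff)
    moreover have "U \<inter> U0 \<inter> W \<in> sets borel" by (rule sets.Int[OF borel_open[OF op(1)] W])
    ultimately have "U \<inter> U0 \<inter> W \<in> \<A> U" unfolding \<A>_def by auto
    then show ?thesis by blast
  qed
  have ev: "eventually P Fi \<longleftrightarrow> (\<exists>U\<in>\<U>. \<forall>A\<in>\<A> U. P A)" for P
    unfolding Fi_def
  proof (subst eventually_INF_base)
    have "UNIV \<in> \<U>" unfolding \<U>_def by simp
    then show "\<U> \<noteq> {}" by blast
    show "\<exists>x\<in>\<U>. principal (\<A> x) \<le> inf (principal (\<A> a)) (principal (\<A> b))" if "a \<in> \<U>" "b \<in> \<U>" for a b
      by (rule bexI[of _ "a \<inter> b"]) (use that in \<open>auto simp: \<U>_def \<A>_def\<close>)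
  qed (simp add: eventually_principal)
  have Fi_ne: "Fi \<noteq> bot"
    unfolding trivial_limit_def ev using \<A>_ne by blast
  have ev_all: "eventually P Fi" if "\<And>A. A \<in> sets borel \<Longrightarrow> A \<subseteq> U0 \<Longrightarrow> A \<subseteq> W \<Longrightarrow> 0 < measure M A \<Longrightarrow> P A" for P
    unfolding ev by (rule bexI[of _ U0]) (use that K in \<open>auto simp: \<A>_def \<U>_def\<close>)
  define R where "R f = cball (0::complex) (if f \<in> Linf M then Linf_norm M f else 0)" for f
  define Bx where "Bx = PiE UNIV R"
  have "compactin (product_topology (\<lambda>_. euclidean) UNIV) Bx"
    unfolding Bx_def compactin_PiE by (auto simp: R_def)
  then have "compact Bx" unfolding euclidean_product_topology by simp
  have \<phi>Bx: "\<phi> A \<in> Bx" if A: "A \<in> sets borel" "0 < measure M A" for A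
  proof -
    note av = avg_props[OF A]
    have "norm (\<integral>x. f x * avg A x \<partial>M) \<le> Linf_norm M f" if f: "f \<in> Linf M" for f
    proof -
      have "norm (\<integral>x. f x * avg A x \<partial>M) \<le> (\<integral>x. norm (f x * avg A x) \<partial>M)"
        by (rule Bochner_Integration.integral_norm_bound)
      also have "\<dots> \<le> (\<integral>x. Linf_norm M f * norm (avg A x) \<partial>M)"
      proof (rule integral_mono_AE)
        show "integrable M (\<lambda>x. norm (f x * avg A x))" by (rule integrable_norm[OF integrable_Linf_mult[OF f av(1)]])
        show "integrable M (\<lambda>x. Linf_norm M f * norm (avg A x))" using av(1) by simp
        have "AE x in M. x \<in> A \<longrightarrow> norm (f x) \<le> Linf_norm M f"
          using Linf_norm_bound[OF f] A measure_pos_imp_finite[OF A(2)] unfolding loc_AE_def by simp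
        then show "AE x in M. norm (f x * avg A x) \<le> Linf_norm M f * norm (avg A x)"
        proof eventually_elim
          case (elim x)
          then show ?case unfolding norm_mult by (cases "x \<in> A") (auto simp: avg_def intro!: mult_right_mono)
        qed
      qed
      also have "\<dots> = Linf_norm M f" using av(2) by simp
      finally show ?thesis .
    qed
    then show ?thesis unfolding Bx_def R_def \<phi>_def by auto
  qed
  have "filtermap \<phi> Fi \<noteq> bot" using Fi_ne by (simp add: filtermap_bot_iff)
  moreover have "eventually (\<lambda>x. x \<in> Bx) (filtermap \<phi> Fi)"
    unfolding eventually_filtermap by (rule ev_all) (rule \<phi>Bx)
  ultimately obtain E where E: "E \<in> Bx" "inf (nhds E) (filtermap \<phi> Fi) \<noteq> bot"
    using \<open>compact Bx\<close> unfolding compact_filter by blast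
  \<comment> \<open>Weak-star closed conditions pass to the cluster point.\<close>
  have closedI: "E \<in> Z" if Z: "closed Z" "eventually (\<lambda>A. \<phi> A \<in> Z) Fi" for Z
  proof (rule ccontr)
    assume "E \<notin> Z"
    then have "eventually (\<lambda>x. x \<in> - Z) (nhds E)"
      using Z(1) by (intro eventually_nhds_in_open) auto
    then have 1: "eventually (\<lambda>x. x \<in> - Z) (inf (nhds E) (filtermap \<phi> Fi))" by (rule filter_leD[OF inf_le1])
    have "eventually (\<lambda>x. x \<in> Z) (filtermap \<phi> Fi)" using Z(2) by (simp add: eventually_filtermap)
    then have "eventually (\<lambda>x. x \<in> Z) (inf (nhds E) (filtermap \<phi> Fi))" by (rule filter_leD[OF inf_le2])
    with 1 have "eventually (\<lambda>x. False) (inf (nhds E) (filtermap \<phi> Fi))" by eventually_elim auto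
    then show False using E(2) by (simp add: trivial_limit_def)
  qed
  have coord: "continuous_on UNIV (\<lambda>E :: ('g \<Rightarrow> complex) \<Rightarrow> complex. E f)" for f by simp
  have E_Linf: "E \<in> Linf_dual M"
    unfolding Linf_dual_def
  proof (intro CollectI conjI allI impI ballI)
    have Ef: "E f \<in> R f" for f using E(1) unfolding Bx_def by auto
    show "E f = 0" if "f \<notin> Linf M" for f using Ef[of f] that by (simp add: R_def)
    show "\<exists>B. \<forall>f\<in>Linf M. norm (E f) \<le> B * Linf_norm M f"
    proof (intro exI[of _ 1] ballI)
      show "norm (E f) \<le> 1 * Linf_norm M f" if "f \<in> Linf M" for f
        using Ef[of f] that by (simp add: R_def)
    qed
    show "E (\<lambda>x. f x + g x) = E f + E g" if f: "f \<in> Linf M" and g: "g \<in> Linf M" for f g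
    proof -
      have "E \<in> {E. E (\<lambda>x. f x + g x) = E f + E g}"
      proof (rule closedI)
        show "closed {E :: ('g \<Rightarrow> complex) \<Rightarrow> complex. E (\<lambda>x. f x + g x) = E f + E g}"
          by (intro closed_Collect_eq continuous_on_add coord)
        show "eventually (\<lambda>A. \<phi> A \<in> {E. E (\<lambda>x. f x + g x) = E f + E g}) Fi"
        proof (rule ev_all)
          fix A assume A: "A \<in> sets borel" "0 < measure M A"
          note av = avg_props(1)[OF A]
          show "\<phi> A \<in> {E. E (\<lambda>x. f x + g x) = E f + E g}"
            using f g Linf_add[OF f g] integrable_Linf_mult[OF f av] integrable_Linf_mult[OF g av]
            by (simp add: \<phi>_def distrib_right)
        qed
      qed
      then show ?thesis by simp
    qed
    show "E (\<lambda>x. c * f x) = c * E f" if f: "f \<in> Linf M" for c f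
    proof -
      have "E \<in> {E. E (\<lambda>x. c * f x) = c * E f}"
      proof (rule closedI)
        show "closed {E :: ('g \<Rightarrow> complex) \<Rightarrow> complex. E (\<lambda>x. c * f x) = c * E f}"
          by (intro closed_Collect_eq continuous_on_mult continuous_on_const coord)
        show "eventually (\<lambda>A. \<phi> A \<in> {E. E (\<lambda>x. c * f x) = c * E f}) Fi"
          by (rule ev_all) (use f Linf_scale[OF f] in \<open>simp add: \<phi>_def mult.assoc\<close>)
      qed
      then show ?thesis by simp
    qed
  qed
  have E_loc: "E f = E (\<lambda>x. indicator B x * f x)" if f: "f \<in> Linf M" and B: "B \<in> sets borel" "U0 \<inter> W \<subseteq> B" for f B
  proof -
    have "E \<in> {E. E f = E (\<lambda>x. indicator B x * f x)}"
    proof (rule closedI)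
      show "closed {E :: ('g \<Rightarrow> complex) \<Rightarrow> complex. E f = E (\<lambda>x. indicator B x * f x)}"
        by (intro closed_Collect_eq coord)
      show "eventually (\<lambda>A. \<phi> A \<in> {E. E f = E (\<lambda>x. indicator B x * f x)}) Fi"
      proof (rule ev_all)
        fix A assume A: "A \<subseteq> U0" "A \<subseteq> W"
        have "(\<lambda>x. f x * avg A x) = (\<lambda>x. indicator B x * f x * avg A x)"
          using A B(2) by (auto simp: avg_def indicator_def fun_eq_iff)
        then show "\<phi> A \<in> {E. E f = E (\<lambda>x. indicator B x * f x)}"
          using f Linf_indicator_mult[OF f B(1)] by (simp add: \<phi>_def)
      qed
    qed
    then show ?thesis by simp
  qed
  have E_act: "E (Linf_act_L1 M l a) = (\<integral>x. l x * a x \<partial>M)" if l: "l \<in> Linf M" and a: "integrable M a" for l a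
  proof -
    let ?c = "\<integral>x. l x * a x \<partial>M" and ?h = "Linf_act_L1 M l a"
    note h = Linf_act_L1_props[OF l a]
    obtain k C where k: "k \<in> Linf M" "\<And>x. norm (k x) \<le> C" "loc_AE M (\<lambda>x. l x = k x)"
      using Linf_truncate[OF l] by blast
    have "norm (E ?h - ?c) \<le> e" if e: "0 < e" for e
    proof -
      have "E \<in> {E. norm (E ?h - ?c) \<le> e}"
      proof (rule closedI)
        show "closed {E :: ('g \<Rightarrow> complex) \<Rightarrow> complex. norm (E ?h - ?c) \<le> e}"
          by (intro closed_Collect_le continuous_on_norm continuous_on_diff continuous_on_const coord)
        obtain U where U: "open U" "0 \<in> U" "\<forall>A\<in>sets borel. A \<subseteq> U \<and> 0 < measure M A \<longrightarrow>
            norm ((\<integral>x. k x * L1_conv M a (avg A) x \<partial>M) - (\<integral>x. k x * a x \<partial>M)) < e"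
          using L1_right_approximate_identity[OF k(1,2) a e] by blast
        show "eventually (\<lambda>A. \<phi> A \<in> {E. norm (E ?h - ?c) \<le> e}) Fi"
          unfolding ev
        proof (rule bexI[of _ U], rule ballI)
          fix A assume "A \<in> \<A> U"
          then have A: "A \<in> sets borel" "0 < measure M A" "A \<subseteq> U" unfolding \<A>_def by auto
          note av = avg_props(1)[OF A(1,2)]
          have "\<phi> A ?h = (\<integral>x. ?h x * avg A x \<partial>M)" using h(1) by (simp add: \<phi>_def)
          also have "\<dots> = (\<integral>x. l x * L1_conv M a (avg A) x \<partial>M)" by (rule h(2)[OF av])
          also have "\<dots> = (\<integral>x. k x * L1_conv M a (avg A) x \<partial>M)"
            by (rule integral_mult_Linf_cong[OF l k(1,3) integrable_L1_conv[OF a av]])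
          finally have 1: "\<phi> A ?h = \<dots>" .
          have 2: "?c = (\<integral>x. k x * a x \<partial>M)" by (rule integral_mult_Linf_cong[OF l k(1,3) a])
          show "\<phi> A \<in> {E. norm (E ?h - ?c) \<le> e}"
            unfolding mem_Collect_eq 1 2 using U(3) A by (intro less_imp_le) blast
        next
          show "U \<in> \<U>" using U by (simp add: \<U>_def)
        qed
      qed
      then show ?thesis by simp
    qed
    then have "norm (E ?h - ?c) \<le> 0" by (rule field_le_epsilon[where y=0, simplified])
    then show ?thesis by simp
  qed
  have E_one: "E (\<lambda>x. 1) = 1"
  proof -
    have "E \<in> {E. E (\<lambda>x. 1) = 1}"
    proof (rule closedI)
      show "closed {E :: ('g \<Rightarrow> complex) \<Rightarrow> complex. E (\<lambda>x. 1) = 1}"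
        by (intro closed_Collect_eq continuous_on_const coord)
      show "eventually (\<lambda>A. \<phi> A \<in> {E. E (\<lambda>x. 1) = 1}) Fi"
      proof (rule ev_all)
        fix A assume A: "A \<in> sets borel" "0 < measure M A"
        show "\<phi> A \<in> {E. E (\<lambda>x. 1) = 1}"
          using complex_integral_indicator[OF A(1) measure_pos_imp_finite[OF A(2)]] A(2) one_in_Linf
          by (simp add: \<phi>_def avg_def)
      qed
    qed
    then show ?thesis by simp
  qed
  show ?thesis
  proof (rule that[OF E_Linf _ _ _ E_one])
    show "\<forall>l\<in>Linf M. \<forall>a. integrable M a \<longrightarrow> E (Linf_act_L1 M l a) = (\<integral>x. l x * a x \<partial>M)"
      using E_act by blast
    show "\<forall>f\<in>Linf M. E f = E (\<lambda>x. indicator K x * f x)"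
      by (intro ballI E_loc KB) (use K in auto)
    show "\<forall>f\<in>Linf M. E f = E (\<lambda>x. indicator W x * f x)"
      by (intro ballI E_loc W) auto
  qed
qed

section \<open>A Borel set oscillating at the neutral element\<close>

text \<open>Neighbourhoods of 0 are infinite, and all points have the same mass.\<close>

lemma singleton_zero_null:
  assumes nd: "\<not> open {0::'g}"
  shows "emeasure M {0} = 0"
proof (rule ccontr)
  assume nz: "emeasure M {0} \<noteq> 0"
  obtain U K where U: "open U" "(0::'g) \<in> U" "U \<subseteq> K" "compact K"
    by (rule compact_neighbourhood_zero)
  have fin0: "emeasure M {0} < \<infinity>" by (rule emeasure_compact_finite) simp
  define c where "c = measure M {0}"
  have c: "0 < c" unfolding c_def using nz fin0 by (simp add: measure_def enn2real_positive_iff zero_less_iff_neq_zero)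
  have Kf: "emeasure M K < \<infinity>" by (rule emeasure_compact_finite[OF U(4)])
  have "infinite U"
  proof
    assume "finite U"
    then have "closed (U - {0})" by (intro finite_imp_closed) simp
    then have "open (U - (U - {0}))" using U(1) by (rule open_Diff[rotated])
    moreover have "U - (U - {0}) = {0}" using U(2) by blast
    ultimately show False using nd by simp
  qed
  obtain n where n: "measure M K < real n * c" using reals_Archimedean3[OF c] by blast
  obtain B where B: "finite B" "card B = n" "B \<subseteq> U"
    using infinite_arbitrarily_large[OF \<open>infinite U\<close>] by blast
  have single: "emeasure M {x} = ennreal c" for x :: 'g
  proof -
    have "emeasure M ((+) x ` {0}) = emeasure M {0}" by (rule emeasure_translate_image) simp
    then show ?thesis unfolding c_def using fin0 by (simp add: emeasure_eq_ennreal_measure less_top)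
  qed
  have "emeasure M B = (\<Sum>x\<in>B. emeasure M {x})"
    by (rule emeasure_eq_sum_singleton[OF B(1)]) simp
  also have "\<dots> = ennreal (real n * c)" using single c B(2) by (simp add: ennreal_of_nat_eq_real_of_nat ennreal_mult)
  finally have "ennreal (real n * c) = emeasure M B" ..
  also have "\<dots> \<le> emeasure M K" using B U borel_compact[OF U(4)] by (intro emeasure_mono) auto
  also have "\<dots> = ennreal (measure M K)" using Kf by (intro emeasure_eq_ennreal_measure) (auto simp: less_top)
  finally show False using n c by (simp add: ennreal_le_iff)
qed

text \<open>The step in the construction of a sequence \<open>V\<^sub>n\<close> with \<open>V\<^sub>n\<^sub>+\<^sub>1 + V\<^sub>n\<^sub>+\<^sub>1 \<subseteq> V\<^sub>n\<close>. Keeping the sums in a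
  set \<open>W\<close> of smaller measure makes the measures decrease strictly.\<close>

lemma halving_neighbourhood:
  assumes nd: "\<not> open {0::'g}" and V: "open V" "(0::'g) \<in> V"
  shows "\<exists>V'. (open V' \<and> 0 \<in> V') \<and> (\<forall>x\<in>V'. - x \<in> V') \<and>
    (\<exists>W. emeasure M W < emeasure M V \<and> W \<in> sets borel \<and> (\<forall>x\<in>V'. \<forall>y\<in>V'. x + y \<in> V \<inter> W))"
proof -
  have "emeasure M {0} < emeasure M V" using singleton_zero_null[OF nd] open_measure_pos[OF V] by simp
  then obtain W where W: "open W" "{0} \<subseteq> W" "emeasure M W < emeasure M V"
    using outer_regular[of "{0}"] by auto
  have "open ((\<lambda>p. fst p + snd p) -` (V \<inter> W))"
    by (rule open_vimage) (use V W in \<open>auto intro!: continuous_intros\<close>)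
  moreover have "(0, 0) \<in> (\<lambda>p. fst p + snd p) -` (V \<inter> W)" using V W by auto
  ultimately obtain A B where AB: "open A" "open B" "(0, 0) \<in> A \<times> B" "A \<times> B \<subseteq> (\<lambda>p. fst p + snd p) -` (V \<inter> W)"
    by (rule open_prod_elim)
  have cm: "continuous_on UNIV (uminus :: 'g \<Rightarrow> 'g)" by (intro continuous_intros)
  let ?V = "(A \<inter> B) \<inter> uminus -` (A \<inter> B)"
  have "open ?V" using AB by (intro open_Int open_vimage cm)
  moreover have "0 \<in> ?V" using AB by auto
  moreover have "\<forall>x\<in>?V. - x \<in> ?V" by auto
  moreover have "\<forall>x\<in>?V. \<forall>y\<in>?V. x + y \<in> V \<inter> W"
  proof (intro ballI)
    fix x y assume "x \<in> ?V" "y \<in> ?V"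
    then have "(x, y) \<in> A \<times> B" by auto
    then have "(x, y) \<in> (\<lambda>p. fst p + snd p) -` (V \<inter> W)" using AB(4) by blast
    then show "x + y \<in> V \<inter> W" by simp
  qed
  ultimately show ?thesis using W(1,3) by (intro exI[of _ ?V] conjI exI[of _ W]) auto
qed

text \<open>If the group had a countable base at 0, then the union of every second shell \<open>V\<^sub>n - V\<^sub>n\<^sub>+\<^sub>1\<close> of a
  shrinking sequence of neighbourhoods would do. In general the sequence shrinks only to a compact
  subgroup \<open>N\<close>. The neighbourhoods \<open>S\<^sub>n = N + V\<^sub>n\<close> of \<open>N\<close> are invariant under left translation by \<open>N\<close>, and
  so is the union \<open>W\<close> of every second shell \<open>S\<^sub>n - S\<^sub>n\<^sub>+\<^sub>1\<close>. If \<open>U \<inter> W\<close> were null for a neighbourhood \<open>U\<close>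
  of 0, then by invariance the finitely many translates of \<open>U\<close> that cover \<open>N\<close> would also meet \<open>W\<close> in
  null sets. But they contain some \<open>V\<^sub>m\<close> and with it shells of positive measure. The same applies
  to the complement of \<open>W\<close>.\<close>

lemma oscillating_set:
  assumes nd: "\<not> open {0::'g}"
  obtains W where "W \<in> sets borel"
    "\<And>U. open U \<Longrightarrow> 0 \<in> U \<Longrightarrow> 0 < emeasure M (U \<inter> W)"
    "\<And>U. open U \<Longrightarrow> 0 \<in> U \<Longrightarrow> 0 < emeasure M (U \<inter> - W)"
proof -
  obtain U0 K0 where U0: "open U0" "(0::'g) \<in> U0" "U0 \<subseteq> K0" "compact K0"
    by (rule compact_neighbourhood_zero)
  define Q where "Q V V' \<longleftrightarrow> (\<forall>x\<in>V'. - x \<in> V') \<and>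
      (\<exists>W. emeasure M W < emeasure M V \<and> W \<in> sets borel \<and> (\<forall>x\<in>V'. \<forall>y\<in>V'. x + y \<in> V \<inter> W))" for V V' :: "'g set"
  have "\<exists>V. \<forall>n. (open (V n) \<and> 0 \<in> V n \<and> (n = 0 \<longrightarrow> V n = U0)) \<and> Q (V n) (V (Suc n))"
  proof (rule dependent_nat_choice[of "\<lambda>n V. open V \<and> 0 \<in> V \<and> (n = 0 \<longrightarrow> V = U0)" "\<lambda>_ V V'. Q V V'"])
    show "\<exists>V. open V \<and> 0 \<in> V \<and> ((0::nat) = 0 \<longrightarrow> V = U0)" using U0 by blast
    show "\<exists>V'. (open V' \<and> 0 \<in> V' \<and> (Suc n = 0 \<longrightarrow> V' = U0)) \<and> Q V V'"
      if "open V \<and> 0 \<in> V \<and> (n = 0 \<longrightarrow> V = U0)" for V n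
      using halving_neighbourhood[OF nd, of V] that unfolding Q_def by auto
  qed
  then obtain V :: "nat \<Rightarrow> 'g set" where V: "\<And>n. open (V n)" "\<And>n. 0 \<in> V n" "V 0 = U0" "\<And>n. Q (V n) (V (Suc n))"
    by blast
  have neg: "- x \<in> V (Suc n)" if "x \<in> V (Suc n)" for x n using V(4)[of n] that unfolding Q_def by blast
  have add: "x + y \<in> V n" if "x \<in> V (Suc n)" "y \<in> V (Suc n)" for x y n using V(4)[of n] that unfolding Q_def by blast
  have dec1: "V (Suc n) \<subseteq> V n" for n using add[of _ n 0] V(2)[of "Suc n"] by auto
  have dec: "V n \<subseteq> V m" if "m \<le> n" for m n using that dec1 by (rule lift_Suc_antimono_le[rotated])
  have clo: "closure (V (Suc n)) \<subseteq> V n" for n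
  proof
    fix x assume x: "x \<in> closure (V (Suc n))"
    have "open ((\<lambda>y. - x + y) -` V (Suc n))" by (rule open_vimage[OF V(1)]) (intro continuous_intros)
    moreover have "x \<in> (\<lambda>y. - x + y) -` V (Suc n)" using V(2) by simp
    ultimately have "V (Suc n) \<inter> (\<lambda>y. - x + y) -` V (Suc n) \<noteq> {}"
      using x unfolding closure_iff_nhds_not_empty by (metis Int_commute subset_refl)
    then obtain y where y: "y \<in> V (Suc n)" "- x + y \<in> V (Suc n)" by auto
    have "y + - (- x + y) \<in> V n" by (rule add[OF y(1) neg[OF y(2)]])
    then show "x \<in> V n" by (simp add: minus_add add.assoc[symmetric])
  qed
  \<comment> \<open>A compact subgroup, reduced to a point only if the topology is metrizable.\<close>
  define N where "N = (\<Inter>n. V n)"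
  have N0: "0 \<in> N" unfolding N_def using V(2) by blast
  have Nneg: "- g \<in> N" if "g \<in> N" for g
  proof -
    have "- g \<in> V n" for n using that neg[of g n] dec1[of n] unfolding N_def by blast
    then show ?thesis unfolding N_def by blast
  qed
  have Nadd: "g + h \<in> N" if "g \<in> N" "h \<in> N" for g h
    using that add unfolding N_def by blast
  \<comment> \<open>By compactness the sets \<open>V n\<close> form a neighbourhood base of the subgroup \<open>N\<close>.\<close>
  have absorb: "\<exists>m. V m \<subseteq> W" if W: "open W" "N \<subseteq> W" for W
  proof -
    let ?C = "closure (V (Suc 0)) - W"
    have "closure (V (Suc 0)) \<subseteq> K0" using clo[of 0] V(3) U0(3) by auto
    then have "compact (K0 \<inter> closure (V (Suc 0)))" "K0 \<inter> closure (V (Suc 0)) = closure (V (Suc 0))"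
      using compact_Int_closed[OF U0(4) closed_closure] by auto
    then have comp: "compact ?C" using compact_diff[OF _ W(1)] by metis
    have cov: "?C \<subseteq> (\<Union>n\<in>UNIV. - closure (V (Suc n)))"
    proof
      fix x assume "x \<in> ?C"
      then have "x \<notin> N" using W(2) by blast
      then obtain n where "x \<notin> V n" unfolding N_def by blast
      then show "x \<in> (\<Union>n\<in>UNIV. - closure (V (Suc n)))" using clo[of n] by blast
    qed
    obtain D where D: "D \<subseteq> UNIV" "finite D" "?C \<subseteq> (\<Union>n\<in>D. - closure (V (Suc n)))"
      by (rule compactE_image[OF comp _ cov]) auto
    define m where "m = Max (insert 0 D)"
    have le: "n \<le> m" if "n \<in> D" for n unfolding m_def using D(2) that by simp
    have "V (Suc m) \<subseteq> W"
    proof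
      fix x assume x: "x \<in> V (Suc m)"
      show "x \<in> W"
      proof (rule ccontr)
        assume "x \<notin> W"
        moreover have "x \<in> closure (V (Suc 0))" using x dec[of "Suc 0" "Suc m"] closure_subset[of "V (Suc 0)"] by auto
        ultimately obtain n where n: "n \<in> D" "x \<notin> closure (V (Suc n))" using D(3) by blast
        have "x \<in> V (Suc n)" using x dec[of "Suc n" "Suc m"] le[OF n(1)] by auto
        then show False using n(2) closure_subset[of "V (Suc n)"] by blast
      qed
    qed
    then show ?thesis by blast
  qed
  have Ncomp: "compact N"
  proof -
    have "x \<in> K0 \<inter> (\<Inter>n. closure (V (Suc n)))" if "x \<in> N" for x
    proof -
      have xV: "x \<in> V n" for n using that unfolding N_def by blast
      then have "x \<in> closure (V (Suc n))" for n using closure_subset by (rule rev_subsetD)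
      moreover have "x \<in> K0" using xV[of 0] V(3) U0(3) by blast
      ultimately show ?thesis by blast
    qed
    moreover have "x \<in> N" if "x \<in> K0 \<inter> (\<Inter>n. closure (V (Suc n)))" for x
    proof -
      have "x \<in> V n" for n using that clo[of n] by blast
      then show ?thesis unfolding N_def by blast
    qed
    ultimately have "N = K0 \<inter> (\<Inter>n. closure (V (Suc n)))" by blast
    moreover have "closed (\<Inter>n. closure (V (Suc n)))" by (rule closed_INT) simp
    ultimately show ?thesis using compact_Int_closed[OF U0(4)] by metis
  qed
  define S where "S n = (\<Union>g\<in>N. (+) g ` V n)" for n
  have Sop: "open (S n)" for n
    unfolding S_def translate_image_eq_vimage by (intro open_UN ballI open_vimage[OF V(1)] continuous_translate)
  have Sinv1: "g + x \<in> S n" if gx: "g \<in> N" "x \<in> S n" for g x n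
  proof -
    obtain h v where hv: "h \<in> N" "v \<in> V n" "x = h + v" using gx(2) unfolding S_def by blast
    have "(g + h) + v \<in> S n" unfolding S_def using Nadd[OF gx(1) hv(1)] hv(2) by blast
    then show ?thesis using hv(3) by (simp add: add.assoc)
  qed
  have Sinv: "g + x \<in> S n \<longleftrightarrow> x \<in> S n" if "g \<in> N" for g x n
    using Sinv1[OF that] Sinv1[OF Nneg[OF that], of "g + x" n] by (auto simp: add.assoc[symmetric])
  have VS: "V n \<subseteq> S n" for n unfolding S_def using N0 by force
  have SV: "S (Suc n) \<subseteq> V n" for n
    unfolding S_def N_def using add by blast
  have Sdec: "S n \<subseteq> S m" if "m \<le> n" for m n
  proof -
    have "S (Suc k) \<subseteq> S k" for k using SV VS by blast
    then show ?thesis using that by (rule lift_Suc_antimono_le)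
  qed
  have Slt: "emeasure M (S (Suc n)) < emeasure M (S n)" for n
  proof -
    obtain W where W: "emeasure M W < emeasure M (V n)" "W \<in> sets borel" "\<And>x y. x \<in> V (Suc n) \<Longrightarrow> y \<in> V (Suc n) \<Longrightarrow> x + y \<in> W"
      using V(4)[of n] unfolding Q_def by blast
    have "S (Suc n) \<subseteq> W" unfolding S_def N_def using W(3) by blast
    then have "emeasure M (S (Suc n)) \<le> emeasure M W" using W(2) by (intro emeasure_mono) auto
    also have "\<dots> < emeasure M (V n)" by (rule W(1))
    also have "\<dots> \<le> emeasure M (S n)" using VS Sop by (intro emeasure_mono) auto
    finally show ?thesis .
  qed
  have shell: "0 < emeasure M (S n - S (Suc n))" for n
  proof (rule ccontr)
    assume "\<not> 0 < emeasure M (S n - S (Suc n))"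
    then have z: "emeasure M (S n - S (Suc n)) = 0" by simp
    have "emeasure M (S n) \<le> emeasure M (S (Suc n) \<union> (S n - S (Suc n)))"
      by (rule emeasure_mono) (use Sop in \<open>auto intro!: sets.Un sets.Diff\<close>)
    also have "\<dots> \<le> emeasure M (S (Suc n)) + emeasure M (S n - S (Suc n))"
      by (rule emeasure_subadditive) (use Sop in \<open>auto intro!: sets.Diff\<close>)
    finally show False using z Slt[of n] by simp
  qed
  \<comment> \<open>Stated for every invariant set with arbitrarily late shells, so as to apply to \<open>W\<close> and \<open>- W\<close>.\<close>
  have main: "0 < emeasure M (U \<inter> W)"
    if W: "W \<in> sets borel" "\<And>g x. g \<in> N \<Longrightarrow> g + x \<in> W \<longleftrightarrow> x \<in> W" "\<And>m. \<exists>n\<ge>m. S n - S (Suc n) \<subseteq> W"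
      and U: "open U" "0 \<in> U" for U W
  proof (rule ccontr)
    assume "\<not> 0 < emeasure M (U \<inter> W)"
    then have z: "emeasure M (U \<inter> W) = 0" by simp
    have UW: "U \<inter> W \<in> sets borel" using W U by auto
    have op: "open ((+) g ` U)" for g
      unfolding translate_image_eq_vimage by (rule open_vimage[OF U(1) continuous_translate])
    obtain D where D: "D \<subseteq> N" "finite D" "N \<subseteq> (\<Union>g\<in>D. (+) g ` U)"
    proof (rule compactE_image[OF Ncomp, of N "\<lambda>g. (+) g ` U"])
      show "open ((+) g ` U)" for g by (rule op)
      show "N \<subseteq> (\<Union>g\<in>N. (+) g ` U)"
      proof
        fix g assume "g \<in> N"
        moreover have "g \<in> (+) g ` U" using U(2) by (intro image_eqI[of _ _ 0]) auto
        ultimately show "g \<in> (\<Union>g\<in>N. (+) g ` U)" by blast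
      qed
    qed
    let ?O = "\<Union>g\<in>D. (+) g ` U"
    have "open ?O" by (intro open_UN ballI op)
    then obtain m where m: "V m \<subseteq> ?O" using absorb D(3) by blast
    obtain n where n: "n \<ge> Suc m" "S n - S (Suc n) \<subseteq> W" using W(3) by blast
    have im: "(+) g ` U \<inter> W = (+) g ` (U \<inter> W)" if "g \<in> N" for g using W(2)[OF that] by auto
    have "S n - S (Suc n) \<subseteq> ?O \<inter> W" using n(2) Sdec[OF n(1)] SV[of m] m by blast
    then have "emeasure M (S n - S (Suc n)) \<le> emeasure M (?O \<inter> W)"
      by (rule emeasure_mono) (use \<open>open ?O\<close> W(1) in \<open>auto intro!: sets.Int\<close>)
    also have "?O \<inter> W = (\<Union>g\<in>D. (+) g ` (U \<inter> W))" using im D(1) by blast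
    also have "emeasure M \<dots> \<le> (\<Sum>g\<in>D. emeasure M ((+) g ` (U \<inter> W)))"
    proof (rule emeasure_subadditive_finite[OF D(2)], rule image_subsetI)
      fix g assume "g \<in> D"
      then have "(+) g ` (U \<inter> W) = (+) g ` U \<inter> W" using im D(1) by blast
      then show "(+) g ` (U \<inter> W) \<in> sets M" using op[of g] W(1) by auto
    qed
    also have "\<dots> = 0" using emeasure_translate_image[OF UW] z by simp
    finally show False using shell[of n] by simp
  qed
  define W where "W = (\<Union>n. S (2 * n) - S (Suc (2 * n)))"
  have WB: "W \<in> sets borel" unfolding W_def using Sop by (intro sets.countable_UN) auto
  have Winv: "g + x \<in> W \<longleftrightarrow> x \<in> W" if "g \<in> N" for g x unfolding W_def using Sinv[OF that] by auto
  have odd: "S (Suc (2 * m)) - S (Suc (Suc (2 * m))) \<subseteq> - W" for m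
  proof (rule subsetI, rule ComplI)
    fix x assume x: "x \<in> S (Suc (2 * m)) - S (Suc (Suc (2 * m)))" "x \<in> W"
    then obtain n where n: "x \<in> S (2 * n)" "x \<notin> S (Suc (2 * n))" unfolding W_def by blast
    show False
    proof (cases "n \<le> m")
      case True
      then show False using Sdec[of "Suc (2 * n)" "Suc (2 * m)"] x(1) n(2) by auto
    next
      case False
      then show False using Sdec[of "Suc (Suc (2 * m))" "2 * n"] x(1) n(1) by auto
    qed
  qed
  show ?thesis
  proof (rule that[OF WB])
    fix U :: "'g set" assume U: "open U" "0 \<in> U"
    show "0 < emeasure M (U \<inter> W)"
    proof (rule main[OF WB Winv _ U])
      show "\<exists>n\<ge>m. S n - S (Suc n) \<subseteq> W" for m by (rule exI[of _ "2 * m"]) (auto simp: W_def)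
    qed
    show "0 < emeasure M (U \<inter> - W)"
    proof (rule main[OF _ _ _ U])
      show "- W \<in> sets borel" using WB by (rule borel_comp)
      show "g + x \<in> - W \<longleftrightarrow> x \<in> - W" if "g \<in> N" for g x using Winv[OF that] by simp
      show "\<exists>n\<ge>m. S n - S (Suc n) \<subseteq> - W" for m by (rule exI[of _ "Suc (2 * m)"]) (use odd in auto)
    qed
  qed
qed

section \<open>Trivolutions\<close>

lemma Linf0_dual_compact_carrier:
  assumes F: "F \<in> Linf_dual M" "compact_carrier M F"
  shows "F \<in> Linf0_dual M"
proof -
  have "Linf_norm M (\<lambda>x. 0) \<le> 0" by (rule Linf_norm_le) (auto simp: loc_AE_def)
  then have "{f \<in> Linf M. Linf_norm M f \<le> 1} \<noteq> {}" using zero_in_Linf by force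
  then have "Linf_dual_norm M (\<lambda>f. F f - F f) = 0" unfolding Linf_dual_norm_def by simp
  then show ?thesis unfolding Linf0_dual_def using F by force
qed

lemma Linf_dual_diff:
  assumes F: "F \<in> Linf_dual M" and G: "G \<in> Linf_dual M"
  shows "(\<lambda>f. F f - G f) \<in> Linf_dual M"
proof -
  obtain B1 where B1: "\<forall>f\<in>Linf M. norm (F f) \<le> B1 * Linf_norm M f" using F unfolding Linf_dual_def by blast
  obtain B2 where B2: "\<forall>f\<in>Linf M. norm (G f) \<le> B2 * Linf_norm M f" using G unfolding Linf_dual_def by blast
  have "norm (F f - G f) \<le> (B1 + B2) * Linf_norm M f" if "f \<in> Linf M" for f
    using norm_triangle_ineq4[of "F f" "G f"] B1 B2 that by (force simp: distrib_right)
  then have "\<exists>B. \<forall>f\<in>Linf M. norm (F f - G f) \<le> B * Linf_norm M f" by blast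
  moreover have "F f - G f = 0" if "f \<notin> Linf M" for f using F G that by (simp add: Linf_dual_def)
  ultimately show ?thesis unfolding Linf_dual_def
    by (auto simp: Linf_dual_add[OF F] Linf_dual_add[OF G] Linf_dual_scale[OF F] Linf_dual_scale[OF G] right_diff_distrib)
qed

text \<open>Two right identities with compact carrier that differ on the indicator of the oscillating set;
  their difference annihilates every \<open>l \<cdot> a\<close>.\<close>

lemma right_identity_and_annihilator:
  assumes nd: "\<not> open {0::'g}"
  obtains E N where "E \<in> Linf0_dual M" "N \<in> Linf0_dual M" "N \<noteq> (\<lambda>f. 0)"
    "\<And>F. F \<in> Linf_dual M \<Longrightarrow> arens M F E = F"
    "\<And>F. F \<in> Linf_dual M \<Longrightarrow> arens M F N = (\<lambda>f. 0)"
proof -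
  obtain W where W: "W \<in> sets borel"
    "\<And>U. open U \<Longrightarrow> 0 \<in> U \<Longrightarrow> 0 < emeasure M (U \<inter> W)"
    "\<And>U. open U \<Longrightarrow> 0 \<in> U \<Longrightarrow> 0 < emeasure M (U \<inter> - W)"
    using oscillating_set[OF nd] by blast
  have W': "- W \<in> sets borel" using W(1) by (rule borel_comp)
  obtain U K where U: "open U" "(0::'g) \<in> U" "U \<subseteq> K" "compact K"
    by (rule compact_neighbourhood_zero)
  obtain E1 where E1: "E1 \<in> Linf_dual M"
    "\<forall>l\<in>Linf M. \<forall>a. integrable M a \<longrightarrow> E1 (Linf_act_L1 M l a) = (\<integral>x. l x * a x \<partial>M)"
    "\<forall>f\<in>Linf M. E1 f = E1 (\<lambda>x. indicator K x * f x)"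
    "\<forall>f\<in>Linf M. E1 f = E1 (\<lambda>x. indicator W x * f x)"
    "E1 (\<lambda>x. 1) = 1"
    by (rule cluster_point_of_averages[OF W(1,2) U(4,1,2,3)])
  obtain E2 where E2: "E2 \<in> Linf_dual M"
    "\<forall>l\<in>Linf M. \<forall>a. integrable M a \<longrightarrow> E2 (Linf_act_L1 M l a) = (\<integral>x. l x * a x \<partial>M)"
    "\<forall>f\<in>Linf M. E2 f = E2 (\<lambda>x. indicator K x * f x)"
    "\<forall>f\<in>Linf M. E2 f = E2 (\<lambda>x. indicator (- W) x * f x)"
    "E2 (\<lambda>x. 1) = 1"
    by (rule cluster_point_of_averages[OF W' W(3) U(4,1,2,3)])
  note E1 = E1(1) E1(2-4)[rule_format] E1(5) and E2 = E2(1) E2(2-4)[rule_format] E2(5)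
  define N where "N f = E1 f - E2 f" for f
  have N_dual: "N \<in> Linf_dual M"
    using Linf_dual_diff[OF E1(1) E2(1)] unfolding N_def[abs_def] .
  have "compact_carrier M E1" unfolding compact_carrier_def using U(4) E1(3) by blast
  then have E1_0: "E1 \<in> Linf0_dual M" by (rule Linf0_dual_compact_carrier[OF E1(1)])
  have "N f = N (\<lambda>x. indicator K x * f x)" if "f \<in> Linf M" for f
    unfolding N_def E1(3)[OF that, symmetric] E2(3)[OF that, symmetric] ..
  then have "compact_carrier M N" unfolding compact_carrier_def using U(4) by blast
  then have N_0: "N \<in> Linf0_dual M" by (rule Linf0_dual_compact_carrier[OF N_dual])
  have iW: "(\<lambda>x. indicator W x) \<in> Linf M" using indicator_in_Linf[OF W(1)] by simp
  have "E1 (\<lambda>x. indicator W x) = 1" using E1(4)[OF one_in_Linf] E1(5) by simp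
  moreover have "E2 (\<lambda>x. indicator W x) = 0"
  proof -
    have "E2 (\<lambda>x. indicator W x) = E2 (\<lambda>x. indicator (- W) x * indicator W x)" by (rule E2(4)[OF iW])
    also have "(\<lambda>x. indicator (- W) x * indicator W x) = (\<lambda>x. 0 * (0::complex))" by (auto simp: indicator_def)
    also have "E2 \<dots> = 0 * E2 (\<lambda>x. 0)" by (rule Linf_dual_scale[OF E2(1) zero_in_Linf])
    finally show ?thesis by simp
  qed
  ultimately have "N (\<lambda>x. indicator W x) = 1" by (simp add: N_def)
  then have N_ne: "N \<noteq> (\<lambda>f. 0)" by auto
  show ?thesis
  proof (rule that[OF E1_0 N_0 N_ne])
    fix F assume F: "F \<in> Linf_dual M"
    show "arens M F E1 = F" by (rule arens_right_identity[OF E1(2) F])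
    show "arens M F N = (\<lambda>f. 0)"
      by (rule arens_right_annihilator[OF _ F]) (simp add: N_def E1(2) E2(2))
  qed
qed

text \<open>The range of \<open>\<tau>\<close> contains the right identity, so \<open>\<tau>\<close> maps a right annihilator to an element
  annihilated by that right identity, that is, to 0.\<close>

lemma no_trivolution_onto:
  assumes nd: "\<not> open {0::'g}" and X: "X \<subseteq> Linf_dual M" and Y: "Linf0_dual M \<subseteq> Y" "Y \<subseteq> X"
  shows "\<not> trivolution_onto M X Y \<tau>"
proof
  assume *: "trivolution_onto M X Y \<tau>"
  then have img: "\<tau> ` X = Y" and
    scale: "\<And>c F. F \<in> X \<Longrightarrow> \<tau> (\<lambda>f. c * F f) = (\<lambda>f. cnj c * \<tau> F f)" and
    anti: "\<And>F G. F \<in> X \<Longrightarrow> G \<in> X \<Longrightarrow> \<tau> (arens M F G) = arens M (\<tau> G) (\<tau> F)" and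
    cube: "\<And>F. F \<in> X \<Longrightarrow> \<tau> (\<tau> (\<tau> F)) = \<tau> F"
    by (auto simp: trivolution_onto_def trivolution_def)
  obtain E N where EN: "E \<in> Linf0_dual M" "N \<in> Linf0_dual M" "N \<noteq> (\<lambda>f. 0)"
    "\<And>F. F \<in> Linf_dual M \<Longrightarrow> arens M F E = F"
    "\<And>F. F \<in> Linf_dual M \<Longrightarrow> arens M F N = (\<lambda>f. 0)"
    using right_identity_and_annihilator[OF nd] by blast
  have EY: "E \<in> Y" and NY: "N \<in> Y" using EN(1,2) Y(1) by auto
  have NX: "N \<in> X" using NY Y(2) by auto
  have zero: "\<tau> (\<lambda>f. 0) = (\<lambda>f. 0)" using scale[OF NX, of 0] by simp
  obtain F where F: "F \<in> X" "\<tau> F = E" using img EY by blast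
  obtain Z where Z: "Z \<in> X" "\<tau> Z = N" using img NY by blast
  have \<tau>N: "\<tau> N \<in> Linf_dual M" using img NX Y(2) X by blast
  have "\<tau> N = arens M (\<tau> N) (\<tau> F)" using EN(4)[OF \<tau>N] F(2) by simp
  also have "\<dots> = \<tau> (arens M F N)" using anti[OF F(1) NX] by simp
  also have "arens M F N = (\<lambda>f. 0)" using EN(5) F(1) X by blast
  finally have "\<tau> N = (\<lambda>f. 0)" using zero by simp
  then have "\<tau> (\<tau> (\<tau> Z)) = (\<lambda>f. 0)" using Z(2) zero by simp
  then have "N = (\<lambda>f. 0)" using cube[OF Z(1)] Z(2) by simp
  with EN(3) show False by simp
qed

end

lemma discrete_if_zero_isolated:
  assumes "open {0 :: 'g::topological_group_add}"
  shows "(euclidean :: 'g topology) = discrete_topology UNIV"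
proof -
  have "open {g}" for g :: 'g
  proof -
    have "open ((\<lambda>x. - g + x) -` {0})" by (rule open_vimage[OF assms]) (intro continuous_intros)
    moreover have "(\<lambda>x. - g + x) -` {0} = {g}" by (auto simp: neg_eq_iff_add_eq_0[symmetric])
    ultimately show ?thesis by simp
  qed
  then have "open S" for S :: "'g set" by (metis UN_singleton open_UN)
  then show ?thesis by (simp add: topology_eq)
qed

theorem theorem4p3:
  fixes M :: "'g::{topological_group_add, t2_space} measure"
  assumes "locally_compact_space (euclidean :: 'g topology)"
    and "(euclidean :: 'g topology) \<noteq> discrete_topology UNIV"
    and "left_haar_measure M"
  shows "(\<forall>X Y. arens_subalgebra M X \<and> arens_subalgebra M Y \<and> Linf0_dual M \<subseteq> Y \<and> Y \<subseteq> X
            \<longrightarrow> (\<nexists>\<tau>. trivolution_onto M X Y \<tau>))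
       \<and> (\<nexists>\<tau>. trivolution_onto M (Linf_dual M) (Linf0_dual M) \<tau>)"
proof -
  interpret haar_group M using assms(1,3) by unfold_locales
  have nd: "\<not> open {0::'g}" using discrete_if_zero_isolated assms(2) by blast
  show ?thesis
  proof (intro conjI allI impI)
    fix X Y assume "arens_subalgebra M X \<and> arens_subalgebra M Y \<and> Linf0_dual M \<subseteq> Y \<and> Y \<subseteq> X"
    then show "\<nexists>\<tau>. trivolution_onto M X Y \<tau>"
      using no_trivolution_onto[OF nd, of X Y] by (auto simp: arens_subalgebra_def)
  next
    have "Linf0_dual M \<subseteq> Linf_dual M" by (auto simp: Linf0_dual_def)
    then show "\<nexists>\<tau>. trivolution_onto M (Linf_dual M) (Linf0_dual M) \<tau>"
      using no_trivolution_onto[OF nd, of "Linf_dual M" "Linf0_dual M"] by auto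
  qed
qed

end
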